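(* Let $\mathcal U\subset\mathbb R^n$ be an open bounded convex set with $B(0,1)\subset\mathcal U\subset B(0,n)$, and let $u:\overline{\mathcal U}\to\mathbb R$ be a convex function, $C^2$ in $\mathcal U$ and continuous up to the boundary, solving $$0<\lambda\le\det D^2u\le\Lambda\ \text{ in }\mathcal U,\qquad u=0\ \text{ on }\partial\mathcal U,$$ for some constants $\lambda,\Lambda>0$. Then for every $k\in\mathbb N\cup\{0\}$ there exists a constant $C=C(k,n,\lambda,\Lambda)$ such that $$\int_{\mathcal U/2}\|D^2u\|\log^{k+1}\big(2+\|D^2u\|\big)\le C\int_{3\mathcal U/4}\|D^2u\|\log^{k}\big(2+\|D^2u\|\big).$$
   Context: $\|D^2u\|$ is the operator norm of the Hessian. Let $x_0$ be the (unique) minimum point of $u$ in $\mathcal U$, so that $\mathcal U$ is the section $\{y: u(y)\le u(x_0)+\nabla u(x_0)\cdot(y-x_0)+t\}$ with $t=-u(x_0)$. For $\tau>0$, $\tau\mathcal U$ denotes the dilation of $\mathcal U$ by factor $\tau$ with respect to $x_0$: $\tau\mathcal U=\{y\in\mathbb R^n: x_0+(y-x_0)/\tau\in\mathcal U\}$. *)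

theory Defs
  imports "HOL-Analysis.Analysis"
begin

definition grad :: "(real^'n \<Rightarrow> real) \<Rightarrow> real^'n \<Rightarrow> real^'n" where
  "grad u x = (\<chi> i. frechet_derivative u (at x) (axis i 1))"

definition hessian :: "(real^'n \<Rightarrow> real) \<Rightarrow> real^'n \<Rightarrow> real^'n^'n" where
  "hessian u x = matrix (frechet_derivative (grad u) (at x))"

definition C2_on :: "(real^'n) set \<Rightarrow> (real^'n \<Rightarrow> real) \<Rightarrow> bool" where
  "C2_on U u \<longleftrightarrow> (\<forall>x\<in>U. u differentiable (at x)) \<and> (\<forall>x\<in>U. grad u differentiable (at x))
      \<and> continuous_on U (hessian u)"

definition mnorm :: "real^'n^'n \<Rightarrow> real" where
  "mnorm A = onorm (\<lambda>h. A *v h)"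

definition dilate :: "real \<Rightarrow> real^'n \<Rightarrow> (real^'n) set \<Rightarrow> (real^'n) set" where
  "dilate \<tau> x0 U = {y. x0 + (1/\<tau>) *\<^sub>R (y - x0) \<in> U}"

end

(* For x in U consider the sections S(x,t) = {z. D x z < t} of the Bregman distance
   D x z = u z - u x - grad u x . (z - x). By Alexandrov's maximum principle and the upper bound on
   det, the set of slopes of the cone over S with vertex y has measure at most Lam |S|; the lower
   bound on det gives lam |S| <= C t^n |(S - S)^o|, where K^o is the polar of K. Comparing the polars
   (S - y)^o and (S - S)^o shows that S is balanced: y + c (S - S) is contained in S whenever
   D x y <= t/2. Engulfing, shrinking of sections, and interior estimates up to sections of a fixed
   height all follow from this statement alone.

   On a section, integrating second derivatives along segments bounds the integral of |D^2 u| by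
   alpha |S|; together with det D^2 u >= lam, applied in a maximal frame of S - S, this forces
   |D^2 u| >= alpha / C on half of S. Stopping the sections at the last height where the mean of
   |D^2 u| exceeds gamma / 2 and applying a Vitali covering gives
     int_{U/2, |D^2 u| >= gamma} |D^2 u| <= C gamma |{x in 3U/4. |D^2 u| >= gamma / C}|
   for large gamma, and a weighted sum over gamma = 2^j yields the theorem. *)

theory Submission
  imports Defs
begin

text \<open>The final constant has to be uniform over all \<open>U\<close>, \<open>u\<close> and
  \<open>x0\<close>, so every intermediate constant is an explicit function of n, \<open>lam\<close>
  and \<open>Lam\<close>. The two volume estimates meet through polars because the ratio of |(S -
  y)^o| to |(S - S)^o| does not change under affine maps; no section is ever normalised. The gain of
  exactly one logarithm comes from summation: log^(k+1) is a sum of increments of size (k+1) i^k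
  over the dyadic levels 2^i below |D^2 u|, while after the level set estimate the same weights
  multiply a geometric series in 2^i. That series is controlled by its last term and leaves only
  log^k. The level set estimate holds above a threshold only. Levels below it are absorbed by log(2
  + |D^2 u|) >= log 2, and the threshold itself is uniform because Alexandrov's estimate at the
  minimum point bounds the depth of \<open>u\<close> in terms of n and \<open>Lam\<close>.\<close>

section \<open>Change of variables without a well-ordered index type\<close>

text \<open>A well-ordered copy of the index type: the library states the change of variables theorem only
  for those.\<close>

typedef (overloaded) ('a::finite) idx = "{..<CARD('a)}"
  by (auto intro!: exI[of _ 0] simp: finite_UNIV_card_ge_0)

instantiation idx :: (finite) wellorder
begin
definition less_eq_idx :: "'a idx \<Rightarrow> 'a idx \<Rightarrow> bool" where "less_eq_idx x y \<longleftrightarrow> Rep_idx x \<le> Rep_idx y"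
definition less_idx :: "'a idx \<Rightarrow> 'a idx \<Rightarrow> bool" where "less_idx x y \<longleftrightarrow> Rep_idx x < Rep_idx y"
instance
proof
  fix x y z :: "'a idx"
  show "(x < y) = (x \<le> y \<and> \<not> y \<le> x)" by (auto simp: less_eq_idx_def less_idx_def)
  show "x \<le> x" by (simp add: less_eq_idx_def)
  show "x \<le> y \<Longrightarrow> y \<le> z \<Longrightarrow> x \<le> z" by (simp add: less_eq_idx_def)
  show "x \<le> y \<Longrightarrow> y \<le> x \<Longrightarrow> x = y" by (simp add: less_eq_idx_def Rep_idx_inject)
  show "x \<le> y \<or> y \<le> x" by (auto simp: less_eq_idx_def)
  fix P :: "'a idx \<Rightarrow> bool" and a
  assume step: "\<And>x. (\<And>y. y < x \<Longrightarrow> P y) \<Longrightarrow> P x"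
  have "wf (inv_image less_than (Rep_idx :: 'a idx \<Rightarrow> nat))" by auto
  then show "P a"
    by (induction a rule: wf_induct_rule) (auto simp: less_idx_def intro: step)
qed
end

instance idx :: (finite) finite
proof
  have "(UNIV :: 'a idx set) = Abs_idx ` {..<CARD('a)}"
    by (metis Rep_idx Rep_idx_inverse UNIV_eq_I imageI)
  then show "finite (UNIV :: 'a idx set)" by (metis finite_imageI finite_lessThan)
qed

lemma ex_bij_idx: "\<exists>b :: ('n::finite) idx \<Rightarrow> 'n. bij b"
proof -
  have "card (UNIV :: 'n idx set) = CARD('n)"
    using type_definition.card[OF type_definition_idx[where 'a='n]] by simp
  then show ?thesis
    by (metis finite_same_card_bij finite)
qed

text \<open>Conjugation by \<open>b\<close> turns the transposition of \<open>x\<close> and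
  \<open>y\<close> into that of \<open>b x\<close> and \<open>b y\<close>, so a product of k
  transpositions stays one and signs survive a change of index type.\<close>

lemma swapidseq_conj:
  fixes b :: "'m \<Rightarrow> 'n"
  assumes "swapidseq k p" "bij b"
  shows "swapidseq k (b \<circ> p \<circ> inv b)"
  using assms(1)
proof induction
  case id
  have "b \<circ> inv b = id" using bij_is_surj[OF assms(2)] unfolding surj_iff .
  then show ?case by (simp only: comp_id swapidseq.id)
next
  case (comp_Suc k p x y)
  have i: "b u = b v \<longleftrightarrow> u = v" for u v using assms(2) by (simp add: bij_is_inj inj_eq)
  have e: "b \<circ> (Transposition.transpose x y \<circ> p) \<circ> inv b = Transposition.transpose (b x) (b y) \<circ> (b \<circ> p \<circ> inv b)"
    using assms(2) by (auto simp: fun_eq_iff Transposition.transpose_def i bij_is_inj)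
  have "b x \<noteq> b y" using comp_Suc by (simp add: i)
  then show ?case unfolding e by (rule swapidseq.comp_Suc[OF comp_Suc.IH])
qed

lemma sign_conj:
  fixes b :: "'m::finite \<Rightarrow> 'n::finite"
  assumes "p permutes UNIV" "bij b"
  shows "sign (b \<circ> p \<circ> inv b) = sign p"
proof -
  have "permutation p" by (rule permutes_imp_permutation[OF _ assms(1)]) simp
  then obtain k where k: "swapidseq k p" unfolding permutation_def by blast
  have "evenperm (b \<circ> p \<circ> inv b) = even k" by (rule evenperm_unique[OF swapidseq_conj[OF k assms(2)] refl])
  moreover have "evenperm p = even k" by (rule evenperm_unique[OF k refl])
  ultimately show ?thesis by (simp add: sign_def)
qed

lemma bij_permutes_UNIV: "bij p \<longleftrightarrow> p permutes UNIV"
  by (metis UNIV_I bij_imp_permutes permutes_bij)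

text \<open>Conjugation by \<open>b\<close> is a sign-preserving bijection between the two
  permutation groups, so the Leibniz sums agree term by term.\<close>

lemma det_reindex:
  fixes A :: "real^'n^'n" and b :: "'m::finite \<Rightarrow> 'n::finite"
  assumes b: "bij b"
  shows "det (\<chi> i j. A $ b i $ b j) = det A"
proof -
  let ?c = "\<lambda>p. b \<circ> p \<circ> inv b"
  have bb: "bij_betw ?c {p. p permutes (UNIV::'m set)} {p. p permutes (UNIV::'n set)}"
  proof (rule bij_betw_byWitness[where f' = "\<lambda>p. inv b \<circ> p \<circ> b"])
    show "\<forall>p\<in>{p. p permutes (UNIV::'m set)}. inv b \<circ> (b \<circ> p \<circ> inv b) \<circ> b = p"
      using b by (auto simp: fun_eq_iff bij_is_inj)
    show "\<forall>p\<in>{p. p permutes (UNIV::'n set)}. b \<circ> (inv b \<circ> p \<circ> b) \<circ> inv b = p"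
      using b by (auto simp: fun_eq_iff bij_is_surj surj_f_inv_f)
    show "(\<lambda>p. b \<circ> p \<circ> inv b) ` {p. p permutes UNIV} \<subseteq> {p. p permutes UNIV}"
      unfolding bij_permutes_UNIV[symmetric] using b bij_imp_bij_inv[OF b] by (blast intro: bij_comp)
    show "(\<lambda>p. inv b \<circ> p \<circ> b) ` {p. p permutes UNIV} \<subseteq> {p. p permutes UNIV}"
      unfolding bij_permutes_UNIV[symmetric] using b bij_imp_bij_inv[OF b] by (blast intro: bij_comp)
  qed
  have "det A = (\<Sum>p | p permutes (UNIV::'m set). of_int (sign (?c p)) * (\<Prod>i\<in>UNIV. A $ i $ ?c p i))"
    unfolding det_def by (rule sum.reindex_bij_betw[OF bb, symmetric])
  also have "\<dots> = (\<Sum>p | p permutes (UNIV::'m set). of_int (sign p) * (\<Prod>i\<in>UNIV. A $ b i $ b (p i)))"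
  proof (rule sum.cong[OF refl])
    fix p assume "p \<in> {p. p permutes (UNIV::'m set)}"
    then have "sign (?c p) = sign p" using sign_conj b by auto
    moreover have "(\<Prod>i\<in>UNIV. A $ i $ ?c p i) = (\<Prod>i\<in>UNIV. A $ b i $ ?c p (b i))"
      by (rule prod.reindex_bij_betw[OF b, symmetric])
    ultimately show "of_int (sign (?c p)) * (\<Prod>i\<in>UNIV. A $ i $ ?c p i) = of_int (sign p) * (\<Prod>i\<in>UNIV. A $ b i $ b (p i))"
      using b by (simp add: bij_is_inj)
  qed
  finally show ?thesis by (simp add: det_def)
qed

lemma box_reindex:
  fixes b :: "'m::finite \<Rightarrow> 'n::finite"
  assumes b: "bij b"
  shows "(\<lambda>x::real^'n. \<chi> j. x $ b j) -` box l u = box (\<chi> i. l $ inv b i) (\<chi> i. u $ inv b i)"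
proof -
  have "(\<forall>j. l $ j < x $ b j \<and> x $ b j < u $ j) \<longleftrightarrow> (\<forall>i. l $ inv b i < x $ i \<and> x $ i < u $ inv b i)" for x :: "real^'n"
  proof (intro iffI allI)
    fix i assume "\<forall>j. l $ j < x $ b j \<and> x $ b j < u $ j"
    then have "l $ inv b i < x $ b (inv b i) \<and> x $ b (inv b i) < u $ inv b i" by blast
    then show "l $ inv b i < x $ i \<and> x $ i < u $ inv b i"
      using b by (simp add: bij_is_surj surj_f_inv_f)
  next
    fix j assume "\<forall>i. l $ inv b i < x $ i \<and> x $ i < u $ inv b i"
    then have "l $ inv b (b j) < x $ b j \<and> x $ b j < u $ inv b (b j)" by blast
    then show "l $ j < x $ b j \<and> x $ b j < u $ j" using b by (simp add: bij_is_inj)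
  qed
  then show ?thesis by (auto simp: mem_box_cart)
qed

text \<open>Lebesgue measure is determined by its values on boxes, and relabelling only permutes the
  side lengths of a box.\<close>

lemma lborel_reindex:
  fixes b :: "'m::finite \<Rightarrow> 'n::finite"
  assumes b: "bij b"
  shows "distr lborel lborel (\<lambda>x::real^'n. \<chi> j. x $ b j) = (lborel :: (real^'m) measure)"
proof (rule lborel_eqI[symmetric])
  have m: "(\<lambda>x::real^'n. \<chi> j. x $ b j) \<in> measurable lborel lborel"
    by (auto intro!: borel_measurable_continuous_onI continuous_intros)
  show "sets (distr lborel lborel (\<lambda>x::real^'n. \<chi> j. x $ b j)) = sets (borel :: (real^'m) measure)" by simp
  fix l u :: "real^'m"
  assume le: "\<And>i. i \<in> Basis \<Longrightarrow> l \<bullet> i \<le> u \<bullet> i"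
  have leb: "l $ i \<le> u $ i" for i using le[of "axis i 1"] by (auto simp: Basis_vec_def inner_axis)
  have P: "(\<Prod>i\<in>Basis. (u - l) \<bullet> i) = (\<Prod>i\<in>UNIV. (u $ i - l $ i))" for u l :: "real^'k::finite"
  proof -
    have "Basis = (\<lambda>i. axis i (1::real)) ` (UNIV :: 'k set)" by (auto simp: Basis_vec_def)
    moreover have "inj (\<lambda>i::'k. axis i (1::real))" by (auto simp: inj_def axis_eq_axis)
    ultimately have "(\<Prod>i\<in>Basis. (u - l) \<bullet> i) = (\<Prod>i\<in>UNIV. (u - l) \<bullet> axis i (1::real))"
      using prod.reindex[of "\<lambda>i::'k. axis i (1::real)" UNIV "\<lambda>i. (u - l) \<bullet> i"] by (simp add: comp_def)
    then show ?thesis by (simp add: prod.reindex inner_axis inner_diff_left)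
  qed
  have "emeasure (distr lborel lborel (\<lambda>x::real^'n. \<chi> j. x $ b j)) (box l u)
     = emeasure lborel (box (\<chi> i. l $ inv b i) (\<chi> i. u $ inv b i) :: (real^'n) set)"
    by (subst emeasure_distr[OF m]) (auto simp: box_reindex[OF b])
  also have "\<dots> = (\<Prod>i\<in>Basis. ((\<chi> i. u $ inv b i) - (\<chi> i. l $ inv b i)) \<bullet> i)"
    by (rule emeasure_lborel_box) (use leb in \<open>auto simp: Basis_vec_def inner_axis\<close>)
  also have "(\<Prod>i\<in>Basis. ((\<chi> i. u $ inv b i) - (\<chi> i. l $ inv b i)) \<bullet> i) = (\<Prod>i\<in>Basis. (u - l) \<bullet> i)"
    unfolding P using prod.reindex_bij_betw[OF bij_imp_bij_inv[OF b], of "\<lambda>i. u $ i - l $ i"] by simp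
  finally show "emeasure (distr lborel lborel (\<lambda>x::real^'n. \<chi> j. x $ b j)) (box l u) = (\<Prod>i\<in>Basis. (u - l) \<bullet> i)" .
qed

section \<open>Area formula with two-sided bounds on the Jacobian\<close>

abbreviation vol :: "'a::euclidean_space set \<Rightarrow> real" where "vol \<equiv> measure lebesgue"

lemma area_bounds_wellorder:
  fixes f :: "real^'m::{finite,wellorder} \<Rightarrow> real^'m::_"
  assumes E: "open E" "bounded E" and inj: "inj_on f E"
    and der: "\<And>x. x \<in> E \<Longrightarrow> (f has_derivative (\<lambda>h. A x *v h)) (at x)"
    and cont: "continuous_on E A"
    and bd: "\<And>x. x \<in> E \<Longrightarrow> lo \<le> \<bar>det (A x)\<bar>" "\<And>x. x \<in> E \<Longrightarrow> \<bar>det (A x)\<bar> \<le> hi"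
  shows "f ` E \<in> lmeasurable" "lo * vol E \<le> vol (f ` E)"
    "vol (f ` E) \<le> hi * vol E"
proof -
  have Em: "E \<in> lmeasurable" using E by (simp add: lmeasurable_open)
  have cd: "continuous_on E (\<lambda>x. \<bar>det (A x)\<bar>)"
    unfolding det_def by (intro continuous_intros cont)
  have "(\<lambda>x. \<bar>det (A x)\<bar>) absolutely_integrable_on E"
  proof (rule measurable_bounded_by_integrable_imp_absolutely_integrable)
    show "(\<lambda>x. \<bar>det (A x)\<bar>) \<in> borel_measurable (lebesgue_on E)"
      using cd Em by (intro continuous_imp_measurable_on_sets_lebesgue) auto
    show "E \<in> sets lebesgue" using Em by auto
    show "(\<lambda>_. hi) integrable_on E" using Em by (rule integrable_on_const)
    show "\<And>x. x \<in> E \<Longrightarrow> norm \<bar>det (A x)\<bar> \<le> hi" using bd by auto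
  qed
  then have int: "(\<lambda>x. \<bar>det (A x)\<bar>) integrable_on E" by (rule set_lebesgue_integral_eq_integral)
  have der': "\<And>x. x \<in> E \<Longrightarrow> (f has_derivative (\<lambda>h. A x *v h)) (at x within E)"
    using der has_derivative_at_withinI by blast
  have S: "E \<in> sets lebesgue" using Em by auto
  have int': "(\<lambda>x. \<bar>det (matrix (\<lambda>h. A x *v h))\<bar>) integrable_on E" using int by simp
  show m: "f ` E \<in> lmeasurable" by (rule measurable_differentiable_image[OF S der' int'])
  have eq: "vol (f ` E) = integral E (\<lambda>x. \<bar>det (A x)\<bar>)"
    using measure_differentiable_image_eq[OF S der' inj int'] by simp
  have c: "integral E (\<lambda>x. c) = c * vol E" for c :: real
    using Em by (simp add: lmeasure_integral flip: integral_mult_right)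
  have ic: "(\<lambda>x. c) integrable_on E" for c :: real using Em by (rule integrable_on_const)
  show "lo * vol E \<le> vol (f ` E)"
    unfolding eq c[symmetric] by (rule integral_le[OF ic int]) (use bd in auto)
  show "vol (f ` E) \<le> hi * vol E"
    unfolding eq c[symmetric] by (rule integral_le[OF int ic]) (use bd in auto)
qed

lemma reindex_open:
  fixes b :: "'m::finite \<Rightarrow> 'n::finite" and S :: "(real^'n) set"
  assumes b: "bij b" and S: "open S"
  shows "open ((\<lambda>x. \<chi> j. x $ b j) ` S)"
    and "emeasure lborel ((\<lambda>x. \<chi> j. x $ b j) ` S) = emeasure lborel S"
    and "vol ((\<lambda>x. \<chi> j. x $ b j) ` S) = vol S"
proof -
  let ?p = "\<lambda>x::real^'n. \<chi> j. x $ b j" and ?q = "\<lambda>y::real^'m. \<chi> i. y $ inv b i"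
  have qp: "?q (?p x) = x" for x using b by (simp add: vec_eq_iff bij_is_surj surj_f_inv_f)
  have pq: "?p (?q x) = x" for x using b by (simp add: vec_eq_iff bij_is_inj)
  have im: "?p ` S = ?q -` S"
  proof (intro subset_antisym subsetI)
    fix y assume "y \<in> ?p ` S" then show "y \<in> ?q -` S" using qp by auto
  next
    fix y assume "y \<in> ?q -` S" then show "y \<in> ?p ` S" using pq[of y] by (intro image_eqI[of _ _ "?q y"]) auto
  qed
  have m: "?q \<in> measurable lborel lborel"
    by (auto intro!: borel_measurable_continuous_onI continuous_intros)
  have o: "open (?q -` S)"
    by (rule open_vimage[OF S]) (intro continuous_intros)
  then show "open (?p ` S)" unfolding im .
  have "emeasure lborel (?q -` S) = emeasure (distr lborel lborel ?q) S"
    using S by (subst emeasure_distr[OF m]) auto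
  also have "\<dots> = emeasure lborel S" using lborel_reindex[OF bij_imp_bij_inv[OF b]] by simp
  finally show e: "emeasure lborel (?p ` S) = emeasure lborel S" unfolding im .
  then show "vol (?p ` S) = vol S" unfolding im using S o by (simp add: measure_def)
qed

text \<open>The map is conjugated with a relabelling of coordinates, which changes neither volumes
  nor determinants. Invariance of domain makes the image open, so that its volume can be transported
  back by \<open>reindex_open\<close>.\<close>

proposition area_bounds:
  fixes f :: "real^'n \<Rightarrow> real^'n"
  assumes E: "open E" "bounded E" and inj: "inj_on f E"
    and der: "\<And>x. x \<in> E \<Longrightarrow> (f has_derivative (\<lambda>h. A x *v h)) (at x)"
    and cont: "continuous_on E A"
    and bd: "\<And>x. x \<in> E \<Longrightarrow> lo \<le> \<bar>det (A x)\<bar>" "\<And>x. x \<in> E \<Longrightarrow> \<bar>det (A x)\<bar> \<le> hi"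
  shows "open (f ` E)" "f ` E \<in> lmeasurable" "lo * vol E \<le> vol (f ` E)"
    "vol (f ` E) \<le> hi * vol E"
proof -
  obtain b :: "'n idx \<Rightarrow> 'n" where b: "bij b" using ex_bij_idx by blast
  let ?p = "\<lambda>x::real^'n. (\<chi> j. x $ b j) :: real^'n idx" and ?q = "\<lambda>y::real^'n idx. \<chi> i. y $ inv b i"
  have qp: "?q (?p x) = x" for x using b by (simp add: vec_eq_iff bij_is_surj surj_f_inv_f)
  have pq: "?p (?q x) = x" for x using b by (simp add: vec_eq_iff bij_is_inj)
  have lp: "bounded_linear ?p" and lq: "bounded_linear ?q"
    unfolding linear_conv_bounded_linear[symmetric]
    by (auto intro!: linearI simp: vec_eq_iff)
  have cf: "continuous_on E f"
    using der has_derivative_continuous continuous_at_imp_continuous_on by blast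
  show of: "open (f ` E)" by (rule invariance_of_domain[OF cf E(1) inj])
  let ?E = "?p ` E" and ?f = "\<lambda>y. ?p (f (?q y))"
  let ?A = "\<lambda>y. \<chi> i j. A (?q y) $ b i $ b j"
  have fE: "?f ` ?E = ?p ` (f ` E)" by (simp only: image_image qp)
  have E1: "open ?E" by (rule reindex_open(1)[OF b E(1)])
  have E2: "bounded ?E" using bounded_linear_image[OF E(2) lp] .
  have inj': "inj_on ?f ?E"
  proof (rule inj_onI)
    fix y1 y2 assume y: "y1 \<in> ?E" "y2 \<in> ?E" "?f y1 = ?f y2"
    then obtain x1 x2 where x: "x1 \<in> E" "x2 \<in> E" "y1 = ?p x1" "y2 = ?p x2" by blast
    have "?p (f x1) = ?p (f x2)" using y(3) by (simp only: x qp)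
    then have "f x1 = f x2" by (metis qp)
    then have "x1 = x2" using x inj by (meson inj_onD)
    then show "y1 = y2" using x by simp
  qed
  have der': "(?f has_derivative (\<lambda>h. ?A y *v h)) (at y)" if "y \<in> ?E" for y
  proof -
    from that have y: "?q y \<in> E" using qp by auto
    have "(?f has_derivative (\<lambda>h. ?p (A (?q y) *v ?q h))) (at y)"
      by (rule bounded_linear.has_derivative[OF lp], rule has_derivative_compose[OF bounded_linear_imp_has_derivative[OF lq] der[OF y]])
    moreover have "?p (A (?q y) *v ?q h) = ?A y *v h" for h
    proof -
      have "(\<Sum>j\<in>UNIV. A (?q y) $ b i $ j * h $ inv b j) = (\<Sum>k\<in>UNIV. A (?q y) $ b i $ b k * h $ inv b (b k))" for i
        by (rule sum.reindex_bij_betw[OF b, symmetric])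
      then show ?thesis using b by (simp add: vec_eq_iff matrix_vector_mult_def bij_is_inj)
    qed
    ultimately show ?thesis by simp
  qed
  have cont': "continuous_on ?E ?A"
  proof -
    have "continuous_on ?E (\<lambda>y. A (?q y))"
    proof (rule continuous_on_compose2[OF cont])
      show "continuous_on ?E ?q" by (intro continuous_intros)
      show "?q ` ?E \<subseteq> E" using qp by auto
    qed
    then show ?thesis by (intro continuous_intros)
  qed
  have d: "det (?A y) = det (A (?q y))" for y by (rule det_reindex[OF b])
  have bd': "\<And>y. y \<in> ?E \<Longrightarrow> lo \<le> \<bar>det (?A y)\<bar>" "\<And>y. y \<in> ?E \<Longrightarrow> \<bar>det (?A y)\<bar> \<le> hi"
  proof -
    fix y assume "y \<in> ?E"
    then have "?q y \<in> E" using qp by auto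
    then show "lo \<le> \<bar>det (?A y)\<bar>" "\<bar>det (?A y)\<bar> \<le> hi" unfolding d using bd by blast+
  qed
  note res = area_bounds_wellorder[OF E1 E2 inj' der' cont' bd', unfolded fE]
  note mr = reindex_open(3)[OF b]
  show "lo * vol E \<le> vol (f ` E)"
    "vol (f ` E) \<le> hi * vol E"
    using res(2,3) mr[OF E(1)] mr[OF of] by simp_all
  have "emeasure lborel (?p ` f ` E) < \<infinity>"
    using fmeasurableD2[OF res(1)] reindex_open(1)[OF b of] by (simp add: top.not_eq_extremum)
  then show "f ` E \<in> lmeasurable" unfolding reindex_open(2)[OF b of] using of by (auto simp: fmeasurable_def)
qed

lemma measure_matrix_image:
  fixes F :: "real^'n^'n"
  assumes F: "det F \<noteq> 0" and E: "open E" "bounded E"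
  shows "(\<lambda>x. F *v x) ` E \<in> lmeasurable"
    "vol ((\<lambda>x. F *v x) ` E) = \<bar>det F\<bar> * vol E"
proof -
  have inj: "inj_on (\<lambda>x. F *v x) E"
    using F inj_matrix_vector_mult invertible_det_nz inj_on_subset by blast
  have der: "((\<lambda>x. F *v x) has_derivative (\<lambda>h. F *v h)) (at x)" for x
    by (simp add: bounded_linear_imp_has_derivative)
  note * = area_bounds[OF E inj der continuous_on_const[of E F], of "\<bar>det F\<bar>" "\<bar>det F\<bar>"]
  show "(\<lambda>x. F *v x) ` E \<in> lmeasurable" using * by simp
  show "vol ((\<lambda>x. F *v x) ` E) = \<bar>det F\<bar> * vol E" using * by simp
qed

lemma measure_cube:
  fixes a b :: real
  assumes "a \<le> b"
  shows "measure lborel (box (vec a) (vec b) :: (real^'n) set) = (b - a) ^ CARD('n)"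
proof -
  have "measure lborel (box (vec a) (vec b) :: (real^'n) set) = measure lborel (cbox (vec a) (vec b) :: (real^'n) set)"
    by (simp add: measure_lborel_box_eq measure_lborel_cbox_eq)
  also have "\<dots> = (b - a) ^ CARD('n)"
    using assms by (simp add: content_cbox_if_cart interval_eq_empty_cart)
  finally show ?thesis .
qed

section \<open>Polars, difference bodies and maximal frames\<close>

definition polar :: "'a::real_inner set \<Rightarrow> 'a set" where
  "polar K = {q. \<forall>w\<in>K. q \<bullet> w \<le> 1}"

definition difset :: "'a::real_vector set \<Rightarrow> 'a set" where
  "difset S = {w - w' | w w'. w \<in> S \<and> w' \<in> S}"

lemma difset_eq_Union: "difset S = (\<Union>x\<in>S. \<Union>y\<in>S. {x - y})"
  by (auto simp: difset_def)

lemma convex_difset: "convex S \<Longrightarrow> convex (difset S)"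
  unfolding difset_eq_Union by (rule convex_differences)

lemma open_difset:
  fixes S :: "'a::real_normed_vector set"
  assumes "open S" shows "open (difset S)"
proof -
  have "difset S = (\<Union>y\<in>S. (\<lambda>x. x - y) ` S)" by (auto simp: difset_def)
  then show ?thesis using assms by (auto intro!: open_UN open_translation_subtract)
qed

lemma bounded_difset:
  fixes S :: "'a::real_normed_vector set"
  assumes "bounded S" shows "bounded (difset S)"
proof -
  obtain R where R: "\<And>x. x \<in> S \<Longrightarrow> norm x \<le> R" using assms bounded_iff by blast
  have "norm (x - y) \<le> R + R" if "x \<in> S" "y \<in> S" for x y
    using norm_triangle_ineq4[of x y] R[OF that(1)] R[OF that(2)] by linarith
  then show ?thesis unfolding bounded_iff by (auto simp: difset_def intro!: exI[of _ "R + R"])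
qed

lemma difset_uminus: "w \<in> difset S \<Longrightarrow> - w \<in> difset S"
  by (force simp: difset_def)

lemma difset_zero: "S \<noteq> {} \<Longrightarrow> 0 \<in> difset S"
  by (force simp: difset_def)

lemma convex_polar: "convex (polar K)"
proof (rule convexI)
  fix x y :: 'a and u v :: real
  assume h: "x \<in> polar K" "y \<in> polar K" "0 \<le> u" "0 \<le> v" "u + v = 1"
  have "(u *\<^sub>R x + v *\<^sub>R y) \<bullet> w \<le> 1" if "w \<in> K" for w
  proof -
    have "u * (x \<bullet> w) + v * (y \<bullet> w) \<le> u * 1 + v * 1"
      using h that by (intro add_mono mult_left_mono) (auto simp: polar_def)
    then show ?thesis using h by (simp add: inner_left_distrib)
  qed
  then show "u *\<^sub>R x + v *\<^sub>R y \<in> polar K" by (simp add: polar_def)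
qed

lemma polar_antimono: "K \<subseteq> L \<Longrightarrow> polar L \<subseteq> polar K"
  by (auto simp: polar_def)

text \<open>Test \<open>q\<close> against the vector of length r/2 in its own direction. The halving
  keeps this vector inside the open ball and costs the factor 2.\<close>

lemma polar_bound:
  assumes "ball 0 r \<subseteq> K" "0 < r" "q \<in> polar K"
  shows "norm q \<le> 2 / r"
proof (cases "q = 0")
  case False
  have "(r / (2 * norm q)) *\<^sub>R q \<in> ball 0 r" using False assms(2) by simp
  then have "q \<bullet> ((r / (2 * norm q)) *\<^sub>R q) \<le> 1" using assms(1,3) unfolding polar_def by blast
  then have "r / (2 * norm q) * (norm q)\<^sup>2 \<le> 1" by (simp add: power2_norm_eq_inner)
  then have "r * norm q \<le> 2" using False by (simp add: power2_eq_square)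
  then show ?thesis using assms(2) by (simp add: field_simps)
qed (use assms in simp)

lemma polar_supset_ball:
  assumes "K \<subseteq> cball 0 R" "0 < R"
  shows "ball 0 (1/R) \<subseteq> polar K"
proof
  fix q :: 'a assume "q \<in> ball 0 (1/R)"
  then have q: "norm q \<le> 1/R" by simp
  have "q \<bullet> w \<le> 1" if "w \<in> K" for w
  proof -
    have "norm w \<le> R" using that assms by auto
    then have "norm q * norm w \<le> (1/R) * R" using q assms by (intro mult_mono) auto
    then show ?thesis using norm_cauchy_schwarz[of q w] assms(2) by simp
  qed
  then show "q \<in> polar K" by (simp add: polar_def)
qed

lemma bounded_polar:
  fixes K :: "'a::real_inner set"
  assumes "open K" "0 \<in> K"
  shows "bounded (polar K)"
proof -
  obtain r where r: "0 < r" "ball 0 r \<subseteq> K" using assms by (meson open_contains_ball)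
  show ?thesis unfolding bounded_iff using polar_bound[OF r(2,1)] by (intro exI ballI)
qed

lemma lmeasurable_polar:
  fixes K :: "'a::euclidean_space set"
  assumes "open K" "0 \<in> K"
  shows "polar K \<in> lmeasurable"
proof -
  have "bounded (polar K)" by (rule bounded_polar[OF assms])
  then show ?thesis by (intro measurable_convex convex_polar)
qed

lemma measure_polar_pos:
  fixes K :: "'a::euclidean_space set"
  assumes "open K" "0 \<in> K" "bounded K"
  shows "0 < vol (polar K)"
proof -
  obtain R where "0 < R" "K \<subseteq> cball 0 R" using assms(3) by (auto simp: bounded_pos subset_iff)
  then have "ball 0 (1/R) \<subseteq> polar K" using polar_supset_ball by blast
  then have "vol (ball 0 (1/R) :: 'a set) \<le> vol (polar K)"
    using lmeasurable_polar[OF assms(1,2)] by (intro measure_mono_fmeasurable) auto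
  moreover have "0 < vol (ball 0 (1/R) :: 'a set)"
    using content_ball_pos[of "1/R" "0::'a"] \<open>0 < R\<close> by simp
  ultimately show ?thesis by linarith
qed

lemma measure_scaleR:
  fixes S :: "(real^'n) set"
  assumes "0 \<le> c"
  shows "vol ((\<lambda>x. c *\<^sub>R x) ` S) = c ^ CARD('n) * vol S"
  using measure_lebesgue_affine[of c 0 S] assms by simp

lemma lmeasurable_scaled_polar:
  fixes K :: "'a::euclidean_space set"
  assumes "open K" "0 \<in> K"
  shows "(\<lambda>q. c *\<^sub>R q) ` polar K \<in> lmeasurable"
proof -
  have "bounded (polar K)" by (rule bounded_polar[OF assms])
  then show ?thesis by (intro measurable_convex convex_scaling bounded_scaling convex_polar)
qed

text \<open>Maximal determinant frame in place of the ellipsoid of John's lemma.\<close>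

lemma maximal_frame:
  fixes N :: "(real^'n) set"
  assumes N: "open N" "bounded N" "convex N" "N \<noteq> {}" "\<And>w. w \<in> N \<Longrightarrow> - w \<in> N"
  obtains F :: "real^'n^'n" where "det F \<noteq> 0" "\<And>i. F $ i \<in> N"
    "\<And>w. w \<in> N \<Longrightarrow> \<exists>a. w = (\<Sum>i\<in>UNIV. a $ i *\<^sub>R F $ i) \<and> (\<forall>i. \<bar>a $ i\<bar> \<le> 2)"
proof -
  have z: "0 \<in> N"
  proof -
    obtain w where "w \<in> N" using N(4) by blast
    then have "(1/2) *\<^sub>R w + (1/2) *\<^sub>R (- w) \<in> N" using N(3,5) by (intro convexD) auto
    then show ?thesis by simp
  qed
  \<comment> \<open>The determinant is maximised over frames in the closure, where compactness
    provides a maximum.\<close>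
  let ?K = "closure N"
  let ?X = "{A :: real^'n^'n. \<forall>i. A $ i \<in> ?K}"
  have row: "row i A = A $ i" for i and A :: "real^'n^'n" by (simp add: row_def vec_eq_iff)
  have cX: "compact ?X"
  proof -
    have "?X = (\<Inter>i. (\<lambda>A. A $ i) -` ?K)" by auto
    also have "closed \<dots>" by (intro closed_INT ballI closed_vimage) (auto intro!: continuous_intros)
    finally have cl: "closed ?X" .
    obtain R where R: "\<And>x. x \<in> ?K \<Longrightarrow> norm x \<le> R" using bounded_closure[OF N(2)] bounded_iff by blast
    have "norm A \<le> (\<Sum>i\<in>(UNIV::'n set). R)" if "A \<in> ?X" for A :: "real^'n^'n"
    proof -
      have "norm A \<le> (\<Sum>i\<in>UNIV. norm (A $ i))" unfolding norm_vec_def by (rule L2_set_le_sum) simp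
      also have "\<dots> \<le> (\<Sum>i\<in>(UNIV::'n set). R)" using that R by (intro sum_mono) auto
      finally show ?thesis .
    qed
    then have "bounded ?X" unfolding bounded_iff by blast
    with cl show ?thesis by (simp add: compact_eq_bounded_closed)
  qed
  obtain r where r: "0 < r" "ball 0 r \<subseteq> N" using N(1) z open_contains_ball by blast
  define B :: "real^'n^'n" where "B = (\<chi> i. axis i (r/2))"
  have BX: "B \<in> ?X"
  proof -
    have "axis i (r/2) \<in> ball (0::real^'n) r" for i
    proof -
      have "axis i (r/2) = (r/2) *\<^sub>R axis i (1::real)" by (simp add: vec_eq_iff axis_def)
      then show ?thesis using r by simp
    qed
    then have "axis i (r/2) \<in> closure N" for i using r(2) closure_subset[of N] by blast
    then show ?thesis by (simp add: B_def)
  qed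
  have cd: "continuous_on ?X (\<lambda>A. \<bar>det A\<bar>)"
    unfolding det_def by (intro continuous_intros)
  have Xne: "?X \<noteq> {}" using BX by (metis empty_iff)
  obtain A where A1: "A \<in> ?X" and A2: "\<forall>A'\<in>?X. \<bar>det A'\<bar> \<le> \<bar>det A\<bar>"
    using continuous_attains_sup[OF cX Xne cd] by (elim bexE)
  note A = A1 A2[rule_format]
  have "det B = (\<Prod>i\<in>(UNIV::'n set). r/2)"
    by (subst det_diagonal) (auto simp: B_def axis_def)
  then have "det B \<noteq> 0" using r by simp
  with A(2)[OF BX] have dA: "det A \<noteq> 0" by auto
  have coord: "\<exists>a. w = (\<Sum>i\<in>UNIV. a $ i *\<^sub>R A $ i) \<and> (\<forall>i. \<bar>a $ i\<bar> \<le> 1)" if w: "w \<in> N" for w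
  proof -
    have "invertible (transpose A)" using dA by (simp add: invertible_det_nz)
    then obtain a where a: "w = transpose A *v a"
      by (metis invertible_def matrix_vector_mul_assoc matrix_vector_mul_lid)
    then have a': "w = (\<Sum>i\<in>UNIV. a $ i *\<^sub>R A $ i)"
      by (simp add: matrix_mult_sum column_transpose row scalar_mult_eq_scaleR)
    have "\<bar>a $ k\<bar> \<le> 1" for k
    proof -
      \<comment> \<open>Cramer's rule: replacing row \<open>k\<close> by \<open>w\<close> multiplies
        the determinant by \<open>a $ k\<close>, so maximality bounds this coefficient by 1.\<close>
      let ?A = "(\<chi> i. if i = k then w else A $ i) :: real^'n^'n"
      have "det ?A = a $ k * det A"
        using cramer_lemma_transpose[of k a A] unfolding row scalar_mult_eq_scaleR a'[symmetric] .
      moreover have "\<bar>det ?A\<bar> \<le> \<bar>det A\<bar>"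
      proof (rule A(2))
        have "w \<in> ?K" using w closure_subset[of N] by blast
        then show "?A \<in> ?X" using A(1) by simp
      qed
      ultimately have "\<bar>a $ k\<bar> * \<bar>det A\<bar> \<le> \<bar>det A\<bar>" by (simp add: abs_mult)
      then show ?thesis using dA by simp
    qed
    with a' show ?thesis by (intro exI[of _ a]) simp
  qed
  \<comment> \<open>The rows of \<open>A\<close> lie only in the closure. Halving moves them into
    \<open>N\<close>, since 0 is an interior point, and doubles the coefficients.\<close>
  let ?F = "(1/2) *\<^sub>R A"
  show thesis
  proof
    have "invertible A" using dA by (simp add: invertible_det_nz)
    then have "invertible ?F" by (intro scalar_invertible) auto
    then show "det ?F \<noteq> 0" by (simp add: invertible_det_nz)
    fix i
    have "A $ i - (1/2) *\<^sub>R (A $ i - 0) \<in> interior N"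
      using A(1) z N by (intro mem_interior_closure_convex_shrink) (auto simp: interior_open)
    then show "?F $ i \<in> N"
    proof -
      have "A $ i - (1/2) *\<^sub>R (A $ i - 0) = ?F $ i" by (simp add: vec_eq_iff field_simps)
      then show ?thesis using \<open>A $ i - (1/2) *\<^sub>R (A $ i - 0) \<in> interior N\<close> interior_subset by (metis subsetD)
    qed
  next
    fix w assume "w \<in> N"
    then obtain a where a: "w = (\<Sum>i\<in>UNIV. a $ i *\<^sub>R A $ i)" "\<forall>i. \<bar>a $ i\<bar> \<le> 1" using coord by blast
    show "\<exists>a. w = (\<Sum>i\<in>UNIV. a $ i *\<^sub>R ?F $ i) \<and> (\<forall>i. \<bar>a $ i\<bar> \<le> 2)"
      by (rule exI[of _ "2 *\<^sub>R a"]) (use a in \<open>auto simp: abs_mult\<close>)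
  qed
qed

text \<open>Substitute for the centre of mass. Write each frame vector of the difference body as p_i
  - q_i and let z be the average of the midpoints of p_i and q_i. A vector with frame coefficients
  a_i, |a_i| \<le> 2, scaled by 1/(4n), only changes the weights of p_i and q_i from 1/2 to 1/2 +
  a_i/4 and 1/2 - a_i/4, which stay nonnegative.\<close>

lemma balanced_center:
  fixes S :: "(real^'n) set"
  assumes S: "open S" "bounded S" "convex S" "S \<noteq> {}"
  obtains z where "z \<in> S" "\<And>e. e \<in> difset S \<Longrightarrow> z + (1 / (4 * real CARD('n))) *\<^sub>R e \<in> S"
proof -
  obtain F :: "real^'n^'n" where F: "\<And>i. F $ i \<in> difset S"
    "\<And>w. w \<in> difset S \<Longrightarrow> \<exists>a. w = (\<Sum>i\<in>UNIV. a $ i *\<^sub>R F $ i) \<and> (\<forall>i. \<bar>a $ i\<bar> \<le> 2)"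
  proof (rule maximal_frame)
    show "open (difset S)" "bounded (difset S)" "convex (difset S)"
      using S by (auto intro: open_difset bounded_difset convex_difset)
    show "difset S \<noteq> {}" using difset_zero[OF S(4)] by auto
    show "\<And>w. w \<in> difset S \<Longrightarrow> - w \<in> difset S" by (rule difset_uminus)
  qed blast
  have "\<forall>i. \<exists>p q. p \<in> S \<and> q \<in> S \<and> F $ i = p - q" using F(1) unfolding difset_def by blast
  then obtain p q where pq: "\<And>i. p i \<in> S" "\<And>i. q i \<in> S" "\<And>i. F $ i = p i - q i" by metis
  let ?n = "real CARD('n)"
  define z where "z = (\<Sum>i\<in>UNIV. (1 / ?n) *\<^sub>R ((1/2) *\<^sub>R p i + (1/2) *\<^sub>R q i))"
  have n: "?n > 0" by simp
  have avg: "(\<Sum>i\<in>(UNIV::'n set). (1 / ?n) *\<^sub>R g i) \<in> S" if "\<And>i. g i \<in> S" for g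
    using that S(3) by (intro convex_sum) auto
  show thesis
  proof
    have "(1/2) *\<^sub>R p i + (1/2) *\<^sub>R q i \<in> S" for i using pq S(3) by (intro convexD) auto
    then show "z \<in> S" unfolding z_def by (rule avg)
    fix e assume "e \<in> difset S"
    then obtain a where a: "e = (\<Sum>i\<in>UNIV. a $ i *\<^sub>R F $ i)" "\<And>i. \<bar>a $ i\<bar> \<le> 2" using F(2) by blast
    have "z + (1 / (4 * ?n)) *\<^sub>R e = (\<Sum>i\<in>UNIV. (1 / ?n) *\<^sub>R ((1/2 + a $ i / 4) *\<^sub>R p i + (1/2 - a $ i / 4) *\<^sub>R q i))"
      unfolding z_def a(1) scaleR_sum_right sum.distrib[symmetric]
      by (rule sum.cong) (auto simp: pq(3) algebra_simps)
    also have "\<dots> \<in> S"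
    proof (rule avg)
      fix i show "(1/2 + a $ i / 4) *\<^sub>R p i + (1/2 - a $ i / 4) *\<^sub>R q i \<in> S"
        using a(2)[of i] pq S(3) by (intro convexD) (auto simp: abs_le_iff)
    qed
    finally show "z + (1 / (4 * ?n)) *\<^sub>R e \<in> S" .
  qed
qed

lemma frame_image:
  fixes F :: "real^'n^'n"
  shows "(\<Sum>i\<in>UNIV. a $ i *\<^sub>R F $ i) = transpose F *v a"
proof -
  have "row i F = F $ i" for i by (simp add: row_def vec_eq_iff)
  then show ?thesis by (simp add: matrix_mult_sum column_transpose scalar_mult_eq_scaleR)
qed

text \<open>In frame coordinates the translate of \<open>S\<close> by \<open>- x\<close> lies in the
  cube [-2,2]^n, which is enlarged to the open cube of side 6.\<close>

lemma measure_le_frame: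
  fixes F :: "real^'n^'n"
  assumes F: "det F \<noteq> 0" and S: "x \<in> S" "S \<in> lmeasurable"
    and co: "\<And>w. w \<in> difset S \<Longrightarrow> \<exists>a. w = (\<Sum>i\<in>UNIV. a $ i *\<^sub>R F $ i) \<and> (\<forall>i. \<bar>a $ i\<bar> \<le> 2)"
  shows "vol S \<le> 6 ^ CARD('n) * \<bar>det F\<bar>"
proof -
  let ?B = "box (vec (-3)) (vec 3) :: (real^'n) set"
  have dt: "det (transpose F) \<noteq> 0" using F by simp
  have sub: "(\<lambda>w. w - x) ` S \<subseteq> (\<lambda>a. transpose F *v a) ` ?B"
  proof
    fix v assume "v \<in> (\<lambda>w. w - x) ` S"
    then have "v \<in> difset S" using S(1) by (auto simp: difset_def)
    then obtain a where a: "v = transpose F *v a" "\<forall>i. \<bar>a $ i\<bar> \<le> 2" using co by (auto simp: frame_image)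
    have "a \<in> ?B"
      unfolding mem_box_cart
    proof
      fix i show "(vec (-3) :: real^'n) $ i < a $ i \<and> a $ i < (vec 3 :: real^'n) $ i" using a(2)[rule_format, of i] by auto
    qed
    then show "v \<in> (\<lambda>a. transpose F *v a) ` ?B" using a by blast
  qed
  have "vol S = vol ((\<lambda>w. w - x) ` S)" by (simp add: measure_translation_subtract)
  also have "\<dots> \<le> vol ((\<lambda>a. transpose F *v a) ` ?B)"
    using S(2) by (intro measure_mono_fmeasurable[OF sub] measure_matrix_image dt fmeasurableD measurable_translation_subtract) auto
  also have "\<dots> = 6 ^ CARD('n) * \<bar>det F\<bar>"
    by (subst measure_matrix_image[OF dt]) (auto simp: measure_cube)
  finally show ?thesis .
qed

text \<open>The dual frame maps a cube of side 1/n into the polar: coordinates at most 1/(2n) pair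
  with n coefficients at most 2 to at most 1.\<close>

lemma measure_polar_ge_frame:
  fixes F :: "real^'n^'n"
  assumes F: "det F \<noteq> 0" and S: "open S" "S \<noteq> {}"
    and co: "\<And>w. w \<in> difset S \<Longrightarrow> \<exists>a. w = (\<Sum>i\<in>UNIV. a $ i *\<^sub>R F $ i) \<and> (\<forall>i. \<bar>a $ i\<bar> \<le> 2)"
  shows "(1 / real CARD('n)) ^ CARD('n) \<le> \<bar>det F\<bar> * vol (polar (difset S))"
proof -
  let ?n = "real CARD('n)"
  let ?B = "box (vec (- (1 / (2 * ?n)))) (vec (1 / (2 * ?n))) :: (real^'n) set"
  have P: "polar (difset S) \<in> lmeasurable" using S by (intro lmeasurable_polar open_difset difset_zero)
  obtain G where G: "F ** G = mat 1" "G ** F = mat 1"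
    using F by (metis invertible_det_nz invertible_def)
  have dG: "det F * det G = 1" using G by (metis det_mul det_I)
  then have dG0: "det G \<noteq> 0" by auto
  have sub: "(\<lambda>b. G *v b) ` ?B \<subseteq> polar (difset S)"
  proof clarify
    fix b assume b: "b \<in> ?B"
    have bi: "\<bar>b $ i\<bar> \<le> 1 / (2 * ?n)" for i
    proof -
      have "- (1 / (2 * ?n)) < b $ i" "b $ i < 1 / (2 * ?n)" using b by (auto simp: mem_box_cart)
      then show ?thesis by (simp add: abs_le_iff)
    qed
    have "(G *v b) \<bullet> w \<le> 1" if hw: "w \<in> difset S" for w
    proof -
      obtain a where a: "w = (\<Sum>i\<in>UNIV. a $ i *\<^sub>R F $ i)" "\<And>i. \<bar>a $ i\<bar> \<le> 2" using co[OF hw] by blast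
      have "F $ i \<bullet> (G *v b) = b $ i" for i
      proof -
        have "F $ i \<bullet> (G *v b) = (F *v (G *v b)) $ i"
          by (simp add: matrix_vector_mult_def inner_vec_def)
        then show ?thesis using G by (simp add: matrix_vector_mul_assoc)
      qed
      then have "(G *v b) \<bullet> w = (\<Sum>i\<in>UNIV. a $ i * b $ i)"
        unfolding a(1) by (simp add: inner_sum_right inner_commute)
      also have "\<dots> \<le> (\<Sum>i\<in>(UNIV::'n set). 2 * (1 / (2 * ?n)))"
      proof (rule sum_mono)
        fix i
        have "a $ i * b $ i \<le> \<bar>a $ i\<bar> * \<bar>b $ i\<bar>" by (metis abs_ge_self abs_mult)
        also have "\<dots> \<le> 2 * (1 / (2 * ?n))" using a(2) bi by (intro mult_mono) auto
        finally show "a $ i * b $ i \<le> 2 * (1 / (2 * ?n))" .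
      qed
      also have "\<dots> = 1" by simp
      finally show ?thesis .
    qed
    then show "G *v b \<in> polar (difset S)" by (simp add: polar_def)
  qed
  have cube: "measure lborel ?B = (1 / ?n) ^ CARD('n)"
    by (subst measure_cube) auto
  have "\<bar>det G\<bar> * (1 / ?n) ^ CARD('n) = vol ((\<lambda>b. G *v b) ` ?B)"
    by (subst measure_matrix_image[OF dG0]) (auto simp: cube)
  also have "\<dots> \<le> vol (polar (difset S))"
    by (intro measure_mono_fmeasurable[OF sub] P fmeasurableD measure_matrix_image dG0) auto
  finally have "\<bar>det F\<bar> * (\<bar>det G\<bar> * (1 / ?n) ^ CARD('n)) \<le> \<bar>det F\<bar> * vol (polar (difset S))"
    by (intro mult_left_mono) auto
  moreover have "\<bar>det F\<bar> * \<bar>det G\<bar> = 1" using dG by (metis abs_mult abs_one)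
  ultimately show ?thesis by (simp add: mult.assoc[symmetric])
qed

section \<open>Convex functions of class C2\<close>

definition psd :: "real^'n^'n \<Rightarrow> bool" where
  "psd Q \<longleftrightarrow> (\<forall>v w. v \<bullet> (Q *v w) = w \<bullet> (Q *v v)) \<and> (\<forall>v. 0 \<le> v \<bullet> (Q *v v))"

lemma psd_sym: "psd Q \<Longrightarrow> v \<bullet> (Q *v w) = w \<bullet> (Q *v v)"
  and psd_nonneg: "psd Q \<Longrightarrow> 0 \<le> v \<bullet> (Q *v v)"
  by (auto simp: psd_def)

lemma psd_Cauchy_Schwarz:
  assumes "psd Q"
  shows "(v \<bullet> (Q *v w))\<^sup>2 \<le> (v \<bullet> (Q *v v)) * (w \<bullet> (Q *v w))"
proof -
  define a b c where "a = v \<bullet> (Q *v v)" and "b = v \<bullet> (Q *v w)" and "c = w \<bullet> (Q *v w)"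
  have quad: "0 \<le> a + 2 * s * b + s\<^sup>2 * c" for s
  proof -
    have "0 \<le> (v + s *\<^sub>R w) \<bullet> (Q *v (v + s *\<^sub>R w))" by (rule psd_nonneg[OF assms])
    also have "\<dots> = a + 2 * s * b + s\<^sup>2 * c"
      using psd_sym[OF assms, of w v]
      by (simp add: a_def b_def c_def matrix_vector_right_distrib matrix_vector_mult_scaleR
          inner_add_left inner_add_right power2_eq_square algebra_simps)
    finally show ?thesis .
  qed
  have c: "0 \<le> c" and a: "0 \<le> a" using assms by (auto simp: a_def c_def psd_nonneg)
  have "b\<^sup>2 \<le> a * c"
  proof (cases "c = 0")
    case True
    have "b = 0"
    proof (rule ccontr)
      assume "b \<noteq> 0"
      \<comment> \<open>For \<open>c = 0\<close> the quadratic is affine in s, and this s makes it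
        negative unless its slope vanishes.\<close>
      then have "a + 2 * (- (a + 1) / (2 * b)) * b = -1" by (simp add: field_simps)
      then show False using quad[of "- (a + 1) / (2 * b)"] True by simp
    qed
    then show ?thesis using True by simp
  next
    case False
    with c have "c > 0" by simp
    have "0 \<le> c * (a + 2 * (- b / c) * b + (- b / c)\<^sup>2 * c)" by (rule mult_nonneg_nonneg[OF c quad])
    also have "\<dots> = a * c - b\<^sup>2" using \<open>c > 0\<close> by (simp add: field_simps power2_eq_square)
    finally show ?thesis by simp
  qed
  then show ?thesis by (simp add: a_def b_def c_def)
qed

lemma psd_abs_le:
  assumes "psd Q"
  shows "\<bar>v \<bullet> (Q *v w)\<bar> \<le> sqrt (v \<bullet> (Q *v v)) * sqrt (w \<bullet> (Q *v w))"
proof -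
  have "\<bar>v \<bullet> (Q *v w)\<bar> = sqrt ((v \<bullet> (Q *v w))\<^sup>2)" by simp
  also have "\<dots> \<le> sqrt ((v \<bullet> (Q *v v)) * (w \<bullet> (Q *v w)))"
    using psd_Cauchy_Schwarz[OF assms] by (rule real_sqrt_le_mono)
  finally show ?thesis by (simp add: real_sqrt_mult)
qed

text \<open>Cauchy-Schwarz for \<open>v\<close> and \<open>Q *v v\<close> shows that a null vector
  of the form lies in the kernel.\<close>

lemma psd_definite:
  assumes "psd Q" "det Q \<noteq> 0" "v \<noteq> 0"
  shows "0 < v \<bullet> (Q *v v)"
proof (rule ccontr)
  assume "\<not> ?thesis"
  then have 0: "v \<bullet> (Q *v v) = 0" using psd_nonneg[OF assms(1), of v] by simp
  have "(Q *v v) \<bullet> (Q *v v) = 0"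
  proof -
    have "((Q *v v) \<bullet> (Q *v v))\<^sup>2 \<le> 0"
      using psd_Cauchy_Schwarz[OF assms(1), of "Q *v v" v] 0 by simp
    then show ?thesis by simp
  qed
  then have "Q *v v = 0" by simp
  moreover have "inj (\<lambda>x. Q *v x)" using assms(2) by (simp add: inj_matrix_vector_mult invertible_det_nz)
  ultimately show False using assms(3) by (metis injD matrix_vector_mult_0_right)
qed

locale C2_convex =
  fixes U :: "(real^'n) set" and u :: "real^'n \<Rightarrow> real"
  assumes open_U: "open U" and convex_U: "convex U" and bounded_U: "bounded U"
    and convex_u: "convex_on (closure U) u"
    and C2: "C2_on U u"
    and cont_u: "continuous_on (closure U) u"
begin

abbreviation (input) hnorm :: "real^'n \<Rightarrow> real" where "hnorm y \<equiv> mnorm (hessian u y)"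

lemma has_derivative_u: "x \<in> U \<Longrightarrow> (u has_derivative (\<lambda>h. grad u x \<bullet> h)) (at x)"
proof -
  assume "x \<in> U"
  then have d: "(u has_derivative frechet_derivative u (at x)) (at x)"
    using C2 by (simp add: C2_on_def frechet_derivative_works)
  let ?L = "frechet_derivative u (at x)"
  have lin: "linear ?L" using d has_derivative_linear by blast
  have "?L h = grad u x \<bullet> h" for h
  proof -
    have "h = (\<Sum>i\<in>UNIV. h $ i *\<^sub>R axis i 1)"
      by (simp add: vec_eq_iff axis_def if_distrib sum.If_cases cong: if_cong)
    then have "?L h = ?L (\<Sum>i\<in>UNIV. h $ i *\<^sub>R axis i 1)" by simp
    also have "\<dots> = (\<Sum>i\<in>UNIV. h $ i * ?L (axis i 1))"
      by (simp add: linear_sum[OF lin] linear_scale[OF lin])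
    finally show ?thesis by (simp add: grad_def inner_vec_def mult.commute)
  qed
  then show ?thesis using d by (metis (no_types, lifting) ext)
qed

lemma has_derivative_grad: "x \<in> U \<Longrightarrow> (grad u has_derivative (\<lambda>h. hessian u x *v h)) (at x)"
proof -
  assume "x \<in> U"
  then have d: "(grad u has_derivative frechet_derivative (grad u) (at x)) (at x)"
    using C2 by (simp add: C2_on_def frechet_derivative_works)
  then have "linear (frechet_derivative (grad u) (at x))" using has_derivative_linear by blast
  then have "frechet_derivative (grad u) (at x) = (\<lambda>h. hessian u x *v h)"
    by (auto simp: hessian_def matrix_works)
  then show ?thesis using d by simp
qed

lemma continuous_hessian: "continuous_on U (hessian u)"
  using C2 by (simp add: C2_on_def)

lemma continuous_hessian_form: "continuous_on U (\<lambda>x. v \<bullet> (hessian u x *v w))"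
  unfolding matrix_vector_mult_def inner_vec_def
  by (simp, intro continuous_intros continuous_hessian)

lemma DERIV_line:
  assumes "x + s *\<^sub>R e \<in> U"
  shows "((\<lambda>s. u (x + s *\<^sub>R e)) has_real_derivative (grad u (x + s *\<^sub>R e) \<bullet> e)) (at s)"
proof -
  have "((\<lambda>s. x + s *\<^sub>R e) has_derivative (\<lambda>h. h *\<^sub>R e)) (at s)" by (auto intro!: derivative_eq_intros)
  from has_derivative_compose[OF this has_derivative_u[OF assms]]
  show ?thesis by (simp add: has_field_derivative_def mult.commute[of _ "_ \<bullet> _"])
qed

lemma DERIV_grad_line:
  assumes "x + s *\<^sub>R e \<in> U"
  shows "((\<lambda>s. grad u (x + s *\<^sub>R e) \<bullet> w) has_real_derivative (w \<bullet> (hessian u (x + s *\<^sub>R e) *v e))) (at s)"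
proof -
  have "((\<lambda>s. x + s *\<^sub>R e) has_derivative (\<lambda>h. h *\<^sub>R e)) (at s)" by (auto intro!: derivative_eq_intros)
  from has_derivative_inner_left[OF has_derivative_compose[OF this has_derivative_grad[OF assms]], of w]
  show ?thesis
    by (simp add: has_field_derivative_def matrix_vector_mult_scaleR inner_commute mult_commute_abs)
qed

text \<open>The difference quotient at \<open>x\<close> is bounded by the chord inequality on the
  closure, so \<open>z\<close> may be a boundary point, where \<open>u\<close> is only
  continuous.\<close>

lemma tangent_below:
  assumes x: "x \<in> U" and z: "z \<in> closure U"
  shows "u x + grad u x \<bullet> (z - x) \<le> u z"
proof -
  have xc: "x \<in> closure U" using x closure_subset by blast
  have d: "((\<lambda>s. u (x + s *\<^sub>R (z - x))) has_real_derivative (grad u x \<bullet> (z - x))) (at 0)"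
    using DERIV_line[of x 0 "z - x"] x by simp
  have "((\<lambda>s. (u (x + s *\<^sub>R (z - x)) - u x) / s) \<longlongrightarrow> grad u x \<bullet> (z - x)) (at 0)"
    using d[unfolded DERIV_def] by simp
  then have "((\<lambda>s. (u (x + s *\<^sub>R (z - x)) - u x) / s) \<longlongrightarrow> grad u x \<bullet> (z - x)) (at_right 0)"
    by (rule filterlim_mono) (auto simp: at_le)
  then have "grad u x \<bullet> (z - x) \<le> u z - u x"
  proof (rule tendsto_upperbound)
    show "\<forall>\<^sub>F s in at_right 0. (u (x + s *\<^sub>R (z - x)) - u x) / s \<le> u z - u x"
      unfolding eventually_at_right_field
    proof (intro exI[of _ 1] conjI allI impI)
      fix s :: real assume s: "0 < s" "s < 1"
      have "x + s *\<^sub>R (z - x) = (1 - s) *\<^sub>R x + s *\<^sub>R z" by (simp add: algebra_simps)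
      then have "u (x + s *\<^sub>R (z - x)) \<le> (1 - s) * u x + s * u z"
        using convex_onD[OF convex_u _ _ xc z, of s] s by simp
      then have "u (x + s *\<^sub>R (z - x)) - u x \<le> s * (u z - u x)" by (simp add: algebra_simps)
      then show "(u (x + s *\<^sub>R (z - x)) - u x) / s \<le> u z - u x" using s by (simp add: field_simps)
    qed simp
  qed simp
  then show ?thesis by simp
qed

lemma grad_monotone:
  assumes "x \<in> U" "y \<in> U"
  shows "0 \<le> (grad u y - grad u x) \<bullet> (y - x)"
proof -
  have "u x + grad u x \<bullet> (y - x) \<le> u y" "u y + grad u y \<bullet> (x - y) \<le> u x"
    using assms closure_subset by (blast intro: tangent_below)+
  then show ?thesis by (simp add: inner_diff_left inner_diff_right)
qed

text \<open>Two mean value steps, in direction \<open>e\<close> and then in direction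
  \<open>f\<close>. The left side is symmetric in \<open>e\<close> and \<open>f\<close>, which
  yields the symmetry of the Hessian below.\<close>

lemma second_difference:
  assumes "cball x r \<subseteq> U" "0 < r" "norm e \<le> 1" "norm f \<le> 1" "0 < d" "2 * d \<le> r"
  shows "\<exists>p\<in>cball x (2 * d). u (x + d *\<^sub>R e + d *\<^sub>R f) - u (x + d *\<^sub>R e) - u (x + d *\<^sub>R f) + u x
      = d * d * (e \<bullet> (hessian u p *v f))"
proof -
  have inU: "x + s *\<^sub>R e + t *\<^sub>R f \<in> cball x (2 * d)" if "0 \<le> s" "s \<le> d" "0 \<le> t" "t \<le> d" for s t
  proof -
    have "norm (s *\<^sub>R e + t *\<^sub>R f) \<le> s * norm e + t * norm f"
      using norm_triangle_ineq[of "s *\<^sub>R e" "t *\<^sub>R f"] that by simp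
    also have "\<dots> \<le> d * 1 + d * 1" using assms that by (intro add_mono mult_mono) auto
    finally show ?thesis by (metis add.assoc dist_add_cancel dist_0_norm add_0_right mem_cball mult_2 mult.right_neutral)
  qed
  have sub: "cball x (2 * d) \<subseteq> U" using assms by (meson order_trans subset_cball)
  let ?\<phi> = "\<lambda>s. u (x + d *\<^sub>R f + s *\<^sub>R e) - u (x + s *\<^sub>R e)"
  have "\<exists>s>0. s < d \<and> ?\<phi> d - ?\<phi> 0 = (d - 0) * (grad u (x + d *\<^sub>R f + s *\<^sub>R e) \<bullet> e - grad u (x + s *\<^sub>R e) \<bullet> e)"
  proof (rule MVT2)
    fix s assume s: "0 \<le> s" "s \<le> d"
    have "x + d *\<^sub>R f + s *\<^sub>R e \<in> U" "x + s *\<^sub>R e \<in> U"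
      using inU[of s d] inU[of s 0] s sub assms by (auto simp: algebra_simps)
    then show "(?\<phi> has_real_derivative (grad u (x + d *\<^sub>R f + s *\<^sub>R e) \<bullet> e - grad u (x + s *\<^sub>R e) \<bullet> e)) (at s)"
      by (intro DERIV_diff DERIV_line)
  qed (use assms in simp)
  then obtain s where s: "0 < s" "s < d"
    "?\<phi> d - ?\<phi> 0 = d * (grad u (x + d *\<^sub>R f + s *\<^sub>R e) \<bullet> e - grad u (x + s *\<^sub>R e) \<bullet> e)" by auto
  let ?\<psi> = "\<lambda>t. grad u (x + s *\<^sub>R e + t *\<^sub>R f) \<bullet> e"
  have "\<exists>t>0. t < d \<and> ?\<psi> d - ?\<psi> 0 = (d - 0) * (e \<bullet> (hessian u (x + s *\<^sub>R e + t *\<^sub>R f) *v f))"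
  proof (rule MVT2)
    fix t assume t: "0 \<le> t" "t \<le> d"
    then have "x + s *\<^sub>R e + t *\<^sub>R f \<in> U" using inU[of s t] s sub by auto
    then show "(?\<psi> has_real_derivative (e \<bullet> (hessian u (x + s *\<^sub>R e + t *\<^sub>R f) *v f))) (at t)"
      by (rule DERIV_grad_line)
  qed (use assms in simp)
  then obtain t where t: "0 < t" "t < d"
    "?\<psi> d - ?\<psi> 0 = d * (e \<bullet> (hessian u (x + s *\<^sub>R e + t *\<^sub>R f) *v f))" by auto
  show ?thesis
  proof (rule bexI[of _ "x + s *\<^sub>R e + t *\<^sub>R f"])
    show "x + s *\<^sub>R e + t *\<^sub>R f \<in> cball x (2 * d)" using inU[of s t] s t by auto
    have c: "x + d *\<^sub>R f + s *\<^sub>R e = x + s *\<^sub>R e + d *\<^sub>R f" "x + d *\<^sub>R f + d *\<^sub>R e = x + d *\<^sub>R e + d *\<^sub>R f"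
      by (simp_all add: algebra_simps)
    show "u (x + d *\<^sub>R e + d *\<^sub>R f) - u (x + d *\<^sub>R e) - u (x + d *\<^sub>R f) + u x
      = d * d * (e \<bullet> (hessian u (x + s *\<^sub>R e + t *\<^sub>R f) *v f))"
      using s(3) t(3) unfolding c by simp
  qed
qed

lemma hessian_symmetric_unit:
  assumes x: "x \<in> U" and e: "norm e \<le> 1" "norm f \<le> 1"
  shows "e \<bullet> (hessian u x *v f) = f \<bullet> (hessian u x *v e)"
proof (rule ccontr)
  let ?g = "\<lambda>p. e \<bullet> (hessian u p *v f)" and ?h = "\<lambda>p. f \<bullet> (hessian u p *v e)"
  assume ne: "?g x \<noteq> ?h x"
  define \<epsilon> where "\<epsilon> = \<bar>?g x - ?h x\<bar> / 2"
  have \<epsilon>: "\<epsilon> > 0" using ne by (simp add: \<epsilon>_def)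
  have "isCont ?g x" "isCont ?h x"
    using continuous_hessian_form open_U x continuous_on_eq_continuous_at by blast+
  then obtain d1 d2 where d1: "d1 > 0" "\<And>p. dist p x < d1 \<Longrightarrow> dist (?g p) (?g x) < \<epsilon>"
    and d2: "d2 > 0" "\<And>p. dist p x < d2 \<Longrightarrow> dist (?h p) (?h x) < \<epsilon>"
    using \<epsilon> unfolding continuous_at_eps_delta by metis
  obtain r where r: "r > 0" "cball x r \<subseteq> U" using open_U x open_contains_cball by blast
  define d where "d = min r (min d1 d2) / 3"
  have d: "d > 0" "2 * d \<le> r" "2 * d < d1" "2 * d < d2" using r d1 d2 by (auto simp: d_def min_def)
  obtain p where p: "p \<in> cball x (2 * d)" "u (x + d *\<^sub>R e + d *\<^sub>R f) - u (x + d *\<^sub>R e) - u (x + d *\<^sub>R f) + u x = d * d * ?g p"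
    using second_difference[OF r(2,1) e d(1,2)] by blast
  obtain q where q: "q \<in> cball x (2 * d)" "u (x + d *\<^sub>R f + d *\<^sub>R e) - u (x + d *\<^sub>R f) - u (x + d *\<^sub>R e) + u x = d * d * ?h q"
    using second_difference[OF r(2,1) e(2,1) d(1,2)] by blast
  have "x + d *\<^sub>R f + d *\<^sub>R e = x + d *\<^sub>R e + d *\<^sub>R f" by (simp add: algebra_simps)
  then have "d * d * ?g p = d * d * ?h q" using p(2) q(2) by (simp only:)
  then have "?g p = ?h q" using d(1) by simp
  moreover have "dist (?g p) (?g x) < \<epsilon>" "dist (?h q) (?h x) < \<epsilon>"
    using p(1) q(1) d d1(2)[of p] d2(2)[of q] by (auto simp: dist_commute)
  ultimately show False unfolding \<epsilon>_def dist_real_def by (simp add: abs_if split: if_splits)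
qed

text \<open>Symmetry extends from unit vectors by scaling. A negative value of the form would make
  the component of the gradient along \<open>e\<close> decrease just after \<open>x\<close>, against
  monotonicity of the gradient.\<close>

lemma psd_hessian:
  assumes x: "x \<in> U"
  shows "psd (hessian u x)"
  unfolding psd_def
proof (intro conjI allI)
  fix v w
  show "v \<bullet> (hessian u x *v w) = w \<bullet> (hessian u x *v v)"
  proof (cases "v = 0 \<or> w = 0")
    case False
    then have n: "norm v \<noteq> 0" "norm w \<noteq> 0" by auto
    have "sgn v \<bullet> (hessian u x *v sgn w) = sgn w \<bullet> (hessian u x *v sgn v)"
      by (rule hessian_symmetric_unit[OF x]) (auto simp: norm_sgn)
    then show ?thesis using n by (simp add: sgn_div_norm matrix_vector_mult_scaleR)
  qed (auto simp: matrix_vector_mult_0_right)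
next
  fix e
  obtain r where r: "r > 0" "ball x r \<subseteq> U" using open_U x open_contains_ball by blast
  have d: "((\<lambda>s. grad u (x + s *\<^sub>R e) \<bullet> e) has_real_derivative (e \<bullet> (hessian u x *v e))) (at 0)"
    using DERIV_grad_line[of x 0 e e] x by simp
  show "0 \<le> e \<bullet> (hessian u x *v e)"
  proof (rule ccontr)
    assume "\<not> ?thesis"
    then obtain d where dd: "0 < d" "\<And>h. 0 < h \<Longrightarrow> h < d \<Longrightarrow> grad u (x + (0 + h) *\<^sub>R e) \<bullet> e < grad u (x + 0 *\<^sub>R e) \<bullet> e"
      using DERIV_neg_dec_right[OF d] by (auto simp: not_le)
    \<comment> \<open>Small enough both for the ball inside \<open>U\<close> and for the interval of
      decrease; the \<open>+ 1\<close> covers \<open>e = 0\<close>.\<close>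
    define h where "h = min (d/2) (r / (2 * (norm e + 1)))"
    have "0 < r / (2 * (norm e + 1))" using r(1) by (intro divide_pos_pos) (auto intro: add_nonneg_pos)
    then have h: "0 < h" "h < d" using dd(1) by (auto simp: h_def)
    have "h * norm e \<le> r / (2 * (norm e + 1)) * (norm e + 1)" using r by (intro mult_mono) (auto simp: h_def)
    also have "\<dots> = r / 2"
    proof -
      have "norm e + 1 \<noteq> 0" using norm_ge_zero[of e] by linarith
      then show ?thesis by (simp add: field_simps)
    qed
    finally have "h * norm e < r" using r by simp
    then have "x + h *\<^sub>R e \<in> U" using r(2) h by (auto simp: dist_norm)
    from grad_monotone[OF x this] have "0 \<le> h * ((grad u (x + h *\<^sub>R e) - grad u x) \<bullet> e)" by simp
    then have "0 \<le> (grad u (x + h *\<^sub>R e) - grad u x) \<bullet> e" using h by (simp add: zero_le_mult_iff)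
    then show False using dd(2)[OF h] by (simp add: inner_diff_left)
  qed
qed

end

section \<open>Sections\<close>

lemma convex_segment_mem:
  "\<lbrakk>convex S; x \<in> S; y \<in> S; 0 \<le> s; s \<le> 1\<rbrakk> \<Longrightarrow> x + s *\<^sub>R (y - x) \<in> S"
  using convexD_alt[of S x y s] by (simp add: algebra_simps)

text \<open>More disjoint translates of half of the polar of S - S than the volume estimates admit.
  These bound the number N by (t/8)^n N \<le> (Lam/lam) (16 n t)^n, and 8 * 16 = 128.\<close>

definition balance_count :: "real \<Rightarrow> real \<Rightarrow> nat \<Rightarrow> nat" where
  "balance_count lam Lam n = nat \<lceil>Lam / lam * (128 * real n) ^ n\<rceil> + 1"

definition balance :: "real \<Rightarrow> real \<Rightarrow> nat \<Rightarrow> real" where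
  "balance lam Lam n = 1 / (4 * real (balance_count lam Lam n))"

lemma balance_pos: "0 < balance lam Lam n" and balance_le: "balance lam Lam n \<le> 1/4"
  by (auto simp: balance_def balance_count_def field_simps)

text \<open>The constants are parameters pinned down by equations: terms stay small, and dependence
  on \<open>lam\<close>, \<open>Lam\<close> and n alone is built in.\<close>

locale monge_ampere = C2_convex U u
  for U :: "(real^'n) set" and u :: "real^'n \<Rightarrow> real" +
  fixes lam Lam :: real and c \<theta> :: real
  assumes lam_pos: "0 < lam"
    and det_ge: "x \<in> U \<Longrightarrow> lam \<le> det (hessian u x)"
    and det_le: "x \<in> U \<Longrightarrow> det (hessian u x) \<le> Lam"
    and c_eq: "c = balance lam Lam CARD('n)"
    and \<theta>_eq: "\<theta> = 1 + 1 / c"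
begin

lemma c_pos: "0 < c" unfolding c_eq by (rule balance_pos)
lemma c_le: "c \<le> 1/4" unfolding c_eq by (rule balance_le)
lemma \<theta>_ge: "1 \<le> \<theta>" unfolding \<theta>_eq using c_pos by simp

lemma hessian_form_pos: "x \<in> U \<Longrightarrow> e \<noteq> 0 \<Longrightarrow> 0 < e \<bullet> (hessian u x *v e)"
  using psd_definite[OF psd_hessian] det_ge[of x] lam_pos by force

text \<open>The mean value theorem on the segment and positive definiteness give strict
  monotonicity. Injectivity is what turns the area formula into volume estimates for sets of
  slopes.\<close>

lemma inj_grad: "inj_on (grad u) U"
proof (rule inj_onI, rule ccontr)
  fix x y assume xy: "x \<in> U" "y \<in> U" "grad u x = grad u y" "x \<noteq> y"
  let ?e = "y - x"
  let ?\<psi> = "\<lambda>s. grad u (x + s *\<^sub>R ?e) \<bullet> ?e"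
  have m: "x + s *\<^sub>R ?e \<in> U" if "0 \<le> s" "s \<le> 1" for s
    using convex_segment_mem[OF convex_U xy(1,2) that] .
  have "\<exists>s>0. s < 1 \<and> ?\<psi> 1 - ?\<psi> 0 = (1 - 0) * (?e \<bullet> (hessian u (x + s *\<^sub>R ?e) *v ?e))"
    by (rule MVT2) (auto intro!: DERIV_grad_line m)
  then obtain s where s: "0 < s" "s < 1" "?\<psi> 1 - ?\<psi> 0 = ?e \<bullet> (hessian u (x + s *\<^sub>R ?e) *v ?e)" by auto
  have "0 < ?e \<bullet> (hessian u (x + s *\<^sub>R ?e) *v ?e)"
    using m[of s] s xy(4) by (intro hessian_form_pos) auto
  with s(3) xy(3) show False by simp
qed

definition breg :: "real^'n \<Rightarrow> real^'n \<Rightarrow> real" where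
  "breg x z = u z - u x - grad u x \<bullet> (z - x)"

lemma breg_self [simp]: "breg x x = 0"
  by (simp add: breg_def)

lemma breg_nonneg: "x \<in> U \<Longrightarrow> z \<in> closure U \<Longrightarrow> 0 \<le> breg x z"
  using tangent_below[of x z] by (simp add: breg_def)

lemma breg_convex:
  assumes "a \<in> closure U" "b \<in> closure U" "0 \<le> s" "s \<le> 1"
  shows "breg x (a + s *\<^sub>R (b - a)) \<le> (1 - s) * breg x a + s * breg x b"
proof -
  have e: "a + s *\<^sub>R (b - a) = (1 - s) *\<^sub>R a + s *\<^sub>R b" by (simp add: algebra_simps)
  have "u (a + s *\<^sub>R (b - a)) \<le> (1 - s) * u a + s * u b"
    unfolding e using convex_onD[OF convex_u _ _ assms(1,2)] assms by simp
  moreover have "grad u x \<bullet> (a + s *\<^sub>R (b - a) - x) = (1 - s) * (grad u x \<bullet> (a - x)) + s * (grad u x \<bullet> (b - x))"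
    by (simp add: inner_diff_right inner_add_right algebra_simps)
  ultimately show ?thesis by (simp add: breg_def algebra_simps)
qed

lemma breg_line:
  assumes "x \<in> U" "z \<in> closure U" "0 \<le> s" "s \<le> 1"
  shows "breg x (x + s *\<^sub>R (z - x)) \<le> s * breg x z"
  using breg_convex[of x z s x] assms closure_subset by auto

lemma continuous_breg: "continuous_on (closure U) (breg x)"
  unfolding breg_def by (intro continuous_intros cont_u)

lemma breg_derivative:
  "y \<in> U \<Longrightarrow> (breg x has_derivative (\<lambda>h. (grad u y - grad u x) \<bullet> h)) (at y)"
  unfolding breg_def
  by (auto intro!: derivative_eq_intros has_derivative_u simp: inner_diff_left)

lemma breg_tangent:
  "y \<in> U \<Longrightarrow> z \<in> closure U \<Longrightarrow> breg x y + (grad u y - grad u x) \<bullet> (z - y) \<le> breg x z"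
  using tangent_below[of y z] by (simp add: breg_def inner_diff_left inner_diff_right)

text \<open>Three-point identity: moving the base point costs a constant and a linear term
  only.\<close>

lemma breg_three: "breg y z = breg x z - breg x y - (grad u y - grad u x) \<bullet> (z - y)"
  by (simp add: breg_def inner_diff_left inner_diff_right)

lemma half_in_U: "x \<in> U \<Longrightarrow> z \<in> closure U \<Longrightarrow> x + (1/2) *\<^sub>R (z - x) \<in> U"
proof -
  assume "x \<in> U" "z \<in> closure U"
  then have "z - (1/2) *\<^sub>R (z - x) \<in> interior U"
    using open_U by (intro mem_interior_closure_convex_shrink convex_U) (auto simp: interior_open)
  moreover have "z - (1/2) *\<^sub>R (z - x) = x + (1/2) *\<^sub>R (z - x)" by (simp add: vec_eq_iff field_simps)
  ultimately show ?thesis using interior_subset by auto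
qed

text \<open>As \<open>z\<close> may lie on the boundary, the argument runs at the midpoint, an
  interior point. If \<open>breg x\<close> vanished at \<open>z\<close>, it would attain its minimum
  there, so the gradients at the midpoint and at \<open>x\<close> would agree, against
  \<open>inj_grad\<close>.\<close>

lemma breg_pos:
  assumes "x \<in> U" "z \<in> closure U" "z \<noteq> x"
  shows "0 < breg x z"
proof (rule ccontr)
  assume n: "\<not> 0 < breg x z"
  let ?m = "x + (1/2) *\<^sub>R (z - x)"
  have mU: "?m \<in> U" by (rule half_in_U[OF assms(1,2)])
  have "breg x ?m \<le> (1/2) * breg x z" by (rule breg_line) (use assms in auto)
  then have min: "\<forall>y\<in>U. breg x ?m \<le> breg x y"
    using n breg_nonneg[OF assms(1)] closure_subset by fastforce
  have "(\<lambda>h. (grad u ?m - grad u x) \<bullet> h) = (\<lambda>h. 0)"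
    using differential_zero_maxmin[OF mU open_U breg_derivative[OF mU]] min by blast
  then have "(grad u ?m - grad u x) \<bullet> (grad u ?m - grad u x) = 0" by meson
  then have "grad u ?m = grad u x" by simp
  then have "?m = x" using inj_grad mU assms(1) by (meson inj_onD)
  then show False using assms(3) by simp
qed

definition sec :: "real^'n \<Rightarrow> real \<Rightarrow> (real^'n) set" where
  "sec x t = {z\<in>U. breg x z < t}"

text \<open>Admissible pairs: the section \<open>sec x t\<close> does not cross the boundary of \<open>U\<close>, so the
  function \<open>breg x - t\<close> vanishes on its whole frontier.\<close>

definition adm :: "real^'n \<Rightarrow> real \<Rightarrow> bool" where
  "adm x t \<longleftrightarrow> x \<in> U \<and> 0 < t \<and> (\<forall>z\<in>frontier U. t \<le> breg x z)"

lemma sec_subset: "sec x t \<subseteq> U" by (auto simp: sec_def)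
lemma sec_subset_closure: "sec x t \<subseteq> closure U" using sec_subset closure_subset by blast
lemma bounded_sec: "bounded (sec x t)" using bounded_U sec_subset bounded_subset by blast
lemma sec_mono: "s \<le> t \<Longrightarrow> sec x s \<subseteq> sec x t" by (auto simp: sec_def)
lemma adm_mono: "adm x t \<Longrightarrow> 0 < s \<Longrightarrow> s \<le> t \<Longrightarrow> adm x s" by (force simp: adm_def)
lemma admD: "adm x t \<Longrightarrow> x \<in> U" "adm x t \<Longrightarrow> 0 < t" by (auto simp: adm_def)
lemma self_in_sec: "adm x t \<Longrightarrow> x \<in> sec x t" by (simp add: adm_def sec_def)

lemma open_sec: "open (sec x t)"
proof -
  have "continuous_on U (breg x)" by (rule continuous_on_subset[OF continuous_breg closure_subset])
  then have "open (U \<inter> breg x -` {..<t})" using open_U by (intro continuous_open_preimage) auto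
  also have "U \<inter> breg x -` {..<t} = sec x t" by (auto simp: sec_def)
  finally show ?thesis .
qed

lemma convex_sec: "convex (sec x t)"
  unfolding convex_alt
proof (intro ballI allI impI)
  fix a b s assume h: "a \<in> sec x t" "b \<in> sec x t" "0 \<le> s \<and> s \<le> (1::real)"
  have e: "(1 - s) *\<^sub>R a + s *\<^sub>R b = a + s *\<^sub>R (b - a)" by (simp add: algebra_simps)
  have "a + s *\<^sub>R (b - a) \<in> U" using h convex_U sec_subset by (intro convex_segment_mem) auto
  moreover have "breg x (a + s *\<^sub>R (b - a)) < t"
  proof -
    have "breg x (a + s *\<^sub>R (b - a)) \<le> (1 - s) * breg x a + s * breg x b"
      using h sec_subset_closure by (intro breg_convex) auto
    also have "\<dots> < t" using h by (intro convex_bound_lt) (auto simp: sec_def)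
    finally show ?thesis .
  qed
  ultimately show "(1 - s) *\<^sub>R a + s *\<^sub>R b \<in> sec x t" unfolding e by (simp add: sec_def)
qed

lemma closed_sublevel: "closed {z\<in>closure U. breg x z \<le> t}"
proof -
  have "closed (closure U \<inter> breg x -` {..t})" using continuous_breg by (intro continuous_closed_preimage) auto
  also have "closure U \<inter> breg x -` {..t} = {z\<in>closure U. breg x z \<le> t}" by auto
  finally show ?thesis .
qed

lemma closure_sec_le:
  assumes "z \<in> closure (sec x t)"
  shows "z \<in> closure U" "breg x z \<le> t"
proof -
  have "closure (sec x t) \<subseteq> {z\<in>closure U. breg x z \<le> t}"
    using sec_subset_closure by (intro closure_minimal closed_sublevel) (auto simp: sec_def)
  then show "z \<in> closure U" "breg x z \<le> t" using assms by auto
qed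

lemma frontier_sec_eq:
  assumes "adm x t" "z \<in> closure (sec x t)" "z \<notin> sec x t"
  shows "breg x z = t"
proof (cases "z \<in> U")
  case True
  then show ?thesis using assms closure_sec_le[OF assms(2)] by (simp add: sec_def)
next
  case False
  then have "z \<in> frontier U" using closure_sec_le[OF assms(2)] open_U by (simp add: frontier_def interior_open)
  then show ?thesis using assms(1) closure_sec_le[OF assms(2)] by (force simp: adm_def)
qed

lemma det_abs_bounds: "x \<in> U \<Longrightarrow> lam \<le> \<bar>det (hessian u x)\<bar>" "x \<in> U \<Longrightarrow> \<bar>det (hessian u x)\<bar> \<le> Lam"
  using det_ge[of x] det_le[of x] lam_pos by auto

lemma grad_image_bounds:
  assumes "open E" "E \<subseteq> U"
  shows "open (grad u ` E)" "grad u ` E \<in> lmeasurable"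
    "lam * vol E \<le> vol (grad u ` E)"
    "vol (grad u ` E) \<le> Lam * vol E"
  using area_bounds[OF assms(1) bounded_subset[OF bounded_U assms(2)] inj_on_subset[OF inj_grad assms(2)]
      has_derivative_grad[OF subsetD[OF assms(2)]] continuous_on_subset[OF continuous_hessian assms(2)]
      det_abs_bounds(1)[OF subsetD[OF assms(2)]] det_abs_bounds(2)[OF subsetD[OF assms(2)]]]
  by auto

text \<open>Alexandrov's argument: minus a linear function of small slope, \<open>breg x\<close> has an interior minimum.\<close>

lemma polar_subset_grad_image:
  assumes a: "adm x t" and y: "y \<in> U" "breg x y \<le> t / 2"
  shows "(\<lambda>q. (t/4) *\<^sub>R q) ` polar ((\<lambda>w. w - y) ` sec x t) \<subseteq> (\<lambda>p. p - grad u x) ` grad u ` sec x t"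
proof clarify
  fix q assume q: "q \<in> polar ((\<lambda>w. w - y) ` sec x t)"
  have t: "0 < t" and x: "x \<in> U" using a by (auto simp: adm_def)
  let ?p = "(t/4) *\<^sub>R q"
  have ys: "y \<in> sec x t" using y t by (simp add: sec_def)
  let ?K = "closure (sec x t)"
  have qK: "q \<bullet> (w - y) \<le> 1" if "w \<in> ?K" for w
  proof -
    have "closed {w. q \<bullet> w \<le> 1 + q \<bullet> y}" by (simp add: closed_halfspace_le)
    moreover have "sec x t \<subseteq> {w. q \<bullet> w \<le> 1 + q \<bullet> y}"
      using q by (auto simp: polar_def inner_diff_right)
    ultimately have "?K \<subseteq> {w. q \<bullet> w \<le> 1 + q \<bullet> y}" by (rule closure_minimal[rotated])
    then show ?thesis using that by (auto simp: inner_diff_right)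
  qed
  let ?f = "\<lambda>w. breg x w - ?p \<bullet> (w - y)"
  have cK: "compact ?K" using bounded_sec by (simp add: compact_closure)
  have sub: "?K \<subseteq> closure U" using closure_sec_le(1) by blast
  have "continuous_on ?K ?f"
    by (intro continuous_intros continuous_on_subset[OF continuous_breg sub])
  moreover have "?K \<noteq> {}" using ys closure_subset by blast
  ultimately have "\<exists>m\<in>?K. \<forall>w\<in>?K. ?f m \<le> ?f w" by (intro continuous_attains_inf cK)
  then obtain m where m: "m \<in> ?K" and m2: "\<And>w. w \<in> ?K \<Longrightarrow> ?f m \<le> ?f w" by (elim bexE) simp
  have sK: "sec x t \<subseteq> ?K" by (rule closure_subset)
  \<comment> \<open>On the frontier of the section the function is at least t - t/4, while at
    \<open>y\<close> it is at most t/2.\<close>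
  have ms: "m \<in> sec x t"
  proof (rule ccontr)
    assume "m \<notin> sec x t"
    then have "breg x m = t" by (rule frontier_sec_eq[OF a m])
    moreover have "?f m \<le> breg x y" using m2[OF subsetD[OF sK ys]] by simp
    moreover have "?p \<bullet> (m - y) \<le> t/4" using qK[OF m] t by (simp add: mult_left_le)
    ultimately show False using y(2) t by linarith
  qed
  have mU: "m \<in> U" using ms sec_subset by blast
  have d: "(?f has_derivative (\<lambda>h. (grad u m - grad u x) \<bullet> h - ?p \<bullet> h)) (at m)"
    by (auto intro!: derivative_eq_intros breg_derivative mU)
  have mn: "\<forall>w\<in>sec x t. ?f m \<le> ?f w" using m2[OF subsetD[OF sK]] by simp
  have z: "(\<lambda>h. (grad u m - grad u x) \<bullet> h - ?p \<bullet> h) = (\<lambda>h. 0)"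
    by (rule differential_zero_maxmin[OF ms open_sec d disjI2[OF mn]])
  have "(grad u m - grad u x) \<bullet> h - ?p \<bullet> h = 0" for h using fun_cong[OF z, of h] .
  from this[of "grad u m - grad u x - ?p"]
  have "(grad u m - grad u x - ?p) \<bullet> (grad u m - grad u x - ?p) = 0" by (simp only: inner_diff_left)
  then have "grad u m - grad u x - ?p = 0" by (simp only: inner_eq_zero_iff)
  then have "?p = grad u m - grad u x" by simp
  then show "?p \<in> (\<lambda>p. p - grad u x) ` grad u ` sec x t" using ms by blast
qed

lemma open_shifted_sec: "open ((\<lambda>w. w - y) ` sec x t)"
  by (rule open_translation_subtract[OF open_sec])

lemma polar_measure_le:
  assumes a: "adm x t" and y: "y \<in> U" "breg x y \<le> t / 2"
  shows "(t/4) ^ CARD('n) * vol (polar ((\<lambda>w. w - y) ` sec x t)) \<le> Lam * vol (sec x t)"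
proof -
  have t: "0 < t" using a by (simp add: adm_def)
  have ys: "y \<in> sec x t" using y t by (simp add: sec_def)
  let ?P = "polar ((\<lambda>w. w - y) ` sec x t)"
  note g = grad_image_bounds[OF open_sec sec_subset, of x t]
  have "(t/4) ^ CARD('n) * vol ?P = vol ((\<lambda>q. (t/4) *\<^sub>R q) ` ?P)"
    using t by (simp add: measure_scaleR)
  also have "\<dots> \<le> vol ((\<lambda>p. p - grad u x) ` grad u ` sec x t)"
    using g(2) ys open_shifted_sec
    by (intro measure_mono_fmeasurable[OF polar_subset_grad_image[OF a y]] fmeasurableD lmeasurable_scaled_polar
        measurable_translation_subtract) auto
  also have "\<dots> = vol (grad u ` sec x t)" by (simp add: measure_translation_subtract)
  also have "\<dots> \<le> Lam * vol (sec x t)" by (rule g(4))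
  finally show ?thesis .
qed

text \<open>The half-size copy of the section about its balanced centre leaves room e/(8n) around
  each of its points, for every \<open>e\<close> in the difference body. The tangent inequality then
  bounds all slopes there by 8 n t against \<open>e\<close>, so they lie in a multiple of the polar.
  The lower bound on the determinant is applied to this copy, and its volume factor 2^(-n) turns 8
  into 16.\<close>

lemma sec_measure_le:
  assumes a: "adm x t"
  shows "lam * vol (sec x t) \<le> (16 * real CARD('n) * t) ^ CARD('n) * vol (polar (difset (sec x t)))"
proof -
  have t: "0 < t" and x: "x \<in> U" using a by (auto simp: adm_def)
  let ?S = "sec x t" and ?n = "real CARD('n)"
  let ?P = "polar (difset ?S)"
  have ne: "?S \<noteq> {}" using self_in_sec[OF a] by blast
  obtain z where z: "z \<in> ?S" "\<And>e. e \<in> difset ?S \<Longrightarrow> z + (1 / (4 * ?n)) *\<^sub>R e \<in> ?S"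
    using balanced_center[OF open_sec bounded_sec convex_sec ne] by metis
  let ?T = "(\<lambda>w. (1/2) *\<^sub>R w + (1/2) *\<^sub>R z) ` ?S"
  have oT: "open ?T"
  proof -
    have "?T = (\<lambda>w. (1/2) *\<^sub>R z + w) ` (\<lambda>w. (1/2) *\<^sub>R w) ` ?S" by (simp add: image_image add.commute)
    then show ?thesis using open_sec by (simp add: open_translation open_scaling)
  qed
  have TS: "?T \<subseteq> ?S" using convex_sec[of x t] z(1) by (auto intro!: convexD)
  have sub: "(\<lambda>p. p - grad u x) ` grad u ` ?T \<subseteq> (\<lambda>q. (8 * ?n * t) *\<^sub>R q) ` ?P"
  proof clarify
    fix w assume w: "w \<in> ?S"
    let ?y = "(1/2) *\<^sub>R w + (1/2) *\<^sub>R z"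
    have y: "?y \<in> ?S" using w TS by blast
    have yU: "?y \<in> U" using y sec_subset by blast
    define g where "g = grad u ?y - grad u x"
    have ge: "g \<bullet> e \<le> 8 * ?n * t" if e: "e \<in> difset ?S" for e
    proof -
      let ?z = "?y + (1 / (8 * ?n)) *\<^sub>R e"
      have "?z = (1/2) *\<^sub>R w + (1/2) *\<^sub>R (z + (1 / (4 * ?n)) *\<^sub>R e)" by (simp add: algebra_simps)
      also have "\<dots> \<in> ?S" using w z(2)[OF e] convex_sec[of x t] by (intro convexD) auto
      finally have zS: "?z \<in> ?S" .
      have "breg x ?y + g \<bullet> (?z - ?y) \<le> breg x ?z"
        using zS sec_subset_closure unfolding g_def by (intro breg_tangent yU) auto
      also have "\<dots> \<le> t" using zS by (simp add: sec_def)
      finally have "breg x ?y + (g \<bullet> e) / (8 * ?n) \<le> t" by simp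
      moreover have "0 \<le> breg x ?y" using x yU closure_subset by (intro breg_nonneg) auto
      ultimately have "(g \<bullet> e) / (8 * ?n) \<le> t" by linarith
      then show ?thesis by (simp add: field_simps)
    qed
    have "((1 / (8 * ?n * t)) *\<^sub>R g) \<bullet> e \<le> 1" if "e \<in> difset ?S" for e
      using ge[OF that] t by (simp add: pos_divide_le_eq)
    then have "(1 / (8 * ?n * t)) *\<^sub>R g \<in> ?P" by (simp add: polar_def)
    moreover have "g = (8 * ?n * t) *\<^sub>R ((1 / (8 * ?n * t)) *\<^sub>R g)" using t by simp
    ultimately show "grad u ?y - grad u x \<in> (\<lambda>q. (8 * ?n * t) *\<^sub>R q) ` ?P" unfolding g_def by (metis image_eqI)
  qed
  have TU: "?T \<subseteq> U" using TS sec_subset by blast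
  note g = grad_image_bounds[OF oT TU]
  have oN: "open (difset ?S)" "0 \<in> difset ?S" using open_difset[OF open_sec] difset_zero[OF ne] by auto
  have "lam * ((1/2) ^ CARD('n) * vol ?S) = lam * vol ?T"
    using measure_lebesgue_affine[of "1/2" "(1/2) *\<^sub>R z" ?S] by simp
  also have "\<dots> \<le> vol (grad u ` ?T)" by (rule g(3))
  also have "\<dots> = vol ((\<lambda>p. p - grad u x) ` grad u ` ?T)" by (simp only: measure_translation_subtract)
  also have "\<dots> \<le> vol ((\<lambda>q. (8 * ?n * t) *\<^sub>R q) ` ?P)"
    using g(2) oN by (intro measure_mono_fmeasurable[OF sub] fmeasurableD measurable_translation_subtract
        lmeasurable_scaled_polar) auto
  also have "\<dots> = (8 * ?n * t) ^ CARD('n) * vol ?P" using t by (intro measure_scaleR) auto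
  finally have "2 ^ CARD('n) * (lam * ((1/2) ^ CARD('n) * vol ?S))
      \<le> 2 ^ CARD('n) * ((8 * ?n * t) ^ CARD('n) * vol ?P)" by (intro mult_left_mono) auto
  moreover have "2 ^ CARD('n) * (lam * ((1/2) ^ CARD('n) * vol ?S)) = lam * vol ?S"
    by (simp add: power_divide)
  moreover have "2 ^ CARD('n) * (8 * ?n * t) ^ CARD('n) = (16 * ?n * t) ^ CARD('n)"
  proof -
    have "16 * ?n * t = 2 * (8 * ?n * t)" by simp
    then show ?thesis by (simp only: power_mult_distrib)
  qed
  ultimately show ?thesis by (simp only: mult.assoc[symmetric])
qed

text \<open>The two volume estimates compare the polars of the section seen from \<open>y\<close> and of its
  difference body. If \<open>y\<close> were too close to the frontier, the first polar would contain a long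
  segment and hence many disjoint translates of half of the second one.\<close>

theorem section_balanced:
  assumes a: "adm x t" and y: "y \<in> U" "breg x y \<le> t / 2" and e: "e \<in> difset (sec x t)"
  shows "y + c *\<^sub>R e \<in> sec x t"
proof (rule ccontr)
  assume out: "y + c *\<^sub>R e \<notin> sec x t"
  have t: "0 < t" using a by (simp add: adm_def)
  let ?S = "sec x t" and ?n = "real CARD('n)"
  let ?P = "polar (difset ?S)" and ?Y = "polar ((\<lambda>w. w - y) ` ?S)"
  have ys: "y \<in> ?S" using y t by (simp add: sec_def)
  then have ne: "?S \<noteq> {}" by blast
  have oN: "open (difset ?S)" "0 \<in> difset ?S" "bounded (difset ?S)"
    using open_difset[OF open_sec] difset_zero[OF ne] bounded_difset[OF bounded_sec] by auto
  have Ppos: "0 < vol ?P" using oN by (rule measure_polar_pos)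
  have Ym: "?Y \<in> lmeasurable" using ys open_shifted_sec by (intro lmeasurable_polar) auto
  obtain a0 b0 where ab: "a0 \<noteq> 0" "\<forall>w\<in>?S. a0 \<bullet> w \<le> b0" "b0 \<le> a0 \<bullet> (y + c *\<^sub>R e)"
    using separating_hyperplane_sets[OF convex_sec convex_singleton ne, of "y + c *\<^sub>R e"] out by auto
  obtain r where r: "r > 0" "ball y r \<subseteq> ?S" using open_sec ys open_contains_ball by metis
  have yr: "y + (r / (2 * norm a0)) *\<^sub>R a0 \<in> ?S" using r ab(1) by (intro subsetD[OF r(2)]) (simp add: dist_norm)
  have "0 < r / (2 * norm a0) * (a0 \<bullet> a0)" using r ab(1) by simp
  then have "a0 \<bullet> y < a0 \<bullet> (y + (r / (2 * norm a0)) *\<^sub>R a0)" by (simp add: inner_add_right)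
  also have "\<dots> \<le> b0" using yr ab(2) by blast
  finally have strict: "a0 \<bullet> y < a0 \<bullet> (y + c *\<^sub>R e)" using ab(3) by linarith
  define \<delta> where "\<delta> = c * (a0 \<bullet> e)"
  have \<delta>: "0 < \<delta>" using strict by (simp add: \<delta>_def inner_add_right)
  \<comment> \<open>Normal of the separating hyperplane, scaled to be at most 1 on the section seen
    from \<open>y\<close>. Its value on \<open>e\<close> is 1/c, which is large.\<close>
  define q where "q = (1 / \<delta>) *\<^sub>R a0"
  have qe: "q \<bullet> e = 1 / c" using \<delta> c_pos by (auto simp: q_def \<delta>_def)
  have qY: "q \<bullet> (w - y) \<le> 1" if "w \<in> ?S" for w
  proof -
    have "a0 \<bullet> (w - y) \<le> \<delta>" using ab(2,3) that by (force simp: inner_diff_right inner_add_right \<delta>_def)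
    then show ?thesis using \<delta> by (simp add: q_def)
  qed
  let ?N = "balance_count lam Lam CARD('n)"
  have N: "0 < ?N" by (simp add: balance_count_def)
  have cN: "1 / c = 4 * real ?N" by (simp add: c_eq balance_def)
  \<comment> \<open>For k < N these factors stay below 1/2, so half of the small polar plus
    \<open>?s k\<close> times \<open>q\<close> remains in the large one. Pairing with
    \<open>e\<close> shifts neighbouring translates by 2, whereas half of the small polar only takes
    values in [-1/2, 1/2].\<close>
  let ?s = "\<lambda>k::nat. real k / (2 * real ?N)"
  let ?B = "\<lambda>k::nat. (\<lambda>p. (1/2) *\<^sub>R p + ?s k *\<^sub>R q) ` ?P"
  have Bm: "?B k \<in> lmeasurable" for k
  proof -
    have "?B k = (+) (?s k *\<^sub>R q) ` (\<lambda>p. (1/2) *\<^sub>R p) ` ?P"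
      by (simp add: image_image add.commute)
    then show ?thesis using lmeasurable_scaled_polar[OF oN(1,2)] measurable_translation by metis
  qed
  have BY: "?B k \<subseteq> ?Y" if "k < ?N" for k
  proof -
    have "((1/2) *\<^sub>R p + ?s k *\<^sub>R q) \<bullet> (w - y) \<le> 1" if p: "p \<in> ?P" and w: "w \<in> ?S" for p w
    proof -
      have "p \<bullet> (w - y) \<le> 1" using p w ys unfolding polar_def difset_def by blast
      moreover have "?s k * (q \<bullet> (w - y)) \<le> (1/2) * 1"
      proof -
        have "?s k * (q \<bullet> (w - y)) \<le> ?s k * 1"
          by (intro mult_left_mono qY[OF w]) auto
        also have "\<dots> \<le> (1/2) * 1" using \<open>k < ?N\<close> by (simp add: field_simps)
        finally show ?thesis .
      qed
      ultimately show ?thesis unfolding inner_add_left inner_scaleR_left by linarith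
    qed
    then show ?thesis unfolding polar_def[of "(\<lambda>w. w - y) ` ?S"] by auto
  qed
  have dis: "disjnt (?B j) (?B k)" if jk: "j \<noteq> k" for j k
  proof -
    have False if p: "p \<in> ?P" "p' \<in> ?P" and eq: "(1/2) *\<^sub>R p + ?s j *\<^sub>R q = (1/2) *\<^sub>R p' + ?s k *\<^sub>R q" for p p'
    proof -
      have pe: "p \<bullet> e \<le> 1" "p' \<bullet> e \<le> 1" "- (p \<bullet> e) \<le> 1" "- (p' \<bullet> e) \<le> 1"
        using p e difset_uminus[OF e] unfolding polar_def by (auto simp: inner_minus_right[symmetric] simp del: inner_minus_right)
      from eq have "((1/2) *\<^sub>R p + ?s j *\<^sub>R q) \<bullet> e = ((1/2) *\<^sub>R p' + ?s k *\<^sub>R q) \<bullet> e" by simp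
      then have "(p \<bullet> e) / 2 + 2 * real j = (p' \<bullet> e) / 2 + 2 * real k"
        using N by (simp add: inner_add_left qe cN)
      then have "\<bar>real j - real k\<bar> \<le> 1/2" using pe by (simp add: abs_le_iff)
      then show False using jk by linarith
    qed
    then show ?thesis unfolding disjnt_def by blast
  qed
  have "real ?N * ((1/2) ^ CARD('n) * vol ?P) = (\<Sum>k<?N. vol (?B k))"
    using measure_lebesgue_affine[of "1/2" _ ?P] by simp
  also have "\<dots> = vol (\<Union>k\<in>{..<?N}. ?B k)"
    by (rule measure_UNION'[symmetric]) (use Bm dis in \<open>auto simp: pairwise_def\<close>)
  also have "\<dots> \<le> vol ?Y"
    using BY Bm by (intro measure_mono_fmeasurable Ym fmeasurableD fmeasurable.finite_UN) auto
  finally have 1: "real ?N * ((1/2) ^ CARD('n) * vol ?P) \<le> vol ?Y" .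
  let ?L = "Lam / lam"
  have Lam: "0 < Lam" using det_ge[of x] det_le[of x] lam_pos admD(1)[OF a] by linarith
  have "(t/4) ^ CARD('n) * (real ?N * ((1/2) ^ CARD('n) * vol ?P)) \<le> (t/4) ^ CARD('n) * vol ?Y"
    using 1 t by (intro mult_left_mono) auto
  also have "\<dots> \<le> Lam * vol ?S" by (rule polar_measure_le[OF a y])
  also have "\<dots> = ?L * (lam * vol ?S)" using lam_pos by simp
  also have "\<dots> \<le> ?L * ((16 * ?n * t) ^ CARD('n) * vol ?P)"
    using Lam lam_pos by (intro mult_left_mono sec_measure_le[OF a]) auto
  finally have "((t/8) ^ CARD('n) * vol ?P) * real ?N \<le> ((t/8) ^ CARD('n) * vol ?P) * (?L * (128 * ?n) ^ CARD('n))"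
    using power_mult_distrib[of "t/4" "1/2" "CARD('n)"] power_mult_distrib[of "t/8" "128 * ?n" "CARD('n)"]
    by (simp add: mult_ac)
  moreover have "0 < (t/8) ^ CARD('n) * vol ?P" using t Ppos by (intro mult_pos_pos) auto
  ultimately have "real ?N \<le> ?L * (128 * ?n) ^ CARD('n)" by (rule mult_left_le_imp_le)
  moreover have "?L * (128 * ?n) ^ CARD('n) < real ?N" unfolding balance_count_def by linarith
  ultimately show False by simp
qed

section \<open>Engulfing and shrinking of sections\<close>

lemma grad_difference_le:
  assumes a: "adm x t" and y: "y \<in> U" "breg x y \<le> t / 2" and e: "e \<in> difset (sec x t)"
  shows "\<bar>(grad u y - grad u x) \<bullet> e\<bar> \<le> t / c"
proof -
  have one: "(grad u y - grad u x) \<bullet> e \<le> t / c" if e: "e \<in> difset (sec x t)" for e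
  proof -
    \<comment> \<open>There is room c e around \<open>y\<close>, and \<open>breg x\<close> stays
      below t there, so the slope at \<open>y\<close> against \<open>e\<close> is at most
      t/c.\<close>
    have m: "y + c *\<^sub>R e \<in> sec x t" by (rule section_balanced[OF a y e])
    have "breg x y + (grad u y - grad u x) \<bullet> ((y + c *\<^sub>R e) - y) \<le> breg x (y + c *\<^sub>R e)"
      using m sec_subset_closure by (intro breg_tangent y) auto
    also have "\<dots> \<le> t" using m by (simp add: sec_def)
    finally have "c * ((grad u y - grad u x) \<bullet> e) \<le> t"
      using breg_nonneg[of x y] admD[OF a] y closure_subset by force
    then show ?thesis using c_pos by (simp add: field_simps)
  qed
  show ?thesis using one[OF e] one[OF difset_uminus[OF e]] by (simp add: abs_le_iff)
qed

text \<open>The linear term of the three-point identity is controlled by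
  \<open>grad_difference_le\<close>: t from the height and t/c from the slope give \<theta> = 1 +
  1/c. The closure is included because contact points with the frontier of \<open>U\<close> are
  needed.\<close>

lemma engulfing:
  assumes a: "adm x t" and y: "y \<in> U" "breg x y \<le> t / 2" and z: "z \<in> closure (sec x t)"
  shows "breg y z \<le> \<theta> * t"
proof -
  have "sec x t \<subseteq> {z\<in>closure U. breg y z \<le> \<theta> * t}"
  proof
    fix z assume z: "z \<in> sec x t"
    have "y \<in> sec x t" using y admD[OF a] by (simp add: sec_def)
    then have "\<bar>(grad u y - grad u x) \<bullet> (z - y)\<bar> \<le> t / c"
      using z by (intro grad_difference_le[OF a y]) (auto simp: difset_def)
    moreover have "0 \<le> breg x y" using y admD[OF a] closure_subset by (intro breg_nonneg) auto
    moreover have "breg x z < t" using z by (simp add: sec_def)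
    ultimately have "breg y z \<le> t + t / c" unfolding breg_three[of y z x] by linarith
    then show "z \<in> {z\<in>closure U. breg y z \<le> \<theta> * t}" using z sec_subset_closure by (auto simp: \<theta>_eq algebra_simps)
  qed
  then have "closure (sec x t) \<subseteq> {z\<in>closure U. breg y z \<le> \<theta> * t}" by (intro closure_minimal closed_sublevel)
  then show ?thesis using z by blast
qed

lemma shrink_step:
  assumes a: "adm x t" and y: "y \<in> U" "breg x y \<le> t / 2"
  shows "x + (1 + c) *\<^sub>R (y - x) \<in> sec x t"
proof -
  have "y \<in> sec x t" using y admD[OF a] by (simp add: sec_def)
  then have "y + c *\<^sub>R (y - x) \<in> sec x t"
    using self_in_sec[OF a] by (intro section_balanced[OF a y]) (auto simp: difset_def)
  then show ?thesis by (simp add: algebra_simps)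
qed

text \<open>Such a point is the limit of points on the segment from \<open>x\<close>, at which
  \<open>breg x\<close> is strictly below \<open>t\<close> by convexity.\<close>

lemma mem_closure_sec:
  assumes a: "adm x t" and z: "z \<in> closure U" "breg x z \<le> t"
  shows "z \<in> closure (sec x t)"
proof -
  have lim: "(\<lambda>k. x + (1 - 1 / real (Suc k)) *\<^sub>R (z - x)) \<longlonglongrightarrow> x + (1 - 0) *\<^sub>R (z - x)"
    by (intro tendsto_intros LIMSEQ_Suc[OF lim_1_over_n, unfolded o_def])
  have mem: "x + (1 - 1 / real (Suc k)) *\<^sub>R (z - x) \<in> sec x t" for k
  proof -
    have "z - (1 / real (Suc k)) *\<^sub>R (z - x) \<in> interior U"
      using admD[OF a] z open_U by (intro mem_interior_closure_convex_shrink convex_U) (auto simp: interior_open)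
    moreover have "z - (1 / real (Suc k)) *\<^sub>R (z - x) = x + (1 - 1 / real (Suc k)) *\<^sub>R (z - x)"
      by (simp add: algebra_simps)
    ultimately have U: "x + (1 - 1 / real (Suc k)) *\<^sub>R (z - x) \<in> U" using interior_subset by (metis subsetD)
    have "breg x (x + (1 - 1 / real (Suc k)) *\<^sub>R (z - x)) \<le> (1 - 1 / real (Suc k)) * breg x z"
      using z admD[OF a] by (intro breg_line) auto
    also have "\<dots> \<le> (1 - 1 / real (Suc k)) * t" using z by (intro mult_left_mono) auto
    also have "\<dots> < t" using admD[OF a] by (simp add: algebra_simps)
    finally show ?thesis using U by (simp add: sec_def)
  qed
  show ?thesis
    unfolding closure_sequential using lim mem
    by (intro exI[of _ "\<lambda>k. x + (1 - 1 / real (Suc k)) *\<^sub>R (z - x)"]) simp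
qed

text \<open>Each halving of the height gains a factor 1 + c by \<open>shrink_step\<close>, so
  sections shrink geometrically. The closure accounts for equality in the height bound when m =
  0.\<close>

lemma shrink_power:
  assumes a: "adm x t" and y: "y \<in> U" "breg x y \<le> t / 2 ^ m"
  shows "x + (1 + c) ^ m *\<^sub>R (y - x) \<in> closure (sec x t)"
  using y
proof (induction m arbitrary: y)
  case 0
  then show ?case using closure_subset by (auto intro!: mem_closure_sec[OF a])
next
  case (Suc m)
  have a': "adm x (t / 2 ^ m)" using a admD[OF a] by (intro adm_mono[OF a]) (auto simp: field_simps)
  let ?y = "x + (1 + c) *\<^sub>R (y - x)"
  have "?y \<in> sec x (t / 2 ^ m)" using Suc.prems by (intro shrink_step[OF a']) auto
  then have "x + (1 + c) ^ m *\<^sub>R (?y - x) \<in> closure (sec x t)" by (intro Suc.IH) (auto simp: sec_def)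
  then show ?case by (simp add: mult.commute)
qed

end

section \<open>Zero boundary values\<close>

text \<open>In \<open>descend\<close>, 32/c steps lower \<open>u\<close> by its whole depth. The
  contact height may grow by \<theta> at each step and must still be at most c/32 of the depth after
  them.\<close>

definition adm_factor :: "real \<Rightarrow> real \<Rightarrow> real" where
  "adm_factor c \<theta> = (c / 32) / \<theta> ^ (nat \<lceil>32 / c\<rceil>)"

text \<open>The factor 8 \<theta> leaves room for the repeated use of \<open>engulfing\<close> in
  \<open>sec_engulf\<close>. The power of two provides enough halvings for a contraction by at least
  4 in \<open>sec_subset_big\<close>.\<close>

definition radius_factor :: "real \<Rightarrow> real \<Rightarrow> real" where
  "radius_factor c \<theta> = adm_factor c \<theta> / (8 * \<theta> * 2 ^ nat \<lceil>3 / c\<rceil>)"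

locale ma_dirichlet = monge_ampere U u lam Lam c \<theta>
  for U :: "(real^'n) set" and u :: "real^'n \<Rightarrow> real" and lam Lam c \<theta> :: real +
  fixes x0 :: "real^'n"
  assumes boundary_zero: "z \<in> frontier U \<Longrightarrow> u z = 0"
    and x0: "x0 \<in> U"
    and x0_min: "y \<in> U \<Longrightarrow> u x0 \<le> u y"
    and ball_subset: "ball 0 1 \<subseteq> U"
    and subset_ball: "U \<subseteq> ball 0 (real CARD('n))"
begin

definition depth :: real where "depth = - u x0"

lemma grad_x0: "grad u x0 = 0"
proof -
  have z: "(\<lambda>h. grad u x0 \<bullet> h) = (\<lambda>h. 0)"
    by (rule differential_zero_maxmin[OF x0 open_U has_derivative_u[OF x0]]) (use x0_min in blast)
  have "grad u x0 \<bullet> grad u x0 = 0" using fun_cong[OF z, of "grad u x0"] .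
  then show ?thesis by simp
qed

lemma breg_x0: "breg x0 z = u z + depth"
  by (simp add: breg_def grad_x0 depth_def)

lemma frontier_nonempty: "frontier U \<noteq> {}"
proof -
  have "U \<noteq> UNIV" using bounded_U not_bounded_UNIV by metis
  then show ?thesis using x0 frontier_not_empty by blast
qed

lemma frontier_not_mem: "z \<in> frontier U \<Longrightarrow> z \<notin> U"
  using open_U by (simp add: frontier_def interior_open)

lemma frontier_closure: "z \<in> frontier U \<Longrightarrow> z \<in> closure U"
  by (simp add: frontier_def)

lemma depth_pos: "0 < depth"
proof -
  obtain z where z: "z \<in> frontier U" using frontier_nonempty by blast
  have "0 < breg x0 z" using z x0 frontier_not_mem frontier_closure by (intro breg_pos) auto
  then show ?thesis using boundary_zero[OF z] by (simp add: breg_x0)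
qed

lemma adm_x0: "adm x0 depth"
  unfolding adm_def using x0 depth_pos boundary_zero by (simp add: breg_x0)

text \<open>Otherwise the maximum would be attained inside. It would be a critical point, hence the
  minimum point \<open>x0\<close> by injectivity of the gradient, although \<open>u x0\<close> lies
  below the boundary values. It follows that \<open>U\<close> is itself a section at
  \<open>x0\<close>.\<close>

lemma u_neg: "z \<in> U \<Longrightarrow> u z < 0"
proof (rule ccontr)
  assume z: "z \<in> U" "\<not> u z < 0"
  have cK: "compact (closure U)" using bounded_U by (simp add: compact_closure)
  have "\<exists>m\<in>closure U. \<forall>w\<in>closure U. u w \<le> u m"
    using z closure_subset by (intro continuous_attains_sup cK cont_u) blast
  then obtain m where m: "m \<in> closure U" and mm: "\<And>w. w \<in> closure U \<Longrightarrow> u w \<le> u m" by (elim bexE) simp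
  have int: False if p: "p \<in> U" and pm: "\<And>w. w \<in> closure U \<Longrightarrow> u w \<le> u p" for p
  proof -
    have pU: "\<forall>w\<in>U. u w \<le> u p" using pm closure_subset by blast
    have e: "(\<lambda>h. grad u p \<bullet> h) = (\<lambda>h. 0)"
      by (rule differential_zero_maxmin[OF p open_U has_derivative_u[OF p] disjI1[OF pU]])
    have "grad u p \<bullet> grad u p = 0" using fun_cong[OF e, of "grad u p"] .
    then have "p = x0" using inj_onD[OF inj_grad _ p x0] grad_x0 by simp
    moreover obtain z where z: "z \<in> frontier U" using frontier_nonempty by blast
    ultimately have "0 \<le> u x0" using pm[OF frontier_closure[OF z]] boundary_zero[OF z] by simp
    then show False using depth_pos by (simp add: depth_def)
  qed
  have "m \<notin> U" using int mm by blast
  then have "u m = 0" using m open_U by (intro boundary_zero) (simp add: frontier_def interior_open)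
  then have "u w \<le> u z" if "w \<in> closure U" for w using mm[OF that] z(2) by simp
  then show False using int[OF z(1)] by blast
qed

lemma u_nonpos: "z \<in> closure U \<Longrightarrow> u z \<le> 0"
  using u_neg[of z] boundary_zero[of z] open_U by (cases "z \<in> U") (auto simp: frontier_def interior_open)

lemma sec_x0: "sec x0 depth = U"
  using u_neg by (auto simp: sec_def breg_x0)

text \<open>Alexandrov's estimate for the section \<open>U\<close> at \<open>x0\<close>. The polar
  of \<open>U\<close> seen from \<open>x0\<close> contains a ball of radius 1/(2n), and the volume
  of \<open>U\<close> is at most that of B(0,n); hence (depth/(8 n^2))^n \<le> Lam. Taking
  \<open>max 1 Lam\<close> avoids the n-th root.\<close>

lemma depth_le: "depth \<le> 8 * (real CARD('n))\<^sup>2 * max 1 Lam"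
proof -
  let ?n = "real CARD('n)" and ?N = "CARD('n)"
  let ?b = "vol (ball 0 1 :: (real^'n) set)"
  have n: "1 \<le> ?n" by (simp add: Suc_leI)
  have b: "0 < ?b" using content_ball_pos[of 1 "0::real^'n"] by simp
  have sc: "vol (ball 0 r :: (real^'n) set) = r ^ ?N * ?b" if "0 \<le> r" for r
    using content_ball_conv_unit_ball[OF that, of "0::real^'n"] by simp
  let ?K = "(\<lambda>w. w - x0) ` U"
  have K: "?K \<subseteq> cball 0 (2 * ?n)"
  proof clarify
    fix w assume "w \<in> U"
    then have "norm w < ?n" "norm x0 < ?n" using subset_ball x0 by auto
    then show "w - x0 \<in> cball 0 (2 * ?n)" using norm_triangle_ineq4[of w x0] by simp
  qed
  have P: "polar ?K \<in> lmeasurable"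
    using x0 open_U by (intro lmeasurable_polar open_translation_subtract) auto
  have "(1 / (2 * ?n)) ^ ?N * ?b \<le> vol (polar ?K)"
    using sc[of "1 / (2 * ?n)"] polar_supset_ball[OF K] n P
    by (metis (no_types, lifting) divide_nonneg_pos fmeasurableD lmeasurable_ball measure_mono_fmeasurable
        mult_pos_pos of_nat_0_less_iff zero_le_one zero_less_card_finite zero_less_numeral)
  then have "(depth / 4) ^ ?N * ((1 / (2 * ?n)) ^ ?N * ?b) \<le> (depth / 4) ^ ?N * vol (polar ?K)"
    using depth_pos by (intro mult_left_mono) auto
  also have "\<dots> \<le> Lam * vol U"
    using polar_measure_le[OF adm_x0 x0] depth_pos by (simp add: sec_x0)
  also have "\<dots> \<le> Lam * (?n ^ ?N * ?b)"
  proof (rule mult_left_mono)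
    have "vol U \<le> vol (ball 0 ?n :: (real^'n) set)"
      using open_U by (intro measure_mono_fmeasurable subset_ball) auto
    then show "vol U \<le> ?n ^ ?N * ?b" using sc[of ?n] by simp
    show "0 \<le> Lam" using det_ge[OF x0] det_le[OF x0] lam_pos by linarith
  qed
  finally have "((depth / 4) ^ ?N * (1 / (2 * ?n)) ^ ?N) * ?b \<le> (Lam * ?n ^ ?N) * ?b" by (simp only: mult_ac)
  then have "(depth / 4) ^ ?N * (1 / (2 * ?n)) ^ ?N \<le> Lam * ?n ^ ?N" using b by simp
  then have "(depth / (8 * ?n)) ^ ?N \<le> Lam * ?n ^ ?N"
    using power_mult_distrib[of "depth / 4" "1 / (2 * ?n)" ?N] by simp
  then have "(depth / (8 * ?n)) ^ ?N / ?n ^ ?N \<le> Lam" using n by (simp add: pos_divide_le_eq)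
  then have p: "(depth / (8 * ?n\<^sup>2)) ^ ?N \<le> Lam"
    using power_divide[of "depth / (8 * ?n)" ?n ?N] by (simp add: power2_eq_square mult.assoc)
  have "depth / (8 * ?n\<^sup>2) \<le> max 1 Lam"
  proof (cases "depth / (8 * ?n\<^sup>2) \<le> 1")
    case False
    then have "(depth / (8 * ?n\<^sup>2)) ^ 1 \<le> (depth / (8 * ?n\<^sup>2)) ^ ?N"
      by (intro power_increasing) (auto simp: Suc_leI)
    then show ?thesis using p by simp
  qed (rule order_trans[OF _ max.cobounded1])
  then show ?thesis using n by (simp add: pos_divide_le_eq mult.commute)
qed

text \<open>If the largest section around \<open>x\<close> contained in \<open>U\<close> is very low, then by balancedness it
  extends beyond \<open>x\<close> on the side opposite to its contact point with the boundary, where \<open>u\<close> is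
  smaller by a definite factor. Iterating this would push \<open>u\<close> below its minimum.\<close>

lemma descend_step:
  assumes x: "x \<in> U" and z: "z \<in> frontier U" and min: "\<And>w. w \<in> frontier U \<Longrightarrow> breg x z \<le> breg x w"
  shows "\<exists>b\<in>U. u b \<le> (1 + c / 4) * u x + breg x z \<and> breg b z \<le> \<theta> * breg x z"
proof -
  let ?T = "breg x z"
  have zc: "z \<in> closure U" using z frontier_closure by blast
  have T: "0 < ?T" using x z zc frontier_not_mem by (intro breg_pos) auto
  have a: "adm x ?T" using x T min by (simp add: adm_def)
  \<comment> \<open>The contact point \<open>z\<close> is not in the open section, so half of the
    vector from \<open>x\<close> to \<open>z\<close> is used.\<close>
  let ?w = "x + (1/2) *\<^sub>R (z - x)"
  have w: "?w \<in> sec x ?T"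
    using breg_line[OF x zc, of "1/2"] half_in_U[OF x zc] T by (simp add: sec_def)
  have "x - ?w \<in> difset (sec x ?T)" using w self_in_sec[OF a] unfolding difset_def by blast
  then have p: "x + c *\<^sub>R (x - ?w) \<in> sec x ?T" using T by (intro section_balanced[OF a x]) auto
  let ?p = "x + c *\<^sub>R (x - ?w)"
  \<comment> \<open>Halfway back from \<open>?p\<close> to \<open>x\<close>, where
    \<open>breg x\<close> is at most half the height, as \<open>engulfing\<close> requires. The two
    halvings produce the c/4.\<close>
  let ?b = "x + (1/2) *\<^sub>R (?p - x)"
  have pU: "?p \<in> closure U" using p sec_subset_closure by blast
  have bU: "?b \<in> U" by (rule half_in_U[OF x pU])
  have bb: "breg x ?b \<le> ?T / 2"
    using breg_line[OF x pU, of "1/2"] p by (simp add: sec_def)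
  have "?b - x = - (c / 4) *\<^sub>R (z - x)" by (simp add: algebra_simps)
  then have "grad u x \<bullet> (?b - x) = - (c / 4) * (grad u x \<bullet> (z - x))" by simp
  moreover have "grad u x \<bullet> (z - x) = - u x - ?T" using boundary_zero[OF z] by (simp add: breg_def)
  ultimately have "u ?b = breg x ?b + u x + (c / 4) * (u x + ?T)" by (simp add: breg_def algebra_simps)
  also have "\<dots> \<le> ?T / 2 + u x + (c / 4) * u x + (1/2) * ?T"
  proof -
    have "(c / 4) * ?T \<le> (1/2) * ?T" using c_le T by (intro mult_right_mono) auto
    then show ?thesis using bb by (simp add: algebra_simps)
  qed
  finally have 1: "u ?b \<le> (1 + c / 4) * u x + ?T" by (simp add: algebra_simps)
  have "breg ?b z \<le> \<theta> * ?T" by (rule engulfing[OF a bU bb mem_closure_sec[OF a zc]]) simp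
  with 1 bU show ?thesis by blast
qed

lemma frontier_min_breg:
  assumes "x \<in> U"
  shows "\<exists>z\<in>frontier U. \<forall>w\<in>frontier U. breg x z \<le> breg x w"
proof (rule continuous_attains_inf)
  show "compact (frontier U)" using bounded_U by (rule compact_frontier_bounded)
  show "continuous_on (frontier U) (breg x)"
    using frontier_closure by (intro continuous_on_subset[OF continuous_breg]) auto
qed (rule frontier_nonempty)

text \<open>Each step gains c/4 of |u x|, that is at least c * depth/16, and loses at most the
  contact height, which is at most c * depth/32. So \<open>u\<close> stays below - depth/4 and the
  step can be repeated, while the contact height grows by at most \<theta>.\<close>

lemma descend:
  assumes "x \<in> U" "z \<in> frontier U" "u x \<le> - depth / 4" "breg x z \<le> \<tau>" "\<tau> * \<theta> ^ j \<le> c * depth / 32" "0 \<le> \<tau>"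
  shows "\<exists>b\<in>U. u b \<le> u x - real j * (c * depth / 32)"
  using assms
proof (induction j arbitrary: x z \<tau>)
  case 0
  then show ?case by auto
next
  case (Suc j)
  obtain z' where z': "z' \<in> frontier U" "\<And>w. w \<in> frontier U \<Longrightarrow> breg x z' \<le> breg x w"
    using frontier_min_breg[OF Suc.prems(1)] by blast
  have T: "breg x z' \<le> \<tau>" using z'(2)[OF Suc.prems(2)] Suc.prems(4) by simp
  obtain b where b: "b \<in> U" "u b \<le> (1 + c / 4) * u x + breg x z'" "breg b z' \<le> \<theta> * breg x z'"
    using descend_step[OF Suc.prems(1) z'] by blast
  have p1: "1 \<le> \<theta> ^ Suc j" using \<theta>_ge by (rule one_le_power)
  have "\<tau> * 1 \<le> \<tau> * \<theta> ^ Suc j" using p1 Suc.prems(6) by (intro mult_left_mono) auto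
  then have \<tau>: "\<tau> \<le> c * depth / 32" using Suc.prems(5) by simp
  have "(c / 4) * u x \<le> (c / 4) * (- depth / 4)" using Suc.prems(3) c_pos by (intro mult_left_mono) auto
  then have ub: "u b \<le> u x - c * depth / 32" using b(2) T \<tau> by (simp add: algebra_simps)
  have "0 < c * depth" using c_pos depth_pos by simp
  then have ub4: "u b \<le> - depth / 4" using ub Suc.prems(3) by simp
  have "\<theta> * breg x z' \<le> \<theta> * \<tau>" using T \<theta>_ge by (intro mult_left_mono) auto
  then have bb: "breg b z' \<le> \<theta> * \<tau>" using b(3) by simp
  obtain b' where b': "b' \<in> U" "u b' \<le> u b - real j * (c * depth / 32)"
    using Suc.IH[OF b(1) z'(1) ub4 bb] Suc.prems(5,6) \<theta>_ge by (auto simp: mult_ac)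
  have "real (Suc j) * (c * depth / 32) = real j * (c * depth / 32) + c * depth / 32" by (simp add: algebra_simps)
  then have "u b' \<le> u x - real (Suc j) * (c * depth / 32)" using b'(2) ub by linarith
  then show ?case using b'(1) by blast
qed

definition adm_height :: real where "adm_height = adm_factor c \<theta> * depth"

lemma adm_factor_pos: "0 < adm_factor c \<theta>"
  using c_pos \<theta>_ge by (simp add: adm_factor_def)

lemma adm_height_pos: "0 < adm_height"
  using adm_factor_pos depth_pos by (simp add: adm_height_def)

text \<open>A contact below \<open>adm_height\<close> would allow at least 32/c descent steps,
  lowering \<open>u\<close> by its full depth from a negative value and hence below its
  minimum.\<close>

lemma interior_adm:
  assumes x: "x \<in> U" "u x \<le> - depth / 4"
  shows "adm x adm_height"
proof (rule ccontr)
  assume "\<not> ?thesis"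
  then obtain z where z: "z \<in> frontier U" "breg x z \<le> adm_height"
    using x adm_height_pos by (auto simp: adm_def)
  let ?j = "nat \<lceil>32 / c\<rceil>"
  have "adm_height * \<theta> ^ ?j \<le> c * depth / 32"
    using \<theta>_ge by (simp add: adm_height_def adm_factor_def)
  then obtain b where b: "b \<in> U" "u b \<le> u x - real ?j * (c * depth / 32)"
    using descend[OF x(1) z(1) x(2) z(2)] adm_height_pos by force
  have "32 / c \<le> real ?j" by linarith
  then have "(32 / c) * (c * depth / 32) \<le> real ?j * (c * depth / 32)"
    using c_pos depth_pos by (intro mult_right_mono) auto
  then have "depth \<le> real ?j * (c * depth / 32)" using c_pos by simp
  then have "u b \<le> u x - depth" using b(2) by linarith
  then have "u b < u x0" using x(2) depth_pos unfolding depth_def by linarith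
  then show False using x0_min[OF b(1)] by simp
qed

text \<open>The closed version of U/2: it is compact, so that a covering by sections has a finite
  subcovering.\<close>

definition half :: "(real^'n) set" where "half = (\<lambda>p. x0 + (1/2) *\<^sub>R (p - x0)) ` closure U"
definition big :: "(real^'n) set" where "big = {y. x0 + (4/3) *\<^sub>R (y - x0) \<in> U}"

lemma compact_half: "compact half"
  unfolding half_def using bounded_U
  by (intro compact_continuous_image continuous_intros) (simp add: compact_closure)

lemma u_dilate_le:
  assumes "p \<in> closure U" "0 \<le> s" "s \<le> 1"
  shows "u (x0 + s *\<^sub>R (p - x0)) \<le> - (1 - s) * depth"
proof -
  have "breg x0 (x0 + s *\<^sub>R (p - x0)) \<le> s * breg x0 p" using x0 assms by (intro breg_line) auto
  also have "\<dots> \<le> s * depth" using u_nonpos[OF assms(1)] assms(2) by (intro mult_left_mono) (auto simp: breg_x0)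
  finally show ?thesis by (simp add: breg_x0 algebra_simps)
qed

lemma halfD: "x \<in> half \<Longrightarrow> x \<in> U" "x \<in> half \<Longrightarrow> u x \<le> - depth / 2"
  using half_in_U[OF x0] u_dilate_le[of _ "1/2"] by (auto simp: half_def)

lemma bigD:
  assumes "y \<in> big"
  shows "y \<in> U" "u y \<le> - depth / 4"
proof -
  let ?p = "x0 + (4/3) *\<^sub>R (y - x0)"
  have p: "?p \<in> U" using assms by (simp add: big_def)
  have e: "y = x0 + (3/4) *\<^sub>R (?p - x0)" by simp
  show "y \<in> U" by (subst e, rule convex_segment_mem[OF convex_U x0 p]) auto
  show "u y \<le> - depth / 4"
    using u_dilate_le[of ?p "3/4"] p closure_subset by auto
qed

lemma open_big: "open big"
proof -
  have "big = (\<lambda>y. x0 + (4/3) *\<^sub>R (y - x0)) -` U" by (auto simp: big_def)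
  then show ?thesis using open_U by (simp, intro open_vimage continuous_intros) auto
qed

lemma adm_half: "x \<in> half \<Longrightarrow> adm x adm_height"
  using interior_adm[of x] halfD[of x] depth_pos by auto

definition radius :: real where "radius = radius_factor c \<theta> * depth"

lemma radius_factor_pos: "0 < radius_factor c \<theta>"
  using adm_factor_pos \<theta>_ge by (simp add: radius_factor_def)

lemma radius_pos: "0 < radius"
  using radius_factor_pos depth_pos by (simp add: radius_def)

lemma radius_le: "8 * \<theta> * radius \<le> adm_height" "8 * radius \<le> adm_height"
    "radius \<le> adm_height / 2 ^ nat \<lceil>3 / c\<rceil>"
proof -
  let ?m = "nat \<lceil>3 / c\<rceil>"
  have e: "8 * \<theta> * radius = adm_height / 2 ^ ?m"
    using \<theta>_ge by (simp add: radius_def radius_factor_def adm_height_def)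
  have "adm_height / 2 ^ ?m \<le> adm_height / 1"
    using adm_height_pos by (intro divide_left_mono) auto
  then show 1: "8 * \<theta> * radius \<le> adm_height" using e by simp
  have "8 * 1 * radius \<le> 8 * \<theta> * radius" using \<theta>_ge radius_pos by (intro mult_right_mono mult_left_mono) auto
  then show "8 * radius \<le> adm_height" "radius \<le> adm_height / 2 ^ ?m" using 1 e radius_pos by simp_all
qed

text \<open>By Bernoulli's inequality 3/c halvings of the height contract by at least 4, so x + 4(y
  - x) still lies in the closure of \<open>U\<close>. Combining it with the doubled point of
  \<open>x\<close> gives room for the dilation by 4/3.\<close>

lemma sec_subset_big:
  assumes x: "x \<in> half" and t: "t \<le> radius"
  shows "sec x t \<subseteq> big"
proof
  fix y assume y: "y \<in> sec x t"
  let ?m = "nat \<lceil>3 / c\<rceil>"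
  have yU: "y \<in> U" using y sec_subset by blast
  have "breg x y \<le> adm_height / 2 ^ ?m" using y t radius_le(3) by (simp add: sec_def)
  then have v: "x + (1 + c) ^ ?m *\<^sub>R (y - x) \<in> closure U"
    using shrink_power[OF adm_half[OF x] yU] closure_sec_le(1) by blast
  have "3 / c \<le> real ?m" by linarith
  then have "3 / c * c \<le> real ?m * c" using c_pos by (intro mult_right_mono) auto
  then have "3 \<le> real ?m * c" using c_pos by simp
  moreover have "1 + real ?m * c \<le> (1 + c) ^ ?m" using Bernoulli_inequality[of c ?m] c_pos by simp
  ultimately have L: "4 \<le> (1 + c) ^ ?m" by linarith
  let ?L = "(1 + c) ^ ?m"
  have xc: "x \<in> closure U" using halfD(1)[OF x] closure_subset by blast
  have "x + (4 / ?L) *\<^sub>R ((x + ?L *\<^sub>R (y - x)) - x) \<in> closure U"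
    using L by (intro convex_segment_mem[OF convex_closure[OF convex_U] xc v]) auto
  then have w: "x + 4 *\<^sub>R (y - x) \<in> closure U" using L by simp
  obtain p where p: "p \<in> closure U" "x = x0 + (1/2) *\<^sub>R (p - x0)" using x by (auto simp: half_def)
  let ?w = "x + 4 *\<^sub>R (y - x)"
  \<comment> \<open>With \<open>x0\<close> as origin x = p/2 and w = 4y - (3/2)p. These weights
    cancel p and give (8/5)y, and the factor 5/6 below brings it to (4/3)y, in the interior.\<close>
  let ?q = "(3/5) *\<^sub>R p + (2/5) *\<^sub>R ?w"
  have q: "?q \<in> closure U"
    using p(1) w convex_closure[OF convex_U] by (intro convexD) auto
  have "?q - (1/6) *\<^sub>R (?q - x0) \<in> interior U"
    using x0 open_U by (intro mem_interior_closure_convex_shrink[OF convex_U _ q]) (auto simp: interior_open)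
  moreover have "?q - (1/6) *\<^sub>R (?q - x0) = x0 + (4/3) *\<^sub>R (y - x0)"
    unfolding p(2) by (simp add: vec_eq_iff field_simps)
  ultimately show "y \<in> big" using interior_subset by (auto simp: big_def)
qed

text \<open>A common point w becomes the base. \<open>engulfing\<close> from \<open>y\<close> and
  from \<open>x\<close>, both at doubled heights, puts \<open>z\<close> and \<open>x\<close> into a
  section at w of height 8 \<theta> t, with \<open>x\<close> in its lower half. This section is
  admissible because w lies in \<open>big\<close>. A third application, from w back to
  \<open>x\<close>, gives 8 \<theta>^2 t.\<close>

lemma sec_engulf:
  assumes x: "x \<in> half" and y: "y \<in> half" and t: "0 < t" "t \<le> radius" and s: "0 < s" "s \<le> radius" "s \<le> 2 * t"
    and meet: "sec x t \<inter> sec y s \<noteq> {}" and K: "8 * \<theta>\<^sup>2 < K"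
  shows "sec y s \<subseteq> sec x (K * t)"
proof
  fix z assume z: "z \<in> sec y s"
  obtain w where w: "w \<in> sec x t" "w \<in> sec y s" using meet by blast
  have wU: "w \<in> U" "z \<in> U" using w z sec_subset by blast+
  have ax: "adm x (2 * t)" and ay: "adm y (2 * s)"
    using adm_half[OF x] adm_half[OF y] t s radius_le(2) by (auto intro: adm_mono)
  have aw: "adm w (8 * \<theta> * t)"
  proof -
    have "8 * \<theta> * t \<le> 8 * \<theta> * radius" using t \<theta>_ge by (intro mult_left_mono) auto
    then have "8 * \<theta> * t \<le> adm_height" using radius_le(1) by simp
    have "w \<in> big" using w(1) sec_subset_big[OF x t(2)] by blast
    then have "adm w adm_height" by (intro interior_adm bigD)
    then show ?thesis using \<open>8 * \<theta> * t \<le> adm_height\<close> t \<theta>_ge by (elim adm_mono) auto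
  qed
  have "z \<in> sec y (2 * s)" "x \<in> sec x (2 * t)" using z sec_mono[of s "2 * s" y] s self_in_sec[OF ax] by auto
  then have cl: "z \<in> closure (sec y (2 * s))" "x \<in> closure (sec x (2 * t))" using closure_subset by blast+
  have "breg w z \<le> \<theta> * (2 * s)" by (rule engulfing[OF ay wU(1) _ cl(1)]) (use w in \<open>auto simp: sec_def\<close>)
  also have "\<dots> \<le> \<theta> * (4 * t)" using s \<theta>_ge by (intro mult_left_mono) auto
  also have "\<dots> < 8 * \<theta> * t" using t \<theta>_ge by simp
  finally have "z \<in> sec w (8 * \<theta> * t)" using wU by (simp add: sec_def)
  then have zc: "z \<in> closure (sec w (8 * \<theta> * t))" using closure_subset by blast
  have "breg w x \<le> \<theta> * (2 * t)" by (rule engulfing[OF ax wU(1) _ cl(2)]) (use w in \<open>auto simp: sec_def\<close>)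
  also have "\<dots> \<le> 8 * \<theta> * t / 2" using t \<theta>_ge by simp
  finally have "breg x z \<le> \<theta> * (8 * \<theta> * t)" by (intro engulfing[OF aw halfD(1)[OF x] _ zc])
  also have "\<dots> = 8 * \<theta>\<^sup>2 * t" by (simp add: power2_eq_square)
  also have "\<dots> < K * t" using K t by simp
  finally show "z \<in> sec x (K * t)" using wU by (simp add: sec_def)
qed

end

section \<open>The Hessian on a section\<close>

lemma bounded_linear_matrix: "bounded_linear (\<lambda>h. (A::real^'n^'m) *v h)"
  by (simp add: linear_conv_bounded_linear[symmetric])

lemma mnorm_nonneg: "0 \<le> mnorm A"
  unfolding mnorm_def by (rule onorm_pos_le[OF bounded_linear_matrix])

lemma form_le_mnorm: "v \<bullet> (A *v v) \<le> mnorm A * (norm v)\<^sup>2"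
proof -
  have "v \<bullet> (A *v v) \<le> norm v * norm (A *v v)" by (rule norm_cauchy_schwarz)
  also have "\<dots> \<le> norm v * (mnorm A * norm v)"
    unfolding mnorm_def by (intro mult_left_mono onorm[OF bounded_linear_matrix]) auto
  finally show ?thesis by (simp add: power2_eq_square mult_ac)
qed

lemma mnorm_le_norm: "mnorm (A::real^'n^'n) \<le> (real CARD('n))\<^sup>2 * norm A"
proof -
  have "\<bar>A $ i $ j\<bar> \<le> norm A" for i j
    using component_le_norm_cart[of "A $ i" j] Finite_Cartesian_Product.norm_nth_le[of A i] by linarith
  then show ?thesis using onorm_le_matrix_component[of A "norm A"]
    by (simp add: mnorm_def power2_eq_square)
qed

lemma mnorm_triangle: "mnorm (A + B) \<le> mnorm A + mnorm B"
  using onorm_triangle[OF bounded_linear_matrix bounded_linear_matrix, of A B]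
  by (simp add: mnorm_def matrix_vector_mult_add_rdistrib)

lemma continuous_mnorm: "continuous_on UNIV (mnorm :: real^'n^'n \<Rightarrow> real)"
proof -
  have "\<bar>mnorm A - mnorm B\<bar> \<le> (real CARD('n))\<^sup>2 * norm (A - B)" for A B :: "real^'n^'n"
    using mnorm_triangle[of B "A - B"] mnorm_triangle[of A "B - A"] mnorm_le_norm[of "A - B"] mnorm_le_norm[of "B - A"]
    by (simp add: norm_minus_commute abs_le_iff)
  then have "((real CARD('n))\<^sup>2)-lipschitz_on UNIV (mnorm :: real^'n^'n \<Rightarrow> real)"
    by (intro lipschitz_onI) (auto simp: dist_norm)
  then show ?thesis by (rule lipschitz_on_continuous_on)
qed

text \<open>Both arguments of the form are expanded in the frame with dual vectors
  \<open>g i\<close>. Cauchy-Schwarz for the form reduces mixed entries to diagonal ones, which are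
  the quantities controlled by second derivatives along frame vectors.\<close>

lemma mnorm_le_frame:
  fixes Q F :: "real^'n^'n"
  assumes Q: "psd Q" and rep: "\<And>e. e = (\<Sum>i\<in>UNIV. (g i \<bullet> e) *\<^sub>R F $ i)"
  shows "mnorm Q \<le> real CARD('n) * (\<Sum>i\<in>UNIV. (norm (g i))\<^sup>2 * (F $ i \<bullet> (Q *v F $ i)))"
  unfolding mnorm_def
proof (rule onorm_le)
  fix e
  let ?B = "real CARD('n) * (\<Sum>i\<in>UNIV. (norm (g i))\<^sup>2 * (F $ i \<bullet> (Q *v F $ i)))"
  \<comment> \<open>Testing the form against \<open>Q *v e\<close> itself produces the squared norm
    of \<open>Q *v e\<close>.\<close>
  define w where "w = Q *v e"
  define a where "a i = norm (g i) * sqrt (F $ i \<bullet> (Q *v F $ i))" for i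
  have a0: "0 \<le> a i" for i by (simp add: a_def psd_nonneg[OF Q])
  have Qs: "Q *v (\<Sum>i\<in>UNIV. b i *\<^sub>R v i) = (\<Sum>i\<in>UNIV. b i *\<^sub>R (Q *v v i))" for b and v :: "'n \<Rightarrow> real^'n"
    by (simp only: linear_sum[OF matrix_vector_mul_linear[of Q]] matrix_vector_mult_scaleR)
  have "w \<bullet> (Q *v e) = (\<Sum>i\<in>UNIV. \<Sum>j\<in>UNIV. (g i \<bullet> w) * ((g j \<bullet> e) * (F $ i \<bullet> (Q *v F $ j))))"
  proof -
    have l: "w \<bullet> v = (\<Sum>i\<in>UNIV. (g i \<bullet> w) * (F $ i \<bullet> v))" for v
      using arg_cong[OF rep[of w], of "\<lambda>z. z \<bullet> v"] by (simp add: inner_sum_left)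
    have r: "F $ i \<bullet> (Q *v e) = (\<Sum>j\<in>UNIV. (g j \<bullet> e) * (F $ i \<bullet> (Q *v F $ j)))" for i
      using arg_cong[OF rep[of e], of "\<lambda>z. F $ i \<bullet> (Q *v z)"] by (simp add: Qs inner_sum_right)
    show ?thesis by (simp only: l r sum_distrib_left)
  qed
  also have "\<dots> \<le> (\<Sum>i\<in>UNIV. \<Sum>j\<in>UNIV. (norm w * a i) * (norm e * a j))"
  proof (intro sum_mono)
    fix i j
    have "(g i \<bullet> w) * ((g j \<bullet> e) * (F $ i \<bullet> (Q *v F $ j))) \<le> \<bar>g i \<bullet> w\<bar> * (\<bar>g j \<bullet> e\<bar> * \<bar>F $ i \<bullet> (Q *v F $ j)\<bar>)"
      by (metis abs_ge_self abs_mult)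
    also have "\<dots> \<le> (norm (g i) * norm w) * ((norm (g j) * norm e) * (sqrt (F $ i \<bullet> (Q *v F $ i)) * sqrt (F $ j \<bullet> (Q *v F $ j))))"
      by (intro mult_mono Cauchy_Schwarz_ineq2 psd_abs_le[OF Q] mult_nonneg_nonneg) (auto simp: psd_nonneg[OF Q])
    finally show "(g i \<bullet> w) * ((g j \<bullet> e) * (F $ i \<bullet> (Q *v F $ j))) \<le> (norm w * a i) * (norm e * a j)"
      by (simp add: a_def mult_ac)
  qed
  also have "\<dots> = (norm w * norm e) * (\<Sum>i\<in>UNIV. a i)\<^sup>2"
    by (simp add: power2_eq_square sum_product sum_distrib_left mult_ac)
  also have "\<dots> \<le> (norm w * norm e) * ?B"
  proof (rule mult_left_mono)
    have "(\<Sum>i\<in>UNIV. a i)\<^sup>2 \<le> (\<Sum>i\<in>UNIV. (a i)\<^sup>2) * real CARD('n)"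
      by (rule sum_squared_le_sum_of_squares)
    also have "\<dots> = ?B" by (simp add: a_def power_mult_distrib psd_nonneg[OF Q])
    finally show "(\<Sum>i\<in>UNIV. a i)\<^sup>2 \<le> ?B" .
  qed auto
  finally have "norm w * norm w \<le> norm w * (?B * norm e)" by (simp add: w_def dot_square_norm power2_eq_square mult_ac)
  then have "norm w \<le> ?B * norm e"
    by (cases "w = 0") (auto intro!: mult_nonneg_nonneg sum_nonneg psd_nonneg[OF Q])
  then show "norm (Q *v e) \<le> ?B * norm e" by (simp add: w_def)
qed

text \<open>Hadamard's inequality up to the factor \<open>n!\<close>, by applying Cauchy--Schwarz to every term of the Leibniz formula.\<close>

lemma det_psd_le:
  fixes Q F :: "real^'n^'n"
  assumes Q: "psd Q"
  shows "det Q * (det F)\<^sup>2 \<le> fact CARD('n) * (\<Prod>i\<in>UNIV. F $ i \<bullet> (Q *v F $ i))"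
proof -
  let ?R = "F ** Q ** transpose F"
  have R: "?R $ i $ j = F $ i \<bullet> (Q *v F $ j)" for i j
  proof -
    have "?R $ i $ j = (\<Sum>k\<in>UNIV. (\<Sum>l\<in>UNIV. F $ i $ l * Q $ l $ k) * F $ j $ k)"
      by (simp add: matrix_matrix_mult_def transpose_def)
    also have "\<dots> = (\<Sum>l\<in>UNIV. \<Sum>k\<in>UNIV. F $ i $ l * Q $ l $ k * F $ j $ k)"
      unfolding sum_distrib_right by (rule sum.swap)
    also have "\<dots> = F $ i \<bullet> (Q *v F $ j)"
      by (simp add: inner_vec_def matrix_vector_mult_def sum_distrib_left mult_ac)
    finally show ?thesis .
  qed
  define q where "q i = F $ i \<bullet> (Q *v F $ i)" for i
  have q0: "0 \<le> q i" for i by (simp add: q_def psd_nonneg[OF Q])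
  have "det Q * (det F)\<^sup>2 = det ?R" by (simp add: det_mul det_transpose power2_eq_square)
  also have "\<dots> \<le> (\<Sum>p | p permutes (UNIV::'n set). \<bar>of_int (sign p) * (\<Prod>i\<in>UNIV. ?R $ i $ p i)\<bar>)"
    unfolding det_def by (rule order_trans[OF abs_ge_self sum_abs])
  also have "\<dots> \<le> (\<Sum>p | p permutes (UNIV::'n set). (\<Prod>i\<in>UNIV. q i))"
  proof (rule sum_mono)
    fix p assume "p \<in> {p. p permutes (UNIV::'n set)}"
    then have p: "bij p" using permutes_bij by blast
    have "\<bar>of_int (sign p) * (\<Prod>i\<in>UNIV. ?R $ i $ p i)\<bar> = (\<Prod>i\<in>UNIV. \<bar>?R $ i $ p i\<bar>)"
      by (simp add: abs_mult abs_prod sign_def)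
    also have "\<dots> \<le> (\<Prod>i\<in>UNIV. sqrt (q i) * sqrt (q (p i)))"
      unfolding R q_def by (intro prod_mono conjI psd_abs_le[OF Q]) auto
    also have "\<dots> = (\<Prod>i\<in>UNIV. sqrt (q i)) * (\<Prod>i\<in>UNIV. sqrt (q (p i)))" by (rule prod.distrib)
    also have "(\<Prod>i\<in>UNIV. sqrt (q (p i))) = (\<Prod>i\<in>UNIV. sqrt (q i))"
      by (rule prod.reindex_bij_betw[OF p])
    also have "(\<Prod>i\<in>UNIV. sqrt (q i)) * (\<Prod>i\<in>UNIV. sqrt (q i)) = (\<Prod>i\<in>UNIV. q i)"
      unfolding prod.distrib[symmetric] by (intro prod.cong refl) (use q0 in simp)
    finally show "\<bar>of_int (sign p) * (\<Prod>i\<in>UNIV. ?R $ i $ p i)\<bar> \<le> (\<Prod>i\<in>UNIV. q i)" .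
  qed
  also have "\<dots> = fact CARD('n) * (\<Prod>i\<in>UNIV. q i)"
    by (simp add: card_permutations[OF refl])
  finally show ?thesis by (simp add: q_def)
qed

lemma emeasure_bounded_borel:
  fixes A :: "'a::euclidean_space set"
  assumes "A \<in> sets borel" "bounded A"
  shows "emeasure lborel A = ennreal (vol A)"
proof -
  have "emeasure lborel A \<noteq> \<infinity>" using emeasure_bounded_finite[OF assms(2)] by simp
  then have "emeasure lborel A = ennreal (measure lborel A)"
    by (intro emeasure_eq_ennreal_measure) simp
  then show ?thesis using assms(1) by (simp add: measure_completion)
qed

lemma nn_integral_lborel_translate:
  fixes g :: "'a::euclidean_space \<Rightarrow> ennreal"
  assumes [measurable]: "g \<in> borel_measurable borel"
  shows "(\<integral>\<^sup>+y. g y \<partial>lborel) = (\<integral>\<^sup>+z. g (v + z) \<partial>lborel)"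
  by (subst lborel_distr_plus[of v, symmetric]) (simp add: nn_integral_distr)

context monge_ampere
begin

lemma sec_scale_mem:
  assumes "adm x t" "w \<in> sec x t" "0 < k" "k \<le> 1"
  shows "x + k *\<^sub>R (w - x) \<in> sec x (k * t)"
proof -
  have w: "w \<in> U" "breg x w < t" using assms(2) by (auto simp: sec_def)
  have "breg x (x + k *\<^sub>R (w - x)) \<le> k * breg x w"
    using assms admD(1)[OF assms(1)] w closure_subset by (intro breg_line) auto
  also have "\<dots> < k * t" using w assms by simp
  finally show ?thesis
    using assms admD(1)[OF assms(1)] w convex_U by (auto simp: sec_def intro!: convex_segment_mem)
qed

lemma difset_sec_scale:
  assumes "adm x t" "e \<in> difset (sec x t)" "0 < k" "k \<le> 1"
  shows "k *\<^sub>R e \<in> difset (sec x (k * t))"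
proof -
  obtain w w' where w: "w \<in> sec x t" "w' \<in> sec x t" "e = w - w'" using assms(2) unfolding difset_def by blast
  have "k *\<^sub>R e = (x + k *\<^sub>R (w - x)) - (x + k *\<^sub>R (w' - x))" by (simp add: w(3) algebra_simps)
  then show ?thesis using sec_scale_mem[OF assms(1)] w assms unfolding difset_def by blast
qed

lemma sec_move:
  assumes a: "adm x (2 * t)" and y: "y \<in> sec x t" and e: "e \<in> difset (sec x (2 * t))" and s: "0 \<le> s" "s \<le> c"
  shows "y + s *\<^sub>R e \<in> sec x (2 * t)"
proof -
  have t: "0 < t" using admD(2)[OF a] by simp
  have y': "y \<in> U" "breg x y \<le> 2 * t / 2" "y \<in> sec x (2 * t)"
    using y t sec_mono[of t "2 * t" x] by (auto simp: sec_def)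
  have "y + c *\<^sub>R e \<in> sec x (2 * t)" by (rule section_balanced[OF a y'(1,2) e])
  then have "y + (s / c) *\<^sub>R ((y + c *\<^sub>R e) - y) \<in> sec x (2 * t)"
    using s c_pos y'(3) by (intro convex_segment_mem[OF convex_sec]) auto
  then show ?thesis using c_pos by simp
qed

text \<open>Convexity of \<open>breg x\<close>, which vanishes at \<open>x\<close>: the contraction
  by 1/k towards \<open>x\<close> lowers heights at least by the same factor.\<close>

lemma measure_sec_scale:
  assumes a: "adm x (k * t)" and k: "1 \<le> k"
  shows "vol (sec x (k * t)) \<le> k ^ CARD('n) * vol (sec x t)"
proof -
  have sub: "sec x (k * t) \<subseteq> (\<lambda>w. k *\<^sub>R w + (x - k *\<^sub>R x)) ` sec x t"
  proof
    fix w assume w: "w \<in> sec x (k * t)"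
    have "x + (1/k) *\<^sub>R (w - x) \<in> sec x ((1/k) * (k * t))" using k by (intro sec_scale_mem[OF a w]) auto
    then have "x + (1/k) *\<^sub>R (w - x) \<in> sec x t" using k by simp
    moreover have "w = k *\<^sub>R (x + (1/k) *\<^sub>R (w - x)) + (x - k *\<^sub>R x)" using k by (simp add: algebra_simps)
    ultimately show "w \<in> (\<lambda>w. k *\<^sub>R w + (x - k *\<^sub>R x)) ` sec x t" by (metis image_eqI)
  qed
  have "(\<lambda>w. k *\<^sub>R w + (x - k *\<^sub>R x)) ` sec x t \<in> lmeasurable"
  proof -
    have "(\<lambda>w. k *\<^sub>R w + (x - k *\<^sub>R x)) ` sec x t = (+) (x - k *\<^sub>R x) ` (\<lambda>w. k *\<^sub>R w) ` sec x t"
      by (simp add: image_image add.commute)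
    also have "\<dots> \<in> lmeasurable"
      using k open_sec bounded_sec
      by (intro measurable_translation lmeasurable_open open_scaling bounded_scaling) auto
    finally show ?thesis .
  qed
  then have "vol (sec x (k * t)) \<le> vol ((\<lambda>w. k *\<^sub>R w + (x - k *\<^sub>R x)) ` sec x t)"
    using open_sec by (intro measure_mono_fmeasurable[OF sub]) auto
  then show ?thesis using k by (simp add: measure_lebesgue_affine)
qed

lemma emeasure_sec: "emeasure lborel (sec x t) = ennreal (vol (sec x t))"
  using open_sec bounded_sec by (intro emeasure_bounded_borel) auto

text \<open>Averaging the fundamental theorem of calculus over all segments in direction \<open>e\<close> replaces
  the divergence theorem.\<close>

lemma hessian_form_integral:
  assumes a: "adm x (8 * t)" and e: "e \<in> difset (sec x (8 * t))"
  shows "(\<integral>\<^sup>+y. ennreal (e \<bullet> (hessian u y *v e)) * indicator (sec x t) y \<partial>lborel)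
    \<le> ennreal (64 * 2 ^ CARD('n) / c\<^sup>2 * t * vol (sec x t))"
proof -
  have t: "0 < t" using admD(2)[OF a] by simp
  have a2: "adm x (2 * t)" and a4: "adm x (2 * (2 * t))" using a t by (auto intro: adm_mono)
  \<comment> \<open>Extension by zero makes the integrand Borel on the whole space, where
    translation and Fubini take place.\<close>
  define q where "q y = indicator U y *\<^sub>R (e \<bullet> (hessian u y *v e))" for y
  have q[measurable]: "q \<in> borel_measurable borel"
    unfolding q_def by (rule borel_measurable_continuous_on_indicator[OF _ continuous_hessian_form])
      (use open_U in auto)
  have qU: "q y = e \<bullet> (hessian u y *v e)" if "y \<in> U" for y using that by (simp add: q_def)
  have q0: "0 \<le> q y" for y using psd_nonneg[OF psd_hessian] by (simp add: q_def indicator_def)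
  have e4: "(1/2) *\<^sub>R e \<in> difset (sec x (2 * (2 * t)))" using difset_sec_scale[OF a e, of "1/2"] by simp
  have e2: "- ((1/4) *\<^sub>R e) \<in> difset (sec x (2 * t))"
    using difset_sec_scale[OF a e, of "1/4"] by (intro difset_uminus) simp
  \<comment> \<open>The vectors e/2 and e/4 belong to the difference bodies at heights 4 t and 2 t.
    Hence a shift by s e with s \<le> c/4 leads from height t to 2 t, and from 2 t to 4 t.\<close>
  let ?r = "c / 4"
  have r: "0 < ?r" using c_pos by simp
  have m4: "z + s *\<^sub>R e \<in> sec x (4 * t)" if "z \<in> sec x (2 * t)" "0 \<le> s" "s \<le> ?r" for z s
    using sec_move[OF a4 that(1) e4, of "2 * s"] that by simp
  have m2: "y - s *\<^sub>R e \<in> sec x (2 * t)" if "y \<in> sec x t" "0 \<le> s" "s \<le> ?r" for y s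
    using sec_move[OF a2 that(1) e2, of "4 * s"] that by simp
  have S[measurable]: "sec x t \<in> sets borel" "sec x (2 * t) \<in> sets borel" using open_sec by auto
  let ?I = "\<integral>\<^sup>+y. ennreal (q y) * indicator (sec x t) y \<partial>lborel"
  have "ennreal ?r * ?I = (\<integral>\<^sup>+s. ?I * indicator {0..?r} s \<partial>lborel)"
    using r by (subst nn_integral_cmult_indicator) (auto simp: mult.commute)
  also have "\<dots> \<le> (\<integral>\<^sup>+s. (\<integral>\<^sup>+z. ennreal (q (s *\<^sub>R e + z)) * indicator (sec x (2 * t)) z * indicator {0..?r} s \<partial>lborel) \<partial>lborel)"
  proof (intro nn_integral_mono)
    fix s :: real
    show "?I * indicator {0..?r} s \<le> (\<integral>\<^sup>+z. ennreal (q (s *\<^sub>R e + z)) * indicator (sec x (2 * t)) z * indicator {0..?r} s \<partial>lborel)"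
    proof (cases "s \<in> {0..?r}")
      case True
      have "?I = (\<integral>\<^sup>+z. ennreal (q (s *\<^sub>R e + z)) * indicator (sec x t) (s *\<^sub>R e + z) \<partial>lborel)"
        by (rule nn_integral_lborel_translate) measurable
      also have "\<dots> \<le> (\<integral>\<^sup>+z. ennreal (q (s *\<^sub>R e + z)) * indicator (sec x (2 * t)) z \<partial>lborel)"
      proof (intro nn_integral_mono mult_left_mono)
        fix z show "indicator (sec x t) (s *\<^sub>R e + z) \<le> (indicator (sec x (2 * t)) z :: ennreal)"
          using m2[of "s *\<^sub>R e + z" s] True by (auto simp: indicator_def)
      qed simp
      finally show ?thesis using True by simp
    qed simp
  qed
  also have "\<dots> = (\<integral>\<^sup>+z. (\<integral>\<^sup>+s. ennreal (q (s *\<^sub>R e + z)) * indicator (sec x (2 * t)) z * indicator {0..?r} s \<partial>lborel) \<partial>lborel)"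
    by (rule lborel_pair.Fubini'[symmetric]) measurable
  also have "\<dots> \<le> (\<integral>\<^sup>+z. ennreal (16 * t / c) * indicator (sec x (2 * t)) z \<partial>lborel)"
  proof (intro nn_integral_mono)
    fix z
    show "(\<integral>\<^sup>+s. ennreal (q (s *\<^sub>R e + z)) * indicator (sec x (2 * t)) z * indicator {0..?r} s \<partial>lborel)
      \<le> ennreal (16 * t / c) * indicator (sec x (2 * t)) z"
    proof (cases "z \<in> sec x (2 * t)")
      case True
      let ?F = "\<lambda>s. grad u (z + s *\<^sub>R e) \<bullet> e"
      have zU: "z + s *\<^sub>R e \<in> U" if "s \<in> {0..?r}" for s using m4[OF True, of s] that sec_subset by auto
      have "(\<integral>\<^sup>+s. ennreal (q (s *\<^sub>R e + z)) * indicator {0..?r} s \<partial>lborel) = ennreal (?F ?r - ?F 0)"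
      proof (rule nn_integral_FTC_Icc)
        show "(\<lambda>s. q (s *\<^sub>R e + z)) \<in> borel_measurable borel" by measurable
        fix s assume s: "s \<in> {0..?r}"
        show "(?F has_real_derivative q (s *\<^sub>R e + z)) (at s)"
          using DERIV_grad_line[OF zU[OF s]] qU[OF zU[OF s]] by (simp add: add.commute)
      qed (use q0 r in auto)
      also have "\<dots> \<le> ennreal (16 * t / c)"
      proof (rule ennreal_leI)
        \<comment> \<open>\<open>grad_difference_le\<close> at height 8 t covers points of height at
          most 4 t, which is where the shifted segments stay. This fixes the 8 in the
          hypothesis.\<close>
        have b: "\<bar>(grad u w - grad u x) \<bullet> e\<bar> \<le> 8 * t / c" if "w \<in> sec x (4 * t)" for w
          using that by (intro grad_difference_le[OF a _ _ e]) (auto simp: sec_def)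
        have "\<bar>(grad u (z + ?r *\<^sub>R e) - grad u x) \<bullet> e\<bar> \<le> 8 * t / c" "\<bar>(grad u (z + 0 *\<^sub>R e) - grad u x) \<bullet> e\<bar> \<le> 8 * t / c"
          using m4[OF True, of ?r] m4[OF True, of 0] r by (auto intro!: b)
        then show "?F ?r - ?F 0 \<le> 16 * t / c" by (simp add: inner_diff_left abs_le_iff)
      qed
      finally show ?thesis using True by simp
    qed simp
  qed
  also have "\<dots> = ennreal (16 * t / c) * ennreal (vol (sec x (2 * t)))"
    using S(2) emeasure_sec[of x "2 * t"] by (subst nn_integral_cmult_indicator) auto
  also have "\<dots> \<le> ennreal (16 * t / c) * ennreal (2 ^ CARD('n) * vol (sec x t))"
    using measure_sec_scale[OF a2] by (intro mult_left_mono ennreal_leI) auto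
  also have "\<dots> = ennreal (16 * t / c * (2 ^ CARD('n) * vol (sec x t)))"
    by (rule ennreal_mult[symmetric]) (use t c_pos in auto)
  finally have 1: "ennreal ?r * ?I \<le> ennreal (16 * t / c * (2 ^ CARD('n) * vol (sec x t)))" .
  have "?I = ennreal (1 / ?r) * (ennreal ?r * ?I)"
    using r by (simp add: mult.assoc[symmetric] ennreal_mult[symmetric])
  also have "\<dots> \<le> ennreal (1 / ?r) * ennreal (16 * t / c * (2 ^ CARD('n) * vol (sec x t)))"
    using 1 by (rule mult_left_mono) simp
  also have "\<dots> = ennreal (1 / ?r * (16 * t / c * (2 ^ CARD('n) * vol (sec x t))))"
    using r t by (subst ennreal_mult) auto
  also have "1 / ?r * (16 * t / c * (2 ^ CARD('n) * vol (sec x t))) = 64 * 2 ^ CARD('n) / c\<^sup>2 * t * vol (sec x t)"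
    using c_pos by (simp add: power2_eq_square field_simps)
  finally have "?I \<le> ennreal (64 * 2 ^ CARD('n) / c\<^sup>2 * t * vol (sec x t))" .
  moreover have "?I = (\<integral>\<^sup>+y. ennreal (e \<bullet> (hessian u y *v e)) * indicator (sec x t) y \<partial>lborel)"
    using sec_subset[of x t] qU by (intro nn_integral_cong) (auto simp: indicator_def subset_iff)
  ultimately show ?thesis by simp
qed

end

section \<open>Lower bound for the Hessian on half of a section\<close>

lemma frame_dual:
  fixes F :: "real^'n^'n"
  assumes "det F \<noteq> 0"
  obtains g :: "'n \<Rightarrow> real^'n" where "\<And>e. e = (\<Sum>i\<in>UNIV. (g i \<bullet> e) *\<^sub>R F $ i)"
    "\<And>a j. g j \<bullet> (\<Sum>i\<in>UNIV. a $ i *\<^sub>R F $ i) = a $ j"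
    "\<And>j e. det (\<chi> i. if i = j then e else F $ i) = (g j \<bullet> e) * det F"
proof -
  obtain G where G: "F ** G = mat 1" "G ** F = mat 1"
    using assms by (metis invertible_det_nz invertible_def)
  define g where "g i = transpose G $ i" for i
  have ga: "g i \<bullet> e = (transpose G *v e) $ i" for i e
    by (simp only: g_def matrix_vector_mul_component)
  have FG: "transpose F ** transpose G = mat 1" "transpose G ** transpose F = mat 1"
    by (simp_all only: matrix_transpose_mul[symmetric] G transpose_mat)
  have 1: "e = (\<Sum>i\<in>UNIV. (g i \<bullet> e) *\<^sub>R F $ i)" for e
  proof -
    have "(\<Sum>i\<in>UNIV. (g i \<bullet> e) *\<^sub>R F $ i) = transpose F *v (transpose G *v e)"
      unfolding ga by (rule frame_image)
    also have "\<dots> = e" by (simp only: matrix_vector_mul_assoc FG matrix_vector_mul_lid)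
    finally show ?thesis by simp
  qed
  have 2: "g j \<bullet> (\<Sum>i\<in>UNIV. a $ i *\<^sub>R F $ i) = a $ j" for a j
    unfolding frame_image ga by (simp only: matrix_vector_mul_assoc FG matrix_vector_mul_lid)
  have row: "row i F = F $ i" for i by (simp add: row_def vec_eq_iff)
  have 3: "det (\<chi> i. if i = j then e else F $ i) = (g j \<bullet> e) * det F" for j e
    using cramer_lemma_transpose[of j "\<chi> i. g i \<bullet> e" F]
    unfolding row scalar_mult_eq_scaleR vec_lambda_beta 1[of e, symmetric] .
  show thesis using 1 2 3 by (rule that)
qed

lemma inner_sgn: "v \<bullet> sgn v = norm (v::'a::real_inner)"
  by (cases "v = 0") (auto simp: sgn_div_norm dot_square_norm power2_eq_square field_simps)

lemma borel_measurable_ennreal_indicator: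
  fixes f :: "'a::euclidean_space \<Rightarrow> real"
  assumes "open A" "continuous_on A f"
  shows "(\<lambda>y. ennreal (f y) * indicator A y) \<in> borel_measurable borel"
proof -
  have "(\<lambda>y. indicator A y *\<^sub>R f y) \<in> borel_measurable borel"
    using assms by (intro borel_measurable_continuous_on_indicator) auto
  then have "(\<lambda>y. ennreal (indicator A y *\<^sub>R f y)) \<in> borel_measurable borel" by measurable
  moreover have "(\<lambda>y. ennreal (indicator A y *\<^sub>R f y)) = (\<lambda>y. ennreal (f y) * indicator A y)"
    by (auto simp: indicator_def)
  ultimately show ?thesis by simp
qed

definition form_const :: "real \<Rightarrow> nat \<Rightarrow> real" where
  "form_const c n = 64 * 2 ^ n / c\<^sup>2"

text \<open>The constant produced when det D^2 u \<ge> lam is solved for |D^2 u| in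
  \<open>hessian_large_portion\<close>: n! comes from Hadamard's inequality, (3n)^n from the frame
  determinant, and the power n - 1 from the frame vectors left in place.\<close>

definition portion_const :: "real \<Rightarrow> real \<Rightarrow> real \<Rightarrow> nat \<Rightarrow> real" where
  "portion_const lam Lam c n = (real n)\<^sup>2 * form_const c n / lam *
     (Lam * fact n * (3 * real n) ^ n * (2 * real n * form_const c n) ^ (n - 1))"

context monge_ampere
begin

lemma continuous_mnorm_hessian: "continuous_on U (\<lambda>y. hnorm y)"
  by (rule continuous_on_compose2[OF continuous_mnorm continuous_hessian]) auto

lemma borel_superlevel:
  assumes "open S" "S \<subseteq> U"
  shows "{y\<in>S. b \<le> a * hnorm y} \<in> sets borel"
proof -
  have "open (S \<inter> (\<lambda>y. a * hnorm y) -` {..<b})"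
    by (intro continuous_open_preimage assms open_lessThan continuous_intros
        continuous_on_subset[OF continuous_mnorm_hessian])
  then have "S - (S \<inter> (\<lambda>y. a * hnorm y) -` {..<b}) \<in> sets borel" using assms(1) by auto
  moreover have "S - (S \<inter> (\<lambda>y. a * hnorm y) -` {..<b}) = {y\<in>S. b \<le> a * hnorm y}" by auto
  ultimately show ?thesis by simp
qed

lemma lmeasurable_superlevel:
  assumes "open S" "S \<subseteq> U" "bounded S"
  shows "{y\<in>S. b \<le> a * hnorm y} \<in> lmeasurable"
proof -
  have "{y\<in>S. b \<le> a * hnorm y} \<in> sets lebesgue"
    using borel_superlevel[OF assms(1,2), of b a] by (simp add: sets_completionI_sets)
  then show ?thesis
    using assms(3) by (intro bounded_set_imp_lmeasurable) (auto intro: bounded_subset)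
qed

text \<open>Markov's inequality, with real-valued volumes.\<close>

lemma measure_superlevel_le:
  assumes S: "open S" "S \<subseteq> U" "bounded S" and f: "continuous_on S f" and b: "0 < b"
    and I: "(\<integral>\<^sup>+y. ennreal (f y) * indicator S y \<partial>lborel) \<le> ennreal m" "0 \<le> m"
  shows "b * vol {y\<in>S. b < f y} \<le> m"
proof -
  let ?B = "{y\<in>S. b < f y}"
  have "open (S \<inter> f -` {b<..})" by (intro continuous_open_preimage f S open_greaterThan)
  moreover have "S \<inter> f -` {b<..} = ?B" by auto
  ultimately have oB: "open ?B" by simp
  have eB: "emeasure lborel ?B = ennreal (vol ?B)"
    using oB S(3) by (intro emeasure_bounded_borel) (auto intro: bounded_subset)
  have "ennreal (b * vol ?B) = ennreal b * emeasure lborel ?B"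
    unfolding eB using b by (intro ennreal_mult) auto
  also have "\<dots> = (\<integral>\<^sup>+y. ennreal b * indicator ?B y \<partial>lborel)"
    using oB by (subst nn_integral_cmult_indicator) auto
  also have "\<dots> \<le> (\<integral>\<^sup>+y. ennreal (f y) * indicator S y \<partial>lborel)"
    by (intro nn_integral_mono) (auto simp: indicator_def intro!: ennreal_leI)
  also have "\<dots> \<le> ennreal m" by (rule I)
  finally show ?thesis using I(2) by simp
qed

text \<open>Here \<alpha> is n K t times the sum of the squared lengths of the dual vectors of a
  maximal frame of the difference body, which bounds the mean of |D^2 u| by
  \<open>mnorm_le_frame\<close>. Off a set of at most half the volume, all second derivatives along
  frame vectors are at most 2 n K t. There the lower bound on the determinant forces the second
  derivative along the longest dual vector up to a multiple of \<alpha>.\<close>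

lemma hessian_large_portion:
  fixes x t
  defines "S \<equiv> sec x t" and "K \<equiv> form_const c CARD('n)" and "C \<equiv> portion_const lam Lam c CARD('n)"
  assumes a: "adm x (8 * t)"
  obtains \<alpha> where "0 \<le> \<alpha>"
    "(\<integral>\<^sup>+y. ennreal (hnorm y) * indicator S y \<partial>lborel) \<le> ennreal (\<alpha> * vol S)"
    "vol S \<le> 2 * vol {y\<in>S. \<alpha> \<le> C * hnorm y}"
    "\<And>r. 0 < r \<Longrightarrow> ball 0 r \<subseteq> difset (sec x (8 * t)) \<Longrightarrow> \<alpha> \<le> 16 * (real CARD('n))\<^sup>2 * K * t / r\<^sup>2"
proof -
  let ?n = "real CARD('n)" and ?N = "CARD('n)"
  let ?T = "sec x (8 * t)" and ?m = "vol S"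
  let ?f = hnorm
  have t: "0 < t" using admD(2)[OF a] by simp
  have n: "0 < ?n" by simp
  have K: "0 < K" unfolding K_def form_const_def using c_pos by simp
  have xU: "x \<in> U" by (rule admD(1)[OF a])
  have Lam: "0 < Lam" using det_ge[OF xU] det_le[OF xU] lam_pos by linarith
  have xT: "x \<in> ?T" by (rule self_in_sec[OF a])
  have SU: "S \<subseteq> U" unfolding S_def by (rule sec_subset)
  have oS: "open S" unfolding S_def by (rule open_sec)
  have bS: "bounded S" unfolding S_def by (rule bounded_sec)
  have Tne: "difset ?T \<noteq> {}" using difset_zero[of ?T] xT by blast
  obtain F :: "real^'n^'n" where F: "det F \<noteq> 0" "\<And>i. F $ i \<in> difset ?T"
    "\<And>w. w \<in> difset ?T \<Longrightarrow> \<exists>a. w = (\<Sum>i\<in>UNIV. a $ i *\<^sub>R F $ i) \<and> (\<forall>i. \<bar>a $ i\<bar> \<le> 2)"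
  proof (rule maximal_frame)
    show "open (difset ?T)" "bounded (difset ?T)" "convex (difset ?T)"
      by (rule open_difset bounded_difset convex_difset open_sec bounded_sec convex_sec)+
    show "difset ?T \<noteq> {}" by (rule Tne)
    show "\<And>w. w \<in> difset ?T \<Longrightarrow> - w \<in> difset ?T" by (rule difset_uminus)
  qed blast
  obtain g where g: "\<And>e. e = (\<Sum>i\<in>UNIV. (g i \<bullet> e) *\<^sub>R F $ i)"
    "\<And>a j. g j \<bullet> (\<Sum>i\<in>UNIV. a $ i *\<^sub>R F $ i) = a $ j"
    "\<And>j e. det (\<chi> i. if i = j then e else F $ i) = (g j \<bullet> e) * det F"
    by (rule frame_dual[OF F(1)]) (rule that)
  let ?q = "\<lambda>i y. F $ i \<bullet> (hessian u y *v F $ i)"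
  have q0: "0 \<le> ?q i y" if "y \<in> U" for i y using psd_nonneg[OF psd_hessian[OF that]] .
  have qc: "continuous_on S (?q i)" for i by (rule continuous_on_subset[OF continuous_hessian_form SU])
  have I: "(\<integral>\<^sup>+y. ennreal (?q i y) * indicator S y \<partial>lborel) \<le> ennreal (K * t * ?m)" for i
    using hessian_form_integral[OF a F(2)] unfolding S_def K_def form_const_def .
  define \<alpha> where "\<alpha> = ?n * (K * t) * (\<Sum>i\<in>UNIV. (norm (g i))\<^sup>2)"
  have \<alpha>0: "0 \<le> \<alpha>" using K t by (auto simp: \<alpha>_def intro!: mult_nonneg_nonneg sum_nonneg)
  have 1: "(\<integral>\<^sup>+y. ennreal (?f y) * indicator S y \<partial>lborel) \<le> ennreal (\<alpha> * ?m)"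
  proof -
    have "(\<integral>\<^sup>+y. ennreal (?f y) * indicator S y \<partial>lborel)
      \<le> (\<integral>\<^sup>+y. (\<Sum>i\<in>UNIV. ennreal (?n * (norm (g i))\<^sup>2) * (ennreal (?q i y) * indicator S y)) \<partial>lborel)"
    proof (intro nn_integral_mono)
      fix y
      show "ennreal (?f y) * indicator S y \<le> (\<Sum>i\<in>UNIV. ennreal (?n * (norm (g i))\<^sup>2) * (ennreal (?q i y) * indicator S y))"
      proof (cases "y \<in> S")
        case True
        then have yU: "y \<in> U" using SU by blast
        have "?f y \<le> (\<Sum>i\<in>UNIV. ?n * (norm (g i))\<^sup>2 * ?q i y)"
          using mnorm_le_frame[OF psd_hessian[OF yU] g(1)] by (simp add: sum_distrib_left mult.assoc)
        then have "ennreal (?f y) \<le> ennreal (\<Sum>i\<in>UNIV. ?n * (norm (g i))\<^sup>2 * ?q i y)" by (rule ennreal_leI)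
        also have "\<dots> = (\<Sum>i\<in>UNIV. ennreal (?n * (norm (g i))\<^sup>2 * ?q i y))"
          using q0[OF yU] by (intro sum_ennreal[symmetric]) auto
        also have "\<dots> = (\<Sum>i\<in>UNIV. ennreal (?n * (norm (g i))\<^sup>2) * ennreal (?q i y))"
          using q0[OF yU] by (intro sum.cong refl ennreal_mult) auto
        finally show ?thesis using True by simp
      qed simp
    qed
    also have "\<dots> = (\<Sum>i\<in>UNIV. ennreal (?n * (norm (g i))\<^sup>2) * (\<integral>\<^sup>+y. ennreal (?q i y) * indicator S y \<partial>lborel))"
      using borel_measurable_ennreal_indicator[OF oS qc]
      by (subst nn_integral_sum) (auto simp: nn_integral_cmult)
    also have "\<dots> \<le> (\<Sum>i\<in>UNIV. ennreal (?n * (norm (g i))\<^sup>2) * ennreal (K * t * ?m))"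
      by (intro sum_mono mult_left_mono I) auto
    also have "\<dots> = (\<Sum>i\<in>UNIV. ennreal (?n * (norm (g i))\<^sup>2 * (K * t * ?m)))"
      using K t by (intro sum.cong refl ennreal_mult[symmetric]) auto
    also have "\<dots> = ennreal (\<Sum>i\<in>UNIV. ?n * (norm (g i))\<^sup>2 * (K * t * ?m))"
      using K t by (intro sum_ennreal) auto
    also have "(\<Sum>i\<in>UNIV. ?n * (norm (g i))\<^sup>2 * (K * t * ?m)) = \<alpha> * ?m"
      by (simp add: \<alpha>_def sum_distrib_left sum_distrib_right mult_ac)
    finally show ?thesis .
  qed
  \<comment> \<open>The section at height 8 t has volume at most 6^n |det F|, and its polar has
    volume at least n^(-n) / |det F|. Alexandrov's upper estimate at \<open>x\<close> compares the
    two.\<close>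
  have dF: "(t / (3 * ?n)) ^ ?N \<le> Lam * (det F)\<^sup>2"
  proof -
    let ?P = "vol (polar (difset ?T))"
    have sub: "polar (difset ?T) \<subseteq> polar ((\<lambda>w. w - x) ` ?T)"
      using xT by (intro polar_antimono) (auto simp: difset_def)
    have z: "open ((\<lambda>w. w - x) ` ?T)" "0 \<in> (\<lambda>w. w - x) ` ?T" using xT open_shifted_sec by auto
    have "(2 * t) ^ ?N * ?P \<le> (2 * t) ^ ?N * vol (polar ((\<lambda>w. w - x) ` ?T))"
      using t difset_zero[of ?T] xT
      by (intro mult_left_mono measure_mono_fmeasurable[OF sub] lmeasurable_polar[OF z] fmeasurableD
          lmeasurable_polar open_difset open_sec) auto
    also have "\<dots> \<le> Lam * vol ?T" using polar_measure_le[OF a xU] t by simp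
    also have "\<dots> \<le> Lam * (6 ^ ?N * \<bar>det F\<bar>)"
      using Lam by (intro mult_left_mono measure_le_frame[OF F(1) xT _ F(3)] lmeasurable_open bounded_sec open_sec) auto
    finally have A: "(2 * t) ^ ?N * ?P \<le> Lam * (6 ^ ?N * \<bar>det F\<bar>)" .
    have B: "(1 / ?n) ^ ?N \<le> \<bar>det F\<bar> * ?P"
      using xT by (intro measure_polar_ge_frame F open_sec) auto
    have "(2 * t) ^ ?N * (1 / ?n) ^ ?N \<le> (2 * t) ^ ?N * (\<bar>det F\<bar> * ?P)"
      using t B by (intro mult_left_mono) auto
    also have "\<dots> = \<bar>det F\<bar> * ((2 * t) ^ ?N * ?P)" by (simp only: mult_ac)
    also have "\<dots> \<le> \<bar>det F\<bar> * (Lam * (6 ^ ?N * \<bar>det F\<bar>))" using A by (intro mult_left_mono) auto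
    also have "\<dots> = 6 ^ ?N * (Lam * (det F)\<^sup>2)" by (simp add: power2_eq_square)
    finally have C: "(2 * t) ^ ?N * (1 / ?n) ^ ?N \<le> 6 ^ ?N * (Lam * (det F)\<^sup>2)" .
    have "(2 * t) ^ ?N * (1 / ?n) ^ ?N = (2 * t * (1 / ?n)) ^ ?N" by (rule power_mult_distrib[symmetric])
    also have "2 * t * (1 / ?n) = 6 * (t / (3 * ?n))" by simp
    also have "(6 * (t / (3 * ?n))) ^ ?N = 6 ^ ?N * (t / (3 * ?n)) ^ ?N" by (rule power_mult_distrib)
    finally show ?thesis using C by simp
  qed
  have pt: "\<alpha> \<le> C * ?f y" if yS: "y \<in> S" and small: "\<And>i. ?q i y \<le> 2 * ?n * K * t" for y
  proof -
    have yU: "y \<in> U" using yS SU by blast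
    let ?Q = "hessian u y"
    note Q = psd_hessian[OF yU]
    obtain j where j: "\<And>i. norm (g i) \<le> norm (g j)"
    proof -
      have "Max (range (\<lambda>i. norm (g i))) \<in> range (\<lambda>i. norm (g i))" by (rule Max_in) auto
      then obtain j where "Max (range (\<lambda>i. norm (g i))) = norm (g j)" by blast
      moreover have "norm (g i) \<le> Max (range (\<lambda>i. norm (g i)))" for i by (rule Max_ge) auto
      ultimately show thesis using that by metis
    qed
    \<comment> \<open>The row with the longest dual vector is replaced by the unit vector in that
      direction. By Cramer's rule the determinant is multiplied by
      \<open>norm (g j)\<close>.\<close>
    let ?e = "sgn (g j)" and ?\<gamma> = "norm (g j)"
    have ge: "g j \<bullet> ?e = ?\<gamma>" by (rule inner_sgn)
    have "?e \<bullet> (?Q *v ?e) \<le> ?f y * (norm ?e)\<^sup>2" by (rule form_le_mnorm)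
    also have "\<dots> \<le> ?f y * 1" using mnorm_nonneg by (intro mult_left_mono) (auto simp: norm_sgn)
    finally have eQ: "?e \<bullet> (?Q *v ?e) \<le> ?f y" by simp
    let ?F = "(\<chi> i. if i = j then ?e else F $ i) :: real^'n^'n"
    have "(\<Prod>i\<in>UNIV. ?F $ i \<bullet> (?Q *v ?F $ i)) = (?e \<bullet> (?Q *v ?e)) * (\<Prod>i\<in>UNIV - {j}. ?q i y)"
      by (subst prod.remove[of _ j]) (auto intro!: prod.cong)
    also have "\<dots> \<le> ?f y * (2 * ?n * K * t) ^ (?N - 1)"
    proof (rule mult_mono)
      have "(\<Prod>i\<in>UNIV - {j}. ?q i y) \<le> (\<Prod>i\<in>UNIV - {j}. 2 * ?n * K * t)"
        using small q0[OF yU] by (intro prod_mono) auto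
      then show "(\<Prod>i\<in>UNIV - {j}. ?q i y) \<le> (2 * ?n * K * t) ^ (?N - 1)"
        by (simp add: card_Diff_singleton)
    qed (use eQ q0[OF yU] mnorm_nonneg in \<open>auto intro!: prod_nonneg\<close>)
    finally have P: "(\<Prod>i\<in>UNIV. ?F $ i \<bullet> (?Q *v ?F $ i)) \<le> ?f y * (2 * ?n * K * t) ^ (?N - 1)" .
    have "lam * ((?\<gamma>)\<^sup>2 * (det F)\<^sup>2) \<le> det ?Q * (det ?F)\<^sup>2"
      unfolding g(3) ge power_mult_distrib using det_ge[OF yU] by (intro mult_right_mono) auto
    also have "\<dots> \<le> fact ?N * (\<Prod>i\<in>UNIV. ?F $ i \<bullet> (?Q *v ?F $ i))" by (rule det_psd_le[OF Q])
    also have "\<dots> \<le> fact ?N * (?f y * (2 * ?n * K * t) ^ (?N - 1))" using P by (intro mult_left_mono) auto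
    finally have D: "lam * (?\<gamma>\<^sup>2 * (det F)\<^sup>2) \<le> fact ?N * (?f y * (2 * ?n * K * t) ^ (?N - 1))" .
    have "lam * ?\<gamma>\<^sup>2 * (t / (3 * ?n)) ^ ?N \<le> lam * ?\<gamma>\<^sup>2 * (Lam * (det F)\<^sup>2)"
      using dF lam_pos by (intro mult_left_mono) auto
    also have "\<dots> = Lam * (lam * (?\<gamma>\<^sup>2 * (det F)\<^sup>2))" by simp
    also have "\<dots> \<le> Lam * (fact ?N * (?f y * (2 * ?n * K * t) ^ (?N - 1)))"
      using D Lam by (intro mult_left_mono) auto
    finally have E: "lam * ?\<gamma>\<^sup>2 * (t / (3 * ?n)) ^ ?N \<le> Lam * (fact ?N * (?f y * (2 * ?n * K * t) ^ (?N - 1)))" .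
    \<comment> \<open>\<open>dF\<close> supplies t^n and the n - 1 remaining rows give t^(n-1). The
      one power left over matches the factor t in \<alpha>.\<close>
    have tN: "t ^ ?N = t * t ^ (?N - 1)" by (metis Suc_diff_1 power_Suc zero_less_card_finite)
    have "(lam * ?\<gamma>\<^sup>2 * t) * t ^ (?N - 1) = (lam * ?\<gamma>\<^sup>2 * (t / (3 * ?n)) ^ ?N) * (3 * ?n) ^ ?N"
      using tN by (simp add: power_divide)
    also have "\<dots> \<le> (Lam * (fact ?N * (?f y * (2 * ?n * K * t) ^ (?N - 1)))) * (3 * ?n) ^ ?N"
      using E by (intro mult_right_mono) auto
    also have "\<dots> = (Lam * fact ?N * (3 * ?n) ^ ?N * (2 * ?n * K) ^ (?N - 1) * ?f y) * t ^ (?N - 1)"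
      unfolding power_mult_distrib by (simp only: mult_ac)
    finally have G: "lam * ?\<gamma>\<^sup>2 * t \<le> Lam * fact ?N * (3 * ?n) ^ ?N * (2 * ?n * K) ^ (?N - 1) * ?f y"
      using t by simp
    have "(\<Sum>i\<in>UNIV. (norm (g i))\<^sup>2) \<le> (\<Sum>i\<in>(UNIV::'n set). ?\<gamma>\<^sup>2)"
      using j by (intro sum_mono power_mono) auto
    then have "\<alpha> \<le> ?n * (K * t) * (?n * ?\<gamma>\<^sup>2)"
      unfolding \<alpha>_def using K t by (intro mult_left_mono) auto
    also have "\<dots> = ?n\<^sup>2 * K / lam * (lam * ?\<gamma>\<^sup>2 * t)" using lam_pos by (simp add: power2_eq_square)
    also have "\<dots> \<le> ?n\<^sup>2 * K / lam * (Lam * fact ?N * (3 * ?n) ^ ?N * (2 * ?n * K) ^ (?N - 1) * ?f y)"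
      using G K lam_pos by (intro mult_left_mono) auto
    also have "\<dots> = C * ?f y" unfolding C_def K_def portion_const_def by (simp only: mult_ac)
    finally show ?thesis .
  qed
  have 2: "?m \<le> 2 * vol {y\<in>S. \<alpha> \<le> C * ?f y}"
  proof -
    \<comment> \<open>The level is 2n times the mean bound K t, so Markov's inequality discards at
      most a fraction 1/(2n) of the section for each of the n frame directions.\<close>
    let ?B = "\<lambda>i. {y\<in>S. 2 * ?n * K * t < ?q i y}" and ?G = "{y\<in>S. \<alpha> \<le> C * ?f y}"
    have b: "0 < 2 * ?n * K * t" using K t by simp
    have B: "vol (?B i) \<le> ?m / (2 * ?n)" for i
    proof -
      have "(2 * ?n * K * t) * vol (?B i) \<le> K * t * ?m"
        using K t by (intro measure_superlevel_le[OF oS SU bS qc b I]) auto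
      then have "(K * t) * (2 * ?n * vol (?B i)) \<le> (K * t) * ?m" by (simp only: mult_ac)
      then have "2 * ?n * vol (?B i) \<le> ?m" using K t by (simp only: mult_le_cancel_left_pos[OF mult_pos_pos])
      then show ?thesis by (simp add: pos_le_divide_eq mult.commute)
    qed
    have oB: "open (?B i)" for i
    proof -
      have "open (S \<inter> ?q i -` {2 * ?n * K * t<..})" by (intro continuous_open_preimage qc oS open_greaterThan)
      moreover have "S \<inter> ?q i -` {2 * ?n * K * t<..} = ?B i" by auto
      ultimately show ?thesis by simp
    qed
    have Bm: "?B i \<in> lmeasurable" for i
      using oB bS by (intro lmeasurable_open) (auto intro: bounded_subset)
    have Sm: "S \<in> lmeasurable" using oS bS by (rule lmeasurable_open[rotated])
    have Gm: "?G \<in> lmeasurable" by (rule lmeasurable_superlevel[OF oS SU bS])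
    have Um: "(\<Union>i. ?B i) \<in> lmeasurable" by (rule fmeasurable.finite_UN[OF finite Bm])
    have "S \<subseteq> ?G \<union> (\<Union>i. ?B i)"
    proof
      fix y assume yS: "y \<in> S"
      show "y \<in> ?G \<union> (\<Union>i. ?B i)"
      proof (cases "\<exists>i. 2 * ?n * K * t < ?q i y")
        case False
        then have "\<alpha> \<le> C * ?f y" by (intro pt yS) (simp add: not_less)
        then show ?thesis using yS by blast
      qed (use yS in blast)
    qed
    then have "?m \<le> vol (?G \<union> (\<Union>i. ?B i))"
      by (rule measure_mono_fmeasurable[OF _ fmeasurableD[OF Sm] fmeasurable.Un[OF Gm Um]])
    also have "\<dots> \<le> vol ?G + vol (\<Union>i. ?B i)"
      by (rule measure_Un_le[OF fmeasurableD[OF Gm] fmeasurableD[OF Um]])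
    also have "vol (\<Union>i. ?B i) \<le> (\<Sum>i\<in>UNIV. vol (?B i))"
      by (rule measure_UNION_le[OF finite fmeasurableD[OF Bm]])
    also have "\<dots> \<le> (\<Sum>i\<in>(UNIV::'n set). ?m / (2 * ?n))" using B by (intro sum_mono) auto
    also have "\<dots> = ?m / 2" by simp
    finally show ?thesis by simp
  qed
  have 3: "\<alpha> \<le> 16 * ?n\<^sup>2 * K * t / r\<^sup>2" if r: "0 < r" "ball 0 r \<subseteq> difset ?T" for r
  proof -
    have gr: "(norm (g i))\<^sup>2 \<le> 16 / r\<^sup>2" for i
    proof -
      \<comment> \<open>This vector of length at most r/2 lies in the difference body, so its frame
        coefficients are at most 2 and the dual vector has norm at most 4/r.\<close>
      let ?e = "(r / 2) *\<^sub>R sgn (g i)"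
      have "norm ?e < r" using r by (simp add: norm_sgn)
      then have "?e \<in> difset ?T" using r by auto
      then obtain a where a: "?e = (\<Sum>i\<in>UNIV. a $ i *\<^sub>R F $ i)" "\<forall>i. \<bar>a $ i\<bar> \<le> 2" using F(3) by blast
      have "g i \<bullet> ?e = a $ i" unfolding a(1) by (rule g(2))
      moreover have "g i \<bullet> ?e = (r / 2) * norm (g i)"
        by (simp add: inner_sgn)
      ultimately have "(r / 2) * norm (g i) \<le> 2" using a(2)[rule_format, of i] by simp
      then have "norm (g i) \<le> 4 / r" using r by (simp add: field_simps)
      then have "(norm (g i))\<^sup>2 \<le> (4 / r)\<^sup>2" by (rule power_mono) simp
      then show ?thesis by (simp add: power_divide)
    qed
    have "\<alpha> \<le> ?n * (K * t) * (\<Sum>i\<in>(UNIV::'n set). 16 / r\<^sup>2)"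
      unfolding \<alpha>_def using gr K t by (intro mult_left_mono sum_mono) auto
    also have "\<dots> = 16 * ?n\<^sup>2 * K * t / r\<^sup>2" by (simp add: power2_eq_square)
    finally show ?thesis .
  qed
  show thesis using \<alpha>0 1 2 3 by (rule that)
qed

end

section \<open>Covering and integration over level sets\<close>

text \<open>Greedy selection: an index with largest \<open>h\<close> is kept, everything meeting its
  set is discarded, and the rest is handled by induction.\<close>

lemma finite_Vitali:
  fixes h :: "'a \<Rightarrow> real"
  assumes "finite A" "\<And>a. a \<in> A \<Longrightarrow> S a \<noteq> {}"
  shows "\<exists>B\<subseteq>A. pairwise (\<lambda>a b. disjnt (S a) (S b)) B \<and> (\<forall>a\<in>A. \<exists>b\<in>B. S a \<inter> S b \<noteq> {} \<and> h a \<le> h b)"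
  using assms
proof (induction A rule: finite_psubset_induct)
  case (psubset A)
  show ?case
  proof (cases "A = {}")
    case False
    have "Max (h ` A) \<in> h ` A" using psubset.hyps False by (intro Max_in) auto
    then obtain m where m: "m \<in> A" "Max (h ` A) = h m" by blast
    have max: "h a \<le> h m" if "a \<in> A" for a
      unfolding m(2)[symmetric] using psubset.hyps that by (intro Max_ge) auto
    let ?A = "{a\<in>A. S a \<inter> S m = {}}"
    have "?A \<subset> A" using m(1) psubset.prems[OF m(1)] by auto
    then obtain B where B: "B \<subseteq> ?A" "pairwise (\<lambda>a b. disjnt (S a) (S b)) B"
      "\<forall>a\<in>?A. \<exists>b\<in>B. S a \<inter> S b \<noteq> {} \<and> h a \<le> h b"
      using psubset.IH[of ?A] psubset.prems by auto
    have "pairwise (\<lambda>a b. disjnt (S a) (S b)) (insert m B)"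
      using B(1,2) by (auto simp: pairwise_insert disjnt_def)
    moreover have "\<forall>a\<in>A. \<exists>b\<in>insert m B. S a \<inter> S b \<noteq> {} \<and> h a \<le> h b"
      using B(3) max by blast
    moreover have "insert m B \<subseteq> A" using B(1) m(1) by auto
    ultimately show ?thesis by blast
  qed simp
qed

text \<open>The dilation required by \<open>sec_engulf\<close>, rounded up to a power of two so that
  the dilate of a dyadic height is again dyadic.\<close>

definition dilation_exp :: "real \<Rightarrow> nat" where
  "dilation_exp \<theta> = nat \<lceil>8 * \<theta>\<^sup>2\<rceil> + 1"

text \<open>More than twice the mean of the Hessian norm over any of the highest sections considered.\<close>

definition threshold :: "real \<Rightarrow> real \<Rightarrow> real \<Rightarrow> nat \<Rightarrow> real" where
  "threshold Lam c \<theta> n = 1 + 2 * ((real n)\<^sup>2 * form_const c n * \<theta>\<^sup>2 * 2 ^ dilation_exp \<theta> / radius_factor c \<theta>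
      * (8 * (real n)\<^sup>2 * max 1 Lam))"

lemma dilation_exp_gt: "8 * \<theta>\<^sup>2 < 2 ^ dilation_exp \<theta>"
proof -
  have "8 * \<theta>\<^sup>2 \<le> real (dilation_exp \<theta>)" unfolding dilation_exp_def by linarith
  also have "\<dots> < 2 ^ dilation_exp \<theta>" by (rule of_nat_less_two_power)
  finally show ?thesis .
qed

section \<open>Level set estimate by stopping heights and covering\<close>

context ma_dirichlet
begin

definition sec_integral :: "real^'n \<Rightarrow> real \<Rightarrow> ennreal" where
  "sec_integral x t = (\<integral>\<^sup>+y. ennreal (hnorm y) * indicator (sec x t) y \<partial>lborel)"

lemma adm_half_8: "x \<in> half \<Longrightarrow> 0 < t \<Longrightarrow> t \<le> radius \<Longrightarrow> adm x (8 * t)"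
  by (rule adm_mono[OF adm_half]) (use radius_le(2) in auto)

lemma measure_sec_pos: "adm x t \<Longrightarrow> 0 < vol (sec x t)"
proof -
  assume a: "adm x t"
  obtain r where r: "0 < r" "ball x r \<subseteq> sec x t"
    using open_sec self_in_sec[OF a] open_contains_ball by metis
  have "0 < vol (ball x r)" using content_ball_pos[OF r(1), of x] by simp
  also have "\<dots> \<le> vol (sec x t)"
    using r(2) by (intro measure_mono_fmeasurable lmeasurable_open bounded_sec open_sec) auto
  finally show ?thesis .
qed

text \<open>Dilating the section by (1 + c)^j about \<open>x\<close> keeps it in the closure of
  \<open>U\<close>, which lies in the closed ball of radius n.\<close>

lemma sec_small:
  assumes x: "x \<in> half" and d: "0 < d"
  shows "\<exists>j. sec x (radius / 2 ^ j) \<subseteq> ball x d"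
proof -
  let ?n = "real CARD('n)"
  obtain j where j: "2 * ?n / d < (1 + c) ^ j" using real_arch_pow[of "1 + c"] c_pos by auto
  have "y \<in> ball x d" if y: "y \<in> sec x (radius / 2 ^ j)" for y
  proof -
    have xU: "x \<in> U" and yU: "y \<in> U" using halfD(1)[OF x] y sec_subset by auto
    have "adm x radius" using adm_half_8[OF x radius_pos] radius_pos by (auto intro: adm_mono)
    then have "x + (1 + c) ^ j *\<^sub>R (y - x) \<in> closure (sec x radius)"
      using y yU by (intro shrink_power) (auto simp: sec_def)
    then have "x + (1 + c) ^ j *\<^sub>R (y - x) \<in> closure U" by (rule closure_sec_le(1))
    moreover have "closure U \<subseteq> cball 0 ?n" using subset_ball ball_subset_cball by (intro closure_minimal) auto
    ultimately have "norm (x + (1 + c) ^ j *\<^sub>R (y - x)) \<le> ?n" by auto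
    moreover have "norm x \<le> ?n" using subset_ball xU by auto
    ultimately have "norm ((1 + c) ^ j *\<^sub>R (y - x)) \<le> 2 * ?n"
      using norm_triangle_ineq4[of "x + (1 + c) ^ j *\<^sub>R (y - x)" x] by simp
    then have "(1 + c) ^ j * norm (y - x) \<le> 2 * ?n" using c_pos by simp
    moreover have "2 * ?n < (1 + c) ^ j * d" using j d by (simp add: pos_divide_less_eq)
    ultimately have "(1 + c) ^ j * norm (y - x) < (1 + c) ^ j * d" by linarith
    then have "norm (y - x) < d" using c_pos by simp
    then show ?thesis by (simp add: dist_norm norm_minus_commute)
  qed
  then show ?thesis by blast
qed

lemma breg_half_le:
  assumes "x \<in> half" "z \<in> U"
  shows "breg x z \<le> \<theta> * depth"
proof (rule engulfing[OF adm_x0 halfD(1)[OF assms(1)]])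
  show "breg x0 x \<le> depth / 2" using halfD(2)[OF assms(1)] by (simp add: breg_x0)
  show "z \<in> closure (sec x0 depth)" using assms(2) closure_subset by (auto simp: sec_x0)
qed

lemma adm_factor_le: "adm_factor c \<theta> \<le> 1"
proof -
  have "1 \<le> \<theta> ^ nat \<lceil>32 / c\<rceil>" using \<theta>_ge by (rule one_le_power)
  then have "adm_factor c \<theta> \<le> (c / 32) / 1"
    unfolding adm_factor_def using c_pos by (intro divide_left_mono) auto
  then show ?thesis using c_le by simp
qed

text \<open>On all of \<open>U\<close> the function \<open>breg x\<close> is at most \<theta> times
  the depth, so a copy of \<open>U\<close> contracted towards \<open>x\<close> fits into the
  section. \<open>U\<close> contains the unit ball, and differences with the image of its centre
  give the ball.\<close>

lemma ball_subset_difset: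
  assumes x: "x \<in> half" and t: "0 < t" "t \<le> radius"
  shows "ball 0 (4 * t / (\<theta> * depth)) \<subseteq> difset (sec x (8 * t))"
proof -
  define k where "k = 4 * t / (\<theta> * depth)"
  have td: "0 < \<theta> * depth" using \<theta>_ge depth_pos by simp
  have k0: "0 < k" using t td by (simp add: k_def)
  have "8 * t \<le> adm_height" using t radius_le(2) by simp
  also have "\<dots> \<le> 1 * depth" unfolding adm_height_def using adm_factor_le depth_pos by (intro mult_right_mono) auto
  also have "\<dots> \<le> \<theta> * depth" using \<theta>_ge depth_pos by (intro mult_right_mono) auto
  finally have "4 * t \<le> \<theta> * depth" using t by simp
  then have k1: "k \<le> 1" using td by (simp add: k_def pos_divide_le_eq)
  have mem: "x + k *\<^sub>R (z - x) \<in> sec x (8 * t)" if z: "z \<in> U" for z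
  proof -
    have xU: "x \<in> U" by (rule halfD(1)[OF x])
    have "breg x (x + k *\<^sub>R (z - x)) \<le> k * breg x z"
      using xU z k0 k1 closure_subset by (intro breg_line) auto
    also have "\<dots> \<le> k * (\<theta> * depth)" using breg_half_le[OF x z] k0 by (intro mult_left_mono) auto
    also have "\<dots> = 4 * t"
    proof -
      have "4 * t / d * d = 4 * t" if "0 < d" for d using that by simp
      from this[OF td] show ?thesis unfolding k_def .
    qed
    also have "\<dots> < 8 * t" using t by simp
    finally show ?thesis using k0 k1 by (simp add: sec_def convex_segment_mem[OF convex_U xU z])
  qed
  have "w \<in> difset (sec x (8 * t))" if w: "w \<in> ball 0 k" for w
  proof -
  let ?w = "(1 / k) *\<^sub>R w"
  have "norm ?w = norm w / k" using k0 by simp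
  also have "\<dots> < 1" using w k0 by (simp add: pos_divide_less_eq)
  finally have "?w \<in> U" "0 \<in> U" using ball_subset by auto
  then have "x + k *\<^sub>R (?w - x) \<in> sec x (8 * t)" "x + k *\<^sub>R (0 - x) \<in> sec x (8 * t)" using mem by blast+
  moreover have "w = (x + k *\<^sub>R (?w - x)) - (x + k *\<^sub>R (0 - x))"
    using k0 by (simp add: scaleR_diff_right)
  ultimately show ?thesis unfolding difset_def by blast
  qed
  then show ?thesis unfolding k_def by blast
qed

lemma compact_half_superlevel: "compact {y\<in>half. \<gamma> \<le> hnorm y}"
proof -
  have "half \<subseteq> U" using halfD by blast
  then have "closed (half \<inter> hnorm -` {\<gamma>..})"
    by (intro continuous_closed_preimage continuous_on_subset[OF continuous_mnorm_hessian])
       (auto simp: compact_imp_closed compact_half)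
  then have "compact (half \<inter> (half \<inter> hnorm -` {\<gamma>..}))" using compact_half by (intro compact_Int_closed)
  moreover have "half \<inter> (half \<inter> hnorm -` {\<gamma>..}) = {y\<in>half. \<gamma> \<le> hnorm y}" by auto
  ultimately show ?thesis by simp
qed

lemma form_const_pos: "0 < form_const c CARD('n)"
  using c_pos by (simp add: form_const_def)

text \<open>Dyadic heights are tested from the top. At the highest one with mean at least
  \<gamma>/2, the quantity \<alpha> of \<open>hessian_large_portion\<close> is at least \<gamma>/2,
  so half of the section has |D^2 u| \<ge> \<gamma>/D. At K times this height the mean is still
  below \<gamma>/2.\<close>

lemma stopping_height:
  fixes \<gamma> :: real
  defines "K \<equiv> 2 ^ dilation_exp \<theta> :: real" and "D \<equiv> 2 * portion_const lam Lam c CARD('n)"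
  assumes x: "x \<in> half" and fx: "\<gamma> \<le> hnorm x" and g: "threshold Lam c \<theta> CARD('n) \<le> \<gamma>"
  shows "\<exists>t. 0 < t \<and> K * t \<le> radius \<and>
     sec_integral x (K * t) \<le> ennreal (\<gamma> * K ^ CARD('n) * vol {y\<in>sec x t. \<gamma> \<le> D * hnorm y})"
proof -
  let ?n = "real CARD('n)" and ?N = "CARD('n)" and ?kk = "dilation_exp \<theta>"
  let ?K1 = "form_const c CARD('n)"
  let ?t = "\<lambda>j. radius / 2 ^ j"
  have t0: "0 < ?t j" for j using radius_pos by simp
  have tr: "?t j \<le> radius" for j using radius_pos by (simp add: pos_divide_le_eq)
  have a8: "adm x (8 * ?t j)" for j using adm_half_8[OF x t0 tr] .
  have a1: "adm x (?t j)" for j using a8[of j] t0[of j] by (auto intro: adm_mono)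
  have m0: "0 < vol (sec x (?t j))" for j by (rule measure_sec_pos[OF a1])
  have xU: "x \<in> U" by (rule halfD(1)[OF x])
  define lowb where "lowb = ?n\<^sup>2 * ?K1 * \<theta>\<^sup>2 * 2 ^ ?kk / radius_factor c \<theta> * (8 * ?n\<^sup>2 * max 1 Lam)"
  have lowb0: "0 \<le> lowb" unfolding lowb_def
    using form_const_pos radius_factor_pos by (intro mult_nonneg_nonneg divide_nonneg_pos) auto
  have gl: "lowb < \<gamma> / 2" using g by (simp add: threshold_def lowb_def)
  have g0: "0 < \<gamma>" using gl lowb0 by linarith
  define P where "P j \<longleftrightarrow> ennreal (\<gamma> / 2 * vol (sec x (?t j))) \<le> sec_integral x (?t j)" for j
  have ex: "\<exists>j. P j"
  proof -
    have "isCont hnorm x" using continuous_mnorm_hessian open_U xU continuous_on_eq_continuous_at by blast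
    then obtain d where d: "0 < d" "\<And>y. dist y x < d \<Longrightarrow> dist (hnorm y) (hnorm x) < \<gamma> / 2"
      unfolding continuous_at_eps_delta using g0 half_gt_zero by metis
    obtain j where j: "sec x (?t j) \<subseteq> ball x d" using sec_small[OF x d(1)] by blast
    have "ennreal (\<gamma> / 2 * vol (sec x (?t j))) = ennreal (\<gamma> / 2) * ennreal (vol (sec x (?t j)))"
      by (rule ennreal_mult) (use g0 in auto)
    also have "\<dots> = (\<integral>\<^sup>+y. ennreal (\<gamma> / 2) * indicator (sec x (?t j)) y \<partial>lborel)"
      using open_sec[of x "?t j"] by (subst nn_integral_cmult_indicator) (auto simp: emeasure_sec)
    also have "\<dots> \<le> sec_integral x (?t j)"
      unfolding sec_integral_def
    proof (intro nn_integral_mono)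
      fix y
      show "ennreal (\<gamma> / 2) * indicator (sec x (?t j)) y \<le> ennreal (hnorm y) * indicator (sec x (?t j)) y"
      proof (cases "y \<in> sec x (?t j)")
        case True
        then have "dist y x < d" using j by (auto simp: dist_commute)
        then have "\<gamma> / 2 \<le> hnorm y" using d(2)[of y] fx by (simp add: dist_real_def abs_if split: if_splits)
        then show ?thesis using True by (simp add: ennreal_leI)
      qed simp
    qed
    finally show ?thesis unfolding P_def by blast
  qed
  \<comment> \<open>At these large heights the difference body contains a ball of definite radius,
    so \<alpha>, and with it the mean, stays below half the threshold. Hence K times the stopping
    height does not exceed \<open>radius\<close>.\<close>
  have not_low: "\<not> P j" if j: "j < ?kk" for j
  proof
    assume Pj: "P j"
    obtain \<alpha> where \<alpha>: "0 \<le> \<alpha>" "sec_integral x (?t j) \<le> ennreal (\<alpha> * vol (sec x (?t j)))"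
      "\<And>r. 0 < r \<Longrightarrow> ball 0 r \<subseteq> difset (sec x (8 * ?t j)) \<Longrightarrow> \<alpha> \<le> 16 * ?n\<^sup>2 * ?K1 * ?t j / r\<^sup>2"
    proof (rule hessian_large_portion[OF a8[of j]], goal_cases)
      case (1 \<alpha>)
      show ?case by (rule 1(1)[OF 1(2) 1(3)[folded sec_integral_def] 1(5)])
    qed
    let ?r = "4 * ?t j / (\<theta> * depth)"
    have r: "0 < ?r" using radius_pos \<theta>_ge depth_pos by (intro divide_pos_pos mult_pos_pos) auto
    have "\<alpha> \<le> 16 * ?n\<^sup>2 * ?K1 * ?t j / ?r\<^sup>2" by (rule \<alpha>(3)[OF r ball_subset_difset[OF x t0 tr]])
    also have "\<dots> = ?n\<^sup>2 * ?K1 * \<theta>\<^sup>2 * depth\<^sup>2 / ?t j"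
    proof -
      have "a * T / (4 * T / (b * d))\<^sup>2 = a / 16 * b\<^sup>2 * d\<^sup>2 / T" if "0 < T" "0 < b" "0 < d" for a b d T :: real
        using that by (simp add: power2_eq_square field_simps)
      from this[of "?t j" \<theta> depth "16 * ?n\<^sup>2 * ?K1"] show ?thesis using t0[of j] radius_pos \<theta>_ge depth_pos by simp
    qed
    also have "\<dots> = ?n\<^sup>2 * ?K1 * \<theta>\<^sup>2 * 2 ^ j / radius_factor c \<theta> * depth"
      using depth_pos radius_factor_pos by (simp add: radius_def power2_eq_square field_simps)
    also have "\<dots> \<le> ?n\<^sup>2 * ?K1 * \<theta>\<^sup>2 * 2 ^ ?kk / radius_factor c \<theta> * (8 * ?n\<^sup>2 * max 1 Lam)"
      using j form_const_pos radius_factor_pos depth_pos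
      by (intro mult_mono divide_right_mono mult_left_mono depth_le power_increasing mult_nonneg_nonneg divide_nonneg_pos) auto
    also have "\<dots> < \<gamma> / 2" using gl by (simp add: lowb_def)
    finally have "\<alpha> * vol (sec x (?t j)) < \<gamma> / 2 * vol (sec x (?t j))"
      using m0[of j] by simp
    moreover have "ennreal (\<gamma> / 2 * vol (sec x (?t j))) \<le> ennreal (\<alpha> * vol (sec x (?t j)))"
      using Pj \<alpha>(2) unfolding P_def by (rule order_trans)
    ultimately show False using \<alpha>(1) m0[of j] by (simp add: ennreal_le_iff)
  qed
  \<comment> \<open>Sections shrink to \<open>x\<close>, where |D^2 u| is at least \<gamma>, so some
    index qualifies. The least one has the greatest height.\<close>
  define j where "j = (LEAST j. P j)"
  have Pj: "P j" unfolding j_def using ex by (rule LeastI_ex)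
  have jk: "?kk \<le> j" using not_low Pj by (meson not_le)
  have kk1: "1 \<le> ?kk" by (simp add: dilation_exp_def)
  have "j - ?kk < j" using jk kk1 by simp
  then have nP: "\<not> P (j - ?kk)" unfolding j_def by (rule not_less_Least)
  have Kt: "K * ?t j = ?t (j - ?kk)" unfolding K_def using jk by (simp add: power_diff)
  have K1: "1 \<le> K" by (simp add: K_def)
  obtain \<alpha> where \<alpha>: "0 \<le> \<alpha>" "sec_integral x (?t j) \<le> ennreal (\<alpha> * vol (sec x (?t j)))"
    "vol (sec x (?t j)) \<le> 2 * vol {y\<in>sec x (?t j). \<alpha> \<le> portion_const lam Lam c CARD('n) * hnorm y}"
  proof (rule hessian_large_portion[OF a8[of j]], goal_cases)
    case (1 \<alpha>)
    show ?case by (rule 1(1)[OF 1(2) 1(3)[folded sec_integral_def] 1(4)])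
  qed
  have "ennreal (\<gamma> / 2 * vol (sec x (?t j))) \<le> ennreal (\<alpha> * vol (sec x (?t j)))"
    using Pj \<alpha>(2) unfolding P_def by (rule order_trans)
  then have "\<gamma> / 2 * vol (sec x (?t j)) \<le> \<alpha> * vol (sec x (?t j))"
    using \<alpha>(1) by (simp add: ennreal_le_iff)
  then have ga: "\<gamma> / 2 \<le> \<alpha>" using m0[of j] by simp
  let ?G = "{y\<in>sec x (?t j). \<gamma> \<le> D * hnorm y}"
  have lm: "{y\<in>sec x (?t j). b \<le> a * hnorm y} \<in> lmeasurable" for a b
    by (rule lmeasurable_superlevel[OF open_sec sec_subset bounded_sec])
  have "vol {y\<in>sec x (?t j). \<alpha> \<le> portion_const lam Lam c CARD('n) * hnorm y} \<le> vol ?G"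
    by (rule measure_mono_fmeasurable[OF _ fmeasurableD[OF lm] lm]) (use ga in \<open>auto simp: D_def\<close>)
  then have mG: "vol (sec x (?t j)) \<le> 2 * vol ?G" using \<alpha>(3) by linarith
  have "sec_integral x (K * ?t j) \<le> ennreal (\<gamma> / 2 * vol (sec x (K * ?t j)))"
    using nP unfolding P_def Kt by (simp add: not_le less_imp_le)
  also have "\<dots> \<le> ennreal (\<gamma> * K ^ ?N * vol ?G)"
  proof (rule ennreal_leI)
    have "vol (sec x (K * ?t j)) \<le> K ^ ?N * vol (sec x (?t j))"
      using a1[of "j - ?kk"] unfolding Kt[symmetric] by (rule measure_sec_scale[OF _ K1])
    also have "\<dots> \<le> K ^ ?N * (2 * vol ?G)" using mG K1 by (intro mult_left_mono) auto
    finally have "\<gamma> / 2 * vol (sec x (K * ?t j)) \<le> \<gamma> / 2 * (K ^ ?N * (2 * vol ?G))"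
      using g0 by (intro mult_left_mono) auto
    then show "\<gamma> / 2 * vol (sec x (K * ?t j)) \<le> \<gamma> * K ^ ?N * vol ?G" by simp
  qed
  finally show ?thesis using t0[of j] tr[of "j - ?kk"] Kt by (intro exI[of _ "?t j"]) simp
qed

text \<open>The superlevel set in \<open>half\<close> is compact, so finitely many stopping sections
  cover it. The factor K suits two purposes at once: the K-dilates of the disjoint subfamily still
  cover, and \<open>stopping_height\<close> bounds the integral exactly over these dilates. The
  remaining level sets are disjoint and stay inside \<open>big\<close>, so their volumes add
  up.\<close>

theorem superlevel_integral_le:
  fixes \<gamma> :: real
  defines "K \<equiv> 2 ^ dilation_exp \<theta> :: real" and "D \<equiv> 2 * portion_const lam Lam c CARD('n)"
  assumes g: "threshold Lam c \<theta> CARD('n) \<le> \<gamma>" "0 \<le> \<gamma>"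
  shows "(\<integral>\<^sup>+y. ennreal (hnorm y) * indicator {y\<in>half. \<gamma> \<le> hnorm y} y \<partial>lborel)
     \<le> ennreal (\<gamma> * K ^ CARD('n)) * emeasure lborel {y\<in>big. \<gamma> \<le> D * hnorm y}"
proof -
  let ?F = "{y\<in>half. \<gamma> \<le> hnorm y}" and ?G = "{y\<in>big. \<gamma> \<le> D * hnorm y}"
  have K1: "1 \<le> K" by (simp add: K_def)
  have halfU: "half \<subseteq> U" and bigU: "big \<subseteq> U" using halfD bigD by blast+
  have cF: "compact ?F" by (rule compact_half_superlevel)
  define R where "R x s \<longleftrightarrow> 0 < s \<and> K * s \<le> radius \<and>
     sec_integral x (K * s) \<le> ennreal (\<gamma> * K ^ CARD('n) * vol {y\<in>sec x s. \<gamma> \<le> D * hnorm y})" for x s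
  have "\<forall>x\<in>?F. \<exists>s. R x s"
    unfolding R_def K_def D_def using stopping_height g by simp
  from bchoice[OF this] obtain t where tR: "\<forall>x\<in>?F. R x (t x)" ..
  have t: "0 < t x" "K * t x \<le> radius"
    "sec_integral x (K * t x) \<le> ennreal (\<gamma> * K ^ CARD('n) * vol {y\<in>sec x (t x). \<gamma> \<le> D * hnorm y})"
    if "x \<in> ?F" for x using bspec[OF tR that] unfolding R_def by blast+
  have tr: "t x \<le> radius" if "x \<in> ?F" for x
  proof -
    have "1 * t x \<le> K * t x" using K1 t(1)[OF that] by (intro mult_right_mono) auto
    then show ?thesis using t(2)[OF that] by simp
  qed
  have self: "x \<in> sec x (t x)" if "x \<in> ?F" for x using t(1)[OF that] that halfU by (auto simp: sec_def)
  obtain A where A: "A \<subseteq> ?F" "finite A" "?F \<subseteq> (\<Union>x\<in>A. sec x (t x))"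
  proof (rule compactE_image[OF cF])
    show "\<And>x. x \<in> ?F \<Longrightarrow> open (sec x (t x))" by (rule open_sec)
    show "?F \<subseteq> (\<Union>x\<in>?F. sec x (t x))" using self by blast
  qed blast
  have "\<exists>B\<subseteq>A. pairwise (\<lambda>a b. disjnt (sec a (t a)) (sec b (t b))) B \<and> (\<forall>a\<in>A. \<exists>b\<in>B. sec a (t a) \<inter> sec b (t b) \<noteq> {} \<and> t a \<le> t b)"
    using A self by (intro finite_Vitali) blast+
  then obtain B where B: "B \<subseteq> A" "pairwise (\<lambda>a b. disjnt (sec a (t a)) (sec b (t b))) B"
    "\<forall>a\<in>A. \<exists>b\<in>B. sec a (t a) \<inter> sec b (t b) \<noteq> {} \<and> t a \<le> t b" by (elim exE conjE) (rule that)
  have BF: "B \<subseteq> ?F" and fB: "finite B" using A B finite_subset by blast+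
  have cover: "?F \<subseteq> (\<Union>b\<in>B. sec b (K * t b))"
  proof
    fix y assume "y \<in> ?F"
    then obtain a where a: "a \<in> A" "y \<in> sec a (t a)" using A(3) by blast
    obtain b where b: "b \<in> B" "sec a (t a) \<inter> sec b (t b) \<noteq> {}" "t a \<le> t b" using bspec[OF B(3) a(1)] by blast
    have aF: "a \<in> ?F" and bF: "b \<in> ?F" using a(1) b(1) A(1) BF by blast+
    have "sec a (t a) \<subseteq> sec b (K * t b)"
    proof (rule sec_engulf)
      show "8 * \<theta>\<^sup>2 < K" unfolding K_def by (rule dilation_exp_gt)
      show "t a \<le> 2 * t b" using b(3) t(1)[OF bF] by simp
      show "sec b (t b) \<inter> sec a (t a) \<noteq> {}" using b(2) by (simp add: Int_commute)
    qed (use aF bF t(1) tr in auto)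
    then show "y \<in> (\<Union>b\<in>B. sec b (K * t b))" using a(2) b(1) by blast
  qed
  let ?Gb = "\<lambda>b. {y\<in>sec b (t b). \<gamma> \<le> D * hnorm y}"
  have Gbm: "?Gb b \<in> sets borel" for b by (rule borel_superlevel[OF open_sec sec_subset])
  have Gm: "?G \<in> sets borel" by (rule borel_superlevel[OF open_big bigU])
  have eGb: "emeasure lborel (?Gb b) = ennreal (vol (?Gb b))" for b
    using bounded_sec by (intro emeasure_bounded_borel Gbm) (auto intro: bounded_subset)
  have "(\<integral>\<^sup>+y. ennreal (hnorm y) * indicator ?F y \<partial>lborel) \<le> (\<integral>\<^sup>+y. (\<Sum>b\<in>B. ennreal (hnorm y) * indicator (sec b (K * t b)) y) \<partial>lborel)"
  proof (intro nn_integral_mono)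
    fix y
    show "ennreal (hnorm y) * indicator ?F y \<le> (\<Sum>b\<in>B. ennreal (hnorm y) * indicator (sec b (K * t b)) y)"
    proof (cases "y \<in> ?F")
      case True
      then obtain b where b: "b \<in> B" "y \<in> sec b (K * t b)" using cover by blast
      have "ennreal (hnorm y) * indicator ?F y = ennreal (hnorm y) * indicator (sec b (K * t b)) y" using True b by simp
      also have "\<dots> \<le> (\<Sum>b\<in>B. ennreal (hnorm y) * indicator (sec b (K * t b)) y)"
        using b fB by (intro member_le_sum) auto
      finally show ?thesis .
    qed simp
  qed
  also have "\<dots> = (\<Sum>b\<in>B. sec_integral b (K * t b))"
    unfolding sec_integral_def
    by (rule nn_integral_sum)
       (use borel_measurable_ennreal_indicator[OF open_sec continuous_on_subset[OF continuous_mnorm_hessian sec_subset]] in simp)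
  also have "\<dots> \<le> (\<Sum>b\<in>B. ennreal (\<gamma> * K ^ CARD('n) * vol (?Gb b)))"
    using BF t(3) by (intro sum_mono) blast
  also have "\<dots> = (\<Sum>b\<in>B. ennreal (\<gamma> * K ^ CARD('n)) * emeasure lborel (?Gb b))"
    unfolding eGb using g(2) K1 by (intro sum.cong refl ennreal_mult) auto
  also have "\<dots> = ennreal (\<gamma> * K ^ CARD('n)) * (\<Sum>b\<in>B. emeasure lborel (?Gb b))"
    by (simp add: sum_distrib_left)
  also have "(\<Sum>b\<in>B. emeasure lborel (?Gb b)) = emeasure lborel (\<Union>b\<in>B. ?Gb b)"
  proof (rule sum_emeasure)
    show "disjoint_family_on ?Gb B"
      using B(2) unfolding disjoint_family_on_def pairwise_def disjnt_def by blast
  qed (use Gbm fB in auto)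
  also have "ennreal (\<gamma> * K ^ CARD('n)) * emeasure lborel (\<Union>b\<in>B. ?Gb b) \<le> ennreal (\<gamma> * K ^ CARD('n)) * emeasure lborel ?G"
  proof (intro mult_left_mono emeasure_mono)
    have "sec b (t b) \<subseteq> big" if "b \<in> B" for b
      using that BF tr by (intro sec_subset_big) auto
    then show "(\<Union>b\<in>B. ?Gb b) \<subseteq> ?G" by blast
  qed (use Gm in auto)
  finally show ?thesis .
qed

end

section \<open>Dyadic decomposition of the logarithmic weights\<close>

lemma power_Suc_diff_le:
  fixes x :: real
  assumes "0 \<le> x"
  shows "(x + 1) ^ Suc k \<le> x ^ Suc k + real (Suc k) * (x + 1) ^ k"
proof (induction k)
  case (Suc k)
  have "(x + 1) ^ Suc (Suc k) = x * (x + 1) ^ Suc k + (x + 1) ^ Suc k" by (simp add: algebra_simps)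
  also have "\<dots> \<le> x * (x ^ Suc k + real (Suc k) * (x + 1) ^ k) + (x + 1) ^ Suc k"
    using Suc assms by (intro add_right_mono mult_left_mono)
  also have "\<dots> = x ^ Suc (Suc k) + real (Suc k) * (x * (x + 1) ^ k) + (x + 1) ^ Suc k" by (simp add: algebra_simps)
  also have "\<dots> \<le> x ^ Suc (Suc k) + real (Suc k) * (x + 1) ^ Suc k + (x + 1) ^ Suc k"
    using assms by (intro add_mono mult_left_mono order_refl) (auto intro!: mult_right_mono)
  also have "\<dots> = x ^ Suc (Suc k) + real (Suc (Suc k)) * (x + 1) ^ Suc k" by (simp add: algebra_simps)
  finally show ?case .
qed simp

text \<open>Telescoping of the discrete derivative of x^(k+1). This is where a power k+1 becomes a
  sum of powers k.\<close>

lemma telescoped_power_le: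
  "real (j + p + 3) ^ Suc k \<le> real (j + 3) ^ Suc k + (\<Sum>i<Suc p. real (Suc k) * real (j + i + 3) ^ k)"
proof (induction p)
  case 0
  then show ?case by simp
next
  case (Suc p)
  have "real (j + Suc p + 3) ^ Suc k \<le> real (j + p + 3) ^ Suc k + real (Suc k) * real (j + Suc p + 3) ^ k"
    using power_Suc_diff_le[of "real (j + p + 3)" k] by (simp add: algebra_simps)
  with Suc show ?case by simp
qed

lemma ln_two_plus_le:
  assumes "0 \<le> v" "v < 2 ^ m"
  shows "ln (2 + v) \<le> real (m + 2)"
proof -
  have "(1::real) \<le> 2 ^ m" by simp
  moreover have "(2::real) ^ (m + 2) = 4 * 2 ^ m" by (simp add: power_add)
  ultimately have "2 + v \<le> 2 ^ (m + 2)" using assms by linarith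
  then have "ln (2 + v) \<le> ln (2 ^ (m + 2))" using assms by (subst ln_le_cancel_iff) auto
  also have "\<dots> = real (m + 2) * ln 2" by (rule ln_realpow)
  also have "\<dots> \<le> real (m + 2) * 1" using ln_2_less_1 by (intro mult_left_mono) auto
  finally show ?thesis by simp
qed

text \<open>The logarithm is at most the number of dyadic levels below \<open>v\<close> up to a
  shift, and its power is split into increments, one for each level. The sum starts at level j
  because the level set estimate is available only from there; the first term carries everything
  below.\<close>

lemma dyadic_log_bound:
  fixes v :: real
  assumes v: "0 \<le> v"
  shows "ennreal (v * ln (2 + v) ^ Suc k) \<le> ennreal (real (j + 3) ^ Suc k * v)
    + (\<Sum>i. ennreal (real (Suc k) * real (j + i + 3) ^ k * v) * (if 2 ^ (j + i) \<le> v then 1 else 0))"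
proof (cases "v < 2 ^ j")
  case True
  have "ln (2 + v) \<le> real (j + 3)" using ln_two_plus_le[OF v True] by simp
  then have "ln (2 + v) ^ Suc k \<le> real (j + 3) ^ Suc k" using v by (intro power_mono) auto
  then have "v * ln (2 + v) ^ Suc k \<le> real (j + 3) ^ Suc k * v"
    using v by (subst mult.commute) (rule mult_right_mono)
  then have "ennreal (v * ln (2 + v) ^ Suc k) \<le> ennreal (real (j + 3) ^ Suc k * v)" by (rule ennreal_leI)
  then show ?thesis by (rule order_trans) simp
next
  case False
  have "\<exists>m. v < 2 ^ m" using real_arch_pow[of 2 v] by simp
  define m where "m = (LEAST m. v < 2 ^ m)"
  have m: "v < 2 ^ m" unfolding m_def using \<open>\<exists>m. v < 2 ^ m\<close> by (rule LeastI_ex)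
  have "j < m"
  proof (rule ccontr)
    assume "\<not> j < m"
    then have "(2::real) ^ m \<le> 2 ^ j" by (intro power_increasing) auto
    then show False using m False by linarith
  qed
  \<comment> \<open>The level j + p is the last one not exceeding \<open>v\<close>, so p + 1
    increments are active, and the logarithm is at most m + 2 = j + p + 3.\<close>
  then obtain p where p: "m = j + p + 1" using less_imp_Suc_add by fastforce
  have pv: "2 ^ (j + p) \<le> v"
    using not_less_Least[of "j + p" "\<lambda>m. v < 2 ^ m"] p unfolding m_def[symmetric] by simp
  have le: "2 ^ (j + i) \<le> v" if "i < Suc p" for i
  proof -
    have "(2::real) ^ (j + i) \<le> 2 ^ (j + p)" using that by (intro power_increasing) auto
    then show ?thesis using pv by linarith
  qed
  have "ln (2 + v) \<le> real (j + p + 3)" using ln_two_plus_le[OF v m] p by simp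
  then have "ln (2 + v) ^ Suc k \<le> real (j + p + 3) ^ Suc k" using v by (intro power_mono) auto
  also have "\<dots> \<le> real (j + 3) ^ Suc k + (\<Sum>i<Suc p. real (Suc k) * real (j + i + 3) ^ k)"
    by (rule telescoped_power_le)
  finally have "v * ln (2 + v) ^ Suc k \<le> v * (real (j + 3) ^ Suc k + (\<Sum>i<Suc p. real (Suc k) * real (j + i + 3) ^ k))"
    using v by (rule mult_left_mono)
  also have "\<dots> = real (j + 3) ^ Suc k * v + (\<Sum>i<Suc p. real (Suc k) * real (j + i + 3) ^ k * v)"
    by (simp only: distrib_left sum_distrib_left mult_ac)
  finally have "ennreal (v * ln (2 + v) ^ Suc k) \<le> ennreal (real (j + 3) ^ Suc k * v + (\<Sum>i<Suc p. real (Suc k) * real (j + i + 3) ^ k * v))"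
    by (rule ennreal_leI)
  also have "\<dots> = ennreal (real (j + 3) ^ Suc k * v) + ennreal (\<Sum>i<Suc p. real (Suc k) * real (j + i + 3) ^ k * v)"
    using v by (intro ennreal_plus sum_nonneg mult_nonneg_nonneg) auto
  also have "ennreal (\<Sum>i<Suc p. real (Suc k) * real (j + i + 3) ^ k * v) = (\<Sum>i<Suc p. ennreal (real (Suc k) * real (j + i + 3) ^ k * v))"
    using v by (intro sum_ennreal[symmetric] mult_nonneg_nonneg) auto
  also have "\<dots> = (\<Sum>i<Suc p. ennreal (real (Suc k) * real (j + i + 3) ^ k * v) * (if 2 ^ (j + i) \<le> v then 1 else 0))"
    using le by (intro sum.cong) auto
  also have "\<dots> \<le> (\<Sum>i. ennreal (real (Suc k) * real (j + i + 3) ^ k * v) * (if 2 ^ (j + i) \<le> v then 1 else 0))"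
    by (rule sum_le_suminf[OF summableI]) auto
  finally show ?thesis by (simp add: add_left_mono)
qed

text \<open>A geometric series is less than twice its largest term, and no term exceeds X.\<close>

lemma dyadic_sum_le:
  fixes X :: real
  assumes "0 \<le> X"
  shows "(\<Sum>i<N. if 2 ^ (j + i) \<le> X then 2 ^ (j + i) else 0) \<le> 2 * X"
proof (induction N)
  case (Suc N)
  show ?case
  proof (cases "2 ^ (j + N) \<le> X")
    case True
    have "(\<Sum>i<N. if 2 ^ (j + i) \<le> X then 2 ^ (j + i) else 0) \<le> (\<Sum>i<N. (2::real) ^ (j + i))"
      by (intro sum_mono) auto
    also have "\<dots> \<le> 2 ^ (j + N)" by (induction N) auto
    finally show ?thesis using True by simp
  qed (use Suc in simp)
qed (use assms in simp)

text \<open>From 2^m \<le> D v follows m \<le> (ln D + ln (2 + v)) / ln 2. The additive constants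
  are absorbed by ln (2 + v) \<ge> ln 2.\<close>

definition log_factor :: "real \<Rightarrow> real" where
  "log_factor D = 1 / ln 2 + (ln D / ln 2 + 3) / ln 2"

lemma dyadic_index_le:
  assumes D: "1 \<le> D" and v: "0 \<le> v" and le: "2 ^ m \<le> D * v"
  shows "real (m + 3) \<le> log_factor D * ln (2 + v)"
proof -
  have l2: "0 < ln (2::real)" by simp
  have L: "ln 2 \<le> ln (2 + v)" using v by (subst ln_le_cancel_iff) auto
  have "(0::real) < 2 ^ m" by simp
  then have Dv: "0 < D * v" using le by linarith
  then have v0: "0 < v" using D by (simp add: zero_less_mult_iff)
  have "real m * ln 2 = ln (2 ^ m)" by (simp add: ln_realpow)
  also have "\<dots> \<le> ln (D * v)" using le Dv by (subst ln_le_cancel_iff) auto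
  also have "\<dots> = ln D + ln v" using D v0 by (simp add: ln_mult)
  also have "\<dots> \<le> ln D + ln (2 + v)" using v0 by simp
  finally have "real m \<le> (ln D + ln (2 + v)) / ln 2" using l2 by (simp add: pos_le_divide_eq)
  then have "real (m + 3) \<le> ln (2 + v) / ln 2 + (ln D / ln 2 + 3) * 1" by (simp add: add_divide_distrib)
  also have "\<dots> \<le> ln (2 + v) / ln 2 + (ln D / ln 2 + 3) * (ln (2 + v) / ln 2)"
    using L l2 D by (intro add_left_mono mult_left_mono) (auto simp: pos_le_divide_eq)
  also have "\<dots> = log_factor D * ln (2 + v)" by (simp add: log_factor_def algebra_simps)
  finally show ?thesis .
qed

lemma log_factor_nonneg: "1 \<le> D \<Longrightarrow> 0 \<le> log_factor D"
  by (simp add: log_factor_def)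

text \<open>Every active weight is at most the k-th power of a multiple of the logarithm. What
  remains is a geometric series of sum at most 2 D v, so summing over levels adds no further
  logarithm.\<close>

lemma dyadic_weight_bound:
  fixes v D :: real
  assumes v: "0 \<le> v" and D: "1 \<le> D"
  shows "(\<Sum>i. ennreal (real (Suc k) * real (j + i + 3) ^ k * 2 ^ (j + i)) * (if 2 ^ (j + i) \<le> D * v then 1 else 0))
    \<le> ennreal (2 * D * real (Suc k) * log_factor D ^ k * (v * ln (2 + v) ^ k))"
proof (rule suminf_le_const[OF summableI])
  fix N
  let ?a = "\<lambda>i. real (Suc k) * real (j + i + 3) ^ k * 2 ^ (j + i)"
  let ?L = "log_factor D * ln (2 + v)"
  have L0: "0 \<le> ?L" using log_factor_nonneg[OF D] v by (intro mult_nonneg_nonneg) auto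
  have "(\<Sum>i<N. ennreal (?a i) * (if 2 ^ (j + i) \<le> D * v then 1 else 0))
    = (\<Sum>i<N. ennreal (if 2 ^ (j + i) \<le> D * v then ?a i else 0))"
    by (intro sum.cong) auto
  also have "\<dots> = ennreal (\<Sum>i<N. if 2 ^ (j + i) \<le> D * v then ?a i else 0)"
    by (intro sum_ennreal) auto
  also have "\<dots> \<le> ennreal (\<Sum>i<N. real (Suc k) * ?L ^ k * (if 2 ^ (j + i) \<le> D * v then 2 ^ (j + i) else 0))"
  proof (intro ennreal_leI sum_mono)
    fix i
    show "(if 2 ^ (j + i) \<le> D * v then ?a i else 0)
      \<le> real (Suc k) * ?L ^ k * (if 2 ^ (j + i) \<le> D * v then 2 ^ (j + i) else 0)"
    proof (cases "2 ^ (j + i) \<le> D * v")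
      case True
      have "real (j + i + 3) ^ k \<le> ?L ^ k" using dyadic_index_le[OF D v True] by (intro power_mono) auto
      then have "?a i \<le> real (Suc k) * ?L ^ k * 2 ^ (j + i)"
        by (intro mult_right_mono mult_left_mono) auto
      then show ?thesis using True by simp
    qed simp
  qed
  also have "\<dots> \<le> ennreal (real (Suc k) * ?L ^ k * (2 * (D * v)))"
    unfolding sum_distrib_left[symmetric]
    using v D L0 by (intro ennreal_leI mult_left_mono dyadic_sum_le mult_nonneg_nonneg) auto
  also have "real (Suc k) * ?L ^ k * (2 * (D * v)) = 2 * D * real (Suc k) * log_factor D ^ k * (v * ln (2 + v) ^ k)"
    by (simp add: power_mult_distrib)
  finally show "(\<Sum>i<N. ennreal (?a i) * (if 2 ^ (j + i) \<le> D * v then 1 else 0))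
    \<le> ennreal (2 * D * real (Suc k) * log_factor D ^ k * (v * ln (2 + v) ^ k))" .
qed

text \<open>The first summand pays for the levels below the threshold, the second for the covering
  argument above it. Enlarging D to at least 1 keeps \<open>ln D\<close> nonnegative.\<close>

definition final_const :: "real \<Rightarrow> real \<Rightarrow> real \<Rightarrow> real \<Rightarrow> nat \<Rightarrow> nat \<Rightarrow> real" where
  "final_const lam Lam c \<theta> n k =
    (let D = max 1 (2 * portion_const lam Lam c n); j = nat \<lceil>threshold Lam c \<theta> n\<rceil>
     in real (j + 3) ^ Suc k / ln 2 ^ k
        + (2 ^ dilation_exp \<theta>) ^ n * (2 * D * real (Suc k) * log_factor D ^ k))"

section \<open>Integration of the level set estimate\<close>

context ma_dirichlet
begin

lemma dilate_three_quarters: "dilate (3/4) x0 U = big"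
  by (simp add: dilate_def big_def)

lemma dilate_half_subset: "dilate (1/2) x0 U \<subseteq> half" "dilate (1/2) x0 U \<subseteq> big"
proof -
  have p: "x0 + 2 *\<^sub>R (y - x0) \<in> U" if "y \<in> dilate (1/2) x0 U" for y using that by (simp add: dilate_def)
  show "dilate (1/2) x0 U \<subseteq> half"
  proof
    fix y assume "y \<in> dilate (1/2) x0 U"
    then have "x0 + 2 *\<^sub>R (y - x0) \<in> closure U" using p closure_subset by blast
    moreover have "y = x0 + (1/2) *\<^sub>R ((x0 + 2 *\<^sub>R (y - x0)) - x0)" by simp
    ultimately show "y \<in> half" unfolding half_def by blast
  qed
  show "dilate (1/2) x0 U \<subseteq> big"
  proof
    fix y assume y: "y \<in> dilate (1/2) x0 U"
    have "x0 + (2/3) *\<^sub>R ((x0 + 2 *\<^sub>R (y - x0)) - x0) \<in> U"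
      by (rule convex_segment_mem[OF convex_U x0 p[OF y]]) auto
    then show "y \<in> big" by (simp add: big_def)
  qed
qed

text \<open>The pointwise decomposition of \<open>dyadic_log_bound\<close> is integrated,
  \<open>superlevel_integral_le\<close> is used at each level 2^(j+i), and after interchanging sum
  and integral \<open>dyadic_weight_bound\<close> recombines the levels pointwise on
  \<open>big\<close>.\<close>

theorem log_integral_le:
  "(\<integral>\<^sup>+x\<in>dilate (1/2) x0 U. ennreal (hnorm x * ln (2 + hnorm x) ^ Suc k) \<partial>lebesgue)
   \<le> ennreal (final_const lam Lam c \<theta> CARD('n) k) *
     (\<integral>\<^sup>+x\<in>dilate (3/4) x0 U. ennreal (hnorm x * ln (2 + hnorm x) ^ k) \<partial>lebesgue)"
proof -
  define D where "D = max 1 (2 * portion_const lam Lam c CARD('n))"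
  \<comment> \<open>Since 2^j \<ge> j, all levels from 2^j on lie above the threshold.\<close>
  define j where "j = nat \<lceil>threshold Lam c \<theta> CARD('n)\<rceil>"
  define K where "K = (2::real) ^ dilation_exp \<theta>"
  define A where "A = real (j + 3) ^ Suc k"
  define E where "E = 2 * D * real (Suc k) * log_factor D ^ k"
  have D: "1 \<le> D" by (simp add: D_def)
  have E0: "0 \<le> E" using D log_factor_nonneg[OF D] by (auto simp: E_def intro!: mult_nonneg_nonneg)
  have K0: "0 \<le> K" by (simp add: K_def)
  have A0: "0 \<le> A" by (simp add: A_def)
  have bigU: "big \<subseteq> U" and halfU: "half \<subseteq> U" using bigD halfD by blast+
  have f0: "0 \<le> hnorm y" for y by (rule mnorm_nonneg)
  have L0: "ln 2 \<le> ln (2 + hnorm y)" "0 \<le> ln (2 + hnorm y)" for y using f0[of y] by auto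
  have cb: "continuous_on big hnorm" by (rule continuous_on_subset[OF continuous_mnorm_hessian bigU])
  have cl: "continuous_on big (\<lambda>y. hnorm y * ln (2 + hnorm y) ^ k)"
    using f0 by (intro continuous_intros cb) (metis add_nonneg_pos less_numeral_extra(3) add.commute zero_less_numeral)
  have mU: "(\<lambda>y. ennreal (hnorm y) * indicator U y) \<in> borel_measurable borel"
    by (rule borel_measurable_ennreal_indicator[OF open_U continuous_mnorm_hessian])
  have mL: "(\<lambda>y. ennreal (hnorm y * ln (2 + hnorm y) ^ k) * indicator big y) \<in> borel_measurable borel"
    by (rule borel_measurable_ennreal_indicator[OF open_big cl])
  let ?F = "\<lambda>i. {y\<in>half. 2 ^ (j + i) \<le> hnorm y}" and ?G = "\<lambda>i. {y\<in>big. 2 ^ (j + i) \<le> D * hnorm y}"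
  let ?w = "\<lambda>i. real (Suc k) * real (j + i + 3) ^ k"
  let ?I = "\<lambda>i. \<integral>\<^sup>+y. ennreal (hnorm y) * indicator (?F i) y \<partial>lborel"
  let ?g = "\<lambda>y. ennreal (hnorm y * ln (2 + hnorm y) ^ k) * indicator big y"
  let ?h = "\<lambda>i y. ennreal (K ^ CARD('n)) * (ennreal (?w i * 2 ^ (j + i)) * indicator (?G i) y)"
  let ?J = "\<integral>\<^sup>+y. ?g y \<partial>lborel"
  have Fm: "?F i \<in> sets borel" for i
    by (intro borel_closed compact_imp_closed compact_half_superlevel)
  have Gm: "?G i \<in> sets borel" for i by (rule borel_superlevel[OF open_big bigU])
  have mF: "(\<lambda>y. ennreal (hnorm y) * indicator (?F i) y) \<in> borel_measurable borel" for i
  proof -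
    \<comment> \<open>Continuity of the Hessian norm is known only on \<open>U\<close>, so
      measurability is obtained by inserting the indicator of \<open>U\<close>, which contains
      \<open>half\<close>.\<close>
    have "(\<lambda>y. (ennreal (hnorm y) * indicator U y) * indicator (?F i) y) \<in> borel_measurable borel"
      by (intro borel_measurable_times_ennreal mU borel_measurable_indicator Fm)
    moreover have "(\<lambda>y. (ennreal (hnorm y) * indicator U y) * indicator (?F i) y) = (\<lambda>y. ennreal (hnorm y) * indicator (?F i) y)"
      using halfU by (intro ext) (auto simp: indicator_def)
    ultimately show ?thesis by simp
  qed
  have key: "?I i
     \<le> ennreal (2 ^ (j + i) * K ^ CARD('n)) * emeasure lborel (?G i)" for i
  proof -
    have "threshold Lam c \<theta> CARD('n) \<le> real j" unfolding j_def by linarith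
    also have "\<dots> \<le> 2 ^ j" using of_nat_less_two_power[of j] by (simp add: less_imp_le)
    also have "\<dots> \<le> 2 ^ (j + i)" by (intro power_increasing) auto
    finally have "threshold Lam c \<theta> CARD('n) \<le> 2 ^ (j + i)" .
    then have "?I i
      \<le> ennreal (2 ^ (j + i) * K ^ CARD('n)) * emeasure lborel {y\<in>big. 2 ^ (j + i) \<le> 2 * portion_const lam Lam c CARD('n) * hnorm y}"
      unfolding K_def by (rule superlevel_integral_le) simp
    also have "\<dots> \<le> ennreal (2 ^ (j + i) * K ^ CARD('n)) * emeasure lborel (?G i)"
    proof (intro mult_left_mono emeasure_mono)
      have "2 * portion_const lam Lam c CARD('n) * hnorm y \<le> D * hnorm y" for y
        using f0 by (intro mult_right_mono) (auto simp: D_def)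
      then show "{y\<in>big. 2 ^ (j + i) \<le> 2 * portion_const lam Lam c CARD('n) * hnorm y} \<subseteq> ?G i"
        by (auto intro: order_trans)
    qed (use Gm in auto)
    finally show ?thesis .
  qed
  have fL: "ennreal (A * hnorm y) * indicator big y \<le> ennreal (A / ln 2 ^ k) * ?g y" for y
  proof -
    have "ln 2 ^ k \<le> ln (2 + hnorm y) ^ k" using L0(1) by (intro power_mono) auto
    then have "A / ln 2 ^ k * (hnorm y * ln 2 ^ k) \<le> A / ln 2 ^ k * (hnorm y * ln (2 + hnorm y) ^ k)"
      using A0 f0 by (intro mult_left_mono) auto
    then have "A * hnorm y \<le> A / ln 2 ^ k * (hnorm y * ln (2 + hnorm y) ^ k)" by simp
    then have "ennreal (A * hnorm y) \<le> ennreal (A / ln 2 ^ k * (hnorm y * ln (2 + hnorm y) ^ k))" by (rule ennreal_leI)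
    also have "\<dots> = ennreal (A / ln 2 ^ k) * ennreal (hnorm y * ln (2 + hnorm y) ^ k)"
      using A0 f0 L0 by (intro ennreal_mult) auto
    finally show ?thesis by (auto simp: indicator_def)
  qed
  have "(\<integral>\<^sup>+x\<in>dilate (1/2) x0 U. ennreal (hnorm x * ln (2 + hnorm x) ^ Suc k) \<partial>lebesgue)
    = (\<integral>\<^sup>+x. ennreal (hnorm x * ln (2 + hnorm x) ^ Suc k) * indicator (dilate (1/2) x0 U) x \<partial>lborel)"
    by (rule nn_integral_completion)
  also have "\<dots> \<le> (\<integral>\<^sup>+y. ennreal (A / ln 2 ^ k) * ?g y
      + (\<Sum>i. ennreal (?w i) * (ennreal (hnorm y) * indicator (?F i) y)) \<partial>lborel)"
  proof (intro nn_integral_mono)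
    fix y
    show "ennreal (hnorm y * ln (2 + hnorm y) ^ Suc k) * indicator (dilate (1/2) x0 U) y
      \<le> ennreal (A / ln 2 ^ k) * ?g y
      + (\<Sum>i. ennreal (?w i) * (ennreal (hnorm y) * indicator (?F i) y))"
    proof (cases "y \<in> dilate (1/2) x0 U")
      case True
      then have yb: "y \<in> big" "y \<in> half" using dilate_half_subset by blast+
      have "ennreal (hnorm y * ln (2 + hnorm y) ^ Suc k) \<le> ennreal (A * hnorm y)
        + (\<Sum>i. ennreal (?w i * hnorm y) * (if 2 ^ (j + i) \<le> hnorm y then 1 else 0))"
        unfolding A_def by (rule dyadic_log_bound[OF f0])
      also have "(\<Sum>i. ennreal (?w i * hnorm y) * (if 2 ^ (j + i) \<le> hnorm y then 1 else 0))
        = (\<Sum>i. ennreal (?w i) * (ennreal (hnorm y) * indicator (?F i) y))"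
        using f0 yb by (intro suminf_cong) (simp add: ennreal_mult)
      also have "ennreal (A * hnorm y) \<le> ennreal (A / ln 2 ^ k) * ?g y"
        using fL[of y] yb by simp
      finally show ?thesis using True by simp
    qed simp
  qed
  also have "\<dots> = ennreal (A / ln 2 ^ k) * ?J + (\<Sum>i. ennreal (?w i) * ?I i)"
    using mL mF by (simp add: nn_integral_add nn_integral_cmult nn_integral_suminf)
  also have "\<dots> \<le> ennreal (A / ln 2 ^ k) * ?J + ennreal (K ^ CARD('n) * E) * ?J"
  proof (intro add_left_mono)
    have "(\<Sum>i. ennreal (?w i) * ?I i)
      \<le> (\<Sum>i. ennreal (?w i) * (ennreal (2 ^ (j + i) * K ^ CARD('n)) * emeasure lborel (?G i)))"
      by (intro suminf_le summableI mult_left_mono key) auto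
    also have "\<dots> = (\<Sum>i. \<integral>\<^sup>+y. ?h i y \<partial>lborel)"
    proof (rule suminf_cong)
      fix i
      have "ennreal (?w i) * (ennreal (2 ^ (j + i) * K ^ CARD('n)) * emeasure lborel (?G i))
        = ennreal (K ^ CARD('n)) * (ennreal (?w i * 2 ^ (j + i)) * emeasure lborel (?G i))"
        using K0 by (simp add: ennreal_mult mult_ac)
      also have "\<dots> = (\<integral>\<^sup>+y. ?h i y \<partial>lborel)"
        using Gm[of i] by (simp add: nn_integral_cmult nn_integral_cmult_indicator)
      finally show "ennreal (?w i) * (ennreal (2 ^ (j + i) * K ^ CARD('n)) * emeasure lborel (?G i))
        = (\<integral>\<^sup>+y. ?h i y \<partial>lborel)" .
    qed
    also have "\<dots> = (\<integral>\<^sup>+y. (\<Sum>i. ?h i y) \<partial>lborel)"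
      by (intro nn_integral_suminf[symmetric] borel_measurable_times_ennreal borel_measurable_const
          borel_measurable_indicator) (simp add: Gm)
    also have "\<dots> \<le> (\<integral>\<^sup>+y. ennreal (K ^ CARD('n) * E) * ?g y \<partial>lborel)"
    proof (intro nn_integral_mono)
      fix y
      show "(\<Sum>i. ?h i y)
        \<le> ennreal (K ^ CARD('n) * E) * ?g y"
      proof (cases "y \<in> big")
        case True
        have "(\<Sum>i. ?h i y)
          = ennreal (K ^ CARD('n)) * (\<Sum>i. ennreal (?w i * 2 ^ (j + i)) * (if 2 ^ (j + i) \<le> D * hnorm y then 1 else 0))"
          using True by (subst ennreal_suminf_cmult[symmetric]) (simp add: indicator_def of_bool_def)
        also have "\<dots> \<le> ennreal (K ^ CARD('n)) * ennreal (E * (hnorm y * ln (2 + hnorm y) ^ k))"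
          unfolding E_def by (intro mult_left_mono dyadic_weight_bound f0 D) auto
        also have "\<dots> = ennreal (K ^ CARD('n) * E) * ennreal (hnorm y * ln (2 + hnorm y) ^ k)"
          using K0 E0 f0 L0 by (simp add: ennreal_mult mult.assoc)
        finally show ?thesis using True by simp
      qed simp
    qed
    also have "\<dots> = ennreal (K ^ CARD('n) * E) * ?J"
      using mL by (simp add: nn_integral_cmult)
    finally show "(\<Sum>i. ennreal (?w i) * ?I i) \<le> ennreal (K ^ CARD('n) * E) * ?J" .
  qed
  also have "\<dots> = ennreal (A / ln 2 ^ k + K ^ CARD('n) * E) * ?J"
    using A0 K0 E0 by (simp add: ennreal_plus distrib_right)
  also have "A / ln 2 ^ k + K ^ CARD('n) * E = final_const lam Lam c \<theta> CARD('n) k"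
    by (simp only: final_const_def Let_def A_def K_def E_def D_def j_def)
  also have "?J = (\<integral>\<^sup>+x\<in>dilate (3/4) x0 U. ennreal (hnorm x * ln (2 + hnorm x) ^ k) \<partial>lebesgue)"
    unfolding dilate_three_quarters by (rule nn_integral_completion[symmetric])
  finally show ?thesis .
qed

end

theorem theorem3p1:
  fixes lam Lam :: real and k :: nat
  assumes "0 < lam" and "0 < Lam"
  shows "\<exists>C::real. \<forall>(U :: (real^'n) set) (u :: real^'n \<Rightarrow> real) x0.
     open U \<and> bounded U \<and> convex U \<and> ball 0 1 \<subseteq> U \<and> U \<subseteq> ball 0 (real CARD('n)) \<and>
     convex_on (closure U) u \<and> C2_on U u \<and> continuous_on (closure U) u \<and>
     (\<forall>x\<in>U. lam \<le> det (hessian u x) \<and> det (hessian u x) \<le> Lam) \<and>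
     (\<forall>x\<in>frontier U. u x = 0) \<and>
     x0 \<in> U \<and> (\<forall>y\<in>U. u x0 \<le> u y)
     \<longrightarrow>
     (\<integral>\<^sup>+ x\<in>dilate (1/2) x0 U. ennreal (mnorm (hessian u x) * (ln (2 + mnorm (hessian u x))) ^ (k+1)) \<partial>lebesgue)
       \<le> ennreal C * (\<integral>\<^sup>+ x\<in>dilate (3/4) x0 U. ennreal (mnorm (hessian u x) * (ln (2 + mnorm (hessian u x))) ^ k) \<partial>lebesgue)"
proof -
  \<comment> \<open>Fixed before \<open>U\<close>, \<open>u\<close> and \<open>x0\<close>, so the
    constant depends on n, \<open>lam\<close>, \<open>Lam\<close> and k alone.\<close>
  let ?c = "balance lam Lam CARD('n)"
  let ?C = "final_const lam Lam ?c (1 + 1 / ?c) CARD('n) k"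
  show ?thesis
  proof (intro exI[of _ ?C] allI impI, elim conjE, goal_cases)
    case (1 U u x0)
    interpret ma_dirichlet U u lam Lam ?c "1 + 1 / ?c" x0
      by unfold_locales (use assms 1 in auto)
    show ?case using log_integral_le[of k] by simp
  qed
qed

end
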